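(* Let $n\ge 4$ and let $K$ and $L$ be two convex bodies in $\mathbb{R}^n$, each having countably many diameters. Assume that there exists $\zeta\in S^{n-1}$ such that $K$ has a diameter $d_K(\zeta)$ parallel to $\zeta$ and such that for every $3$-dimensional subspace $H$ of $\mathbb{R}^n$ containing $\zeta$ the projections $K|H$ and $L|H$ are directly congruent. Assume also that for every such $H$ the projections $K|H$, $L|H$ have no $(\zeta,\pi)$-symmetry and no $(u,\pi)$-symmetry for any $u\in\zeta^\perp\cap H\cap S^{n-1}$. Then $K=L+b$ or $K=\mathcal{O}L+b$ for some $b\in\mathbb{R}^n$, where $\mathcal{O}=\mathcal{O}_\zeta\in O(n)$ is the orthogonal transformation with $\mathcal{O}|_{\zeta^\perp}=-I$ and $\mathcal{O}(\zeta)=\zeta$. If, in addition, for all $3$-dimensional subspaces $G$ of $\zeta^\perp$ the projections $K|G$ and $L|G$ are directly congruent and have no rigid motion symmetries, then $K=L+b$ for some $b\in\mathbb{R}^n$.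
   Context: A convex body in $\mathbb{R}^n$ is a compact convex set equal to the closure of its non-empty interior. $\zeta^\perp$ is the hyperplane through the origin orthogonal to $\zeta\in S^{n-1}$, and $K|H$ is the orthogonal projection of $K$ onto the subspace $H$. The support function is $h_K(x)=\max\{x\cdot y: y\in K\}$ and the width function is $\omega_K(x)=h_K(x)+h_K(-x)$, $x\in S^{n-1}$. A segment $[z,y]\subset K$ is a diameter of the convex body $K$ if $|z-y|=\max_{\theta\in S^{n-1}}\omega_K(\theta)$. $K$ has at most one diameter parallel to a given direction $\zeta\in S^{n-1}$; if it exists it is denoted $d_K(\zeta)$. $K$ has countably many diameters if $\omega_K$ attains its maximum on a countable subset of $S^{n-1}$. For a subspace $H$ of dimension $k$, sets $A,B\subset H$ are directly congruent if there is a rotation $\varphi\in SO(k,H)$ of $H$ such that $\varphi(A)$ is a translate of $B$. A set $D\subset H$ has a rigid motion symmetry if $\varphi(D)=D+a$ for some $a\in H$ and some non-identity orthogonal transformation $\varphi\in O(k,H)$ of $H$. If $\dim H=3$ and $\xi\in H\cap S^{n-1}$, then $D\subset H$ has a $(\xi,\pi)$-symmetry if $\varphi(D)=D+a$ for some $a\in H$, where $\varphi\in SO(3,H)$ is the rotation by the angle $\pi$ with $\varphi(\xi)=\xi$. *)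

theory Defs
  imports "HOL-Analysis.Analysis"
begin

definition convex_body :: "(real^'n) set \<Rightarrow> bool" where
  "convex_body K \<longleftrightarrow> compact K \<and> convex K \<and> interior K \<noteq> {} \<and> K = closure (interior K)"

definition orth_proj :: "(real^'n) set \<Rightarrow> (real^'n) set \<Rightarrow> (real^'n) set" where
  "orth_proj K H = {y \<in> H. \<exists>x\<in>K. x - y \<in> H\<^sup>\<bottom>}"

text \<open>The supremum is a maximum whenever \<open>K\<close> is compact and non-empty.\<close>

definition support_fun :: "(real^'n) set \<Rightarrow> real^'n \<Rightarrow> real" where
  "support_fun K x = (SUP y\<in>K. x \<bullet> y)"

definition width_fun :: "(real^'n) set \<Rightarrow> real^'n \<Rightarrow> real" where
  "width_fun K x = support_fun K x + support_fun K (- x)"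

definition max_width_directions :: "(real^'n) set \<Rightarrow> (real^'n) set" where
  "max_width_directions K =
     {\<theta> \<in> sphere 0 1. \<forall>\<theta>' \<in> sphere 0 1. width_fun K \<theta>' \<le> width_fun K \<theta>}"

text \<open>The segment with end points \<open>z\<close> and \<open>y\<close> is a diameter of \<open>K\<close>: its length is the
  maximal width. (The library's \<open>diameter K\<close> is a number, not a segment.)\<close>

definition is_diameter :: "(real^'n) set \<Rightarrow> real^'n \<Rightarrow> real^'n \<Rightarrow> bool" where
  "is_diameter K z y \<longleftrightarrow>
     closed_segment z y \<subseteq> K \<and> (\<exists>\<theta> \<in> max_width_directions K. norm (z - y) = width_fun K \<theta>)"

definition has_diameter_parallel :: "(real^'n) set \<Rightarrow> real^'n \<Rightarrow> bool" where
  "has_diameter_parallel K \<zeta> \<longleftrightarrow> (\<exists>z y c. is_diameter K z y \<and> z - y = c *\<^sub>R \<zeta>)"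

definition countably_many_diameters :: "(real^'n) set \<Rightarrow> bool" where
  "countably_many_diameters K \<longleftrightarrow> countable (max_width_directions K)"

text \<open>An orthogonal transformation of the subspace \<open>H\<close> is represented by its unique extension
  to the whole space that is the identity on the orthogonal complement of \<open>H\<close>. Such an
  extension maps \<open>H\<close> onto itself, has the same determinant as its restriction to \<open>H\<close>, and is
  the identity exactly if the restriction is.\<close>

definition O_on :: "(real^'n) set \<Rightarrow> (real^'n \<Rightarrow> real^'n) set" where
  "O_on H = {\<phi>. orthogonal_transformation \<phi> \<and> (\<forall>x \<in> H\<^sup>\<bottom>. \<phi> x = x)}"

definition SO_on :: "(real^'n) set \<Rightarrow> (real^'n \<Rightarrow> real^'n) set" where
  "SO_on H = {\<phi> \<in> O_on H. det (matrix \<phi>) = 1}"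

definition directly_congruent :: "(real^'n) set \<Rightarrow> (real^'n) set \<Rightarrow> (real^'n) set \<Rightarrow> bool" where
  "directly_congruent H A B \<longleftrightarrow> (\<exists>\<phi> \<in> SO_on H. \<exists>a \<in> H. \<phi> ` A = (+) a ` B)"

definition rigid_motion_symmetry :: "(real^'n) set \<Rightarrow> (real^'n) set \<Rightarrow> bool" where
  "rigid_motion_symmetry H D \<longleftrightarrow> (\<exists>\<phi> \<in> O_on H. \<phi> \<noteq> id \<and> (\<exists>a \<in> H. \<phi> ` D = (+) a ` D))"

text \<open>For a 3-dimensional subspace \<open>H\<close> and a unit vector \<open>\<xi>\<close> in \<open>H\<close>, the rotation of \<open>H\<close> about
  \<open>\<xi>\<close> by the angle \<open>\<pi>\<close> acts on the plane orthogonal to \<open>\<xi>\<close> in \<open>H\<close> as the negative of the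
  identity.\<close>

definition pi_symmetry :: "(real^'n) set \<Rightarrow> real^'n \<Rightarrow> (real^'n) set \<Rightarrow> bool" where
  "pi_symmetry H \<xi> D \<longleftrightarrow>
     (\<exists>\<phi> \<in> SO_on H. \<phi> \<xi> = \<xi> \<and> (\<forall>x \<in> H. orthogonal x \<xi> \<longrightarrow> \<phi> x = - x) \<and>
        (\<exists>a \<in> H. \<phi> ` D = (+) a ` D))"

definition O_zeta :: "real^'n \<Rightarrow> real^'n \<Rightarrow> real^'n" where
  "O_zeta \<zeta> x = (2 * (x \<bullet> \<zeta>)) *\<^sub>R \<zeta> - x"

lemma O_zeta_properties:
  fixes \<zeta> :: "real^'n"
  assumes "norm \<zeta> = 1"
  shows "orthogonal_transformation (O_zeta \<zeta>)"
    and "O_zeta \<zeta> \<zeta> = \<zeta>"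
    and "\<And>x. x \<in> {\<zeta>}\<^sup>\<bottom> \<Longrightarrow> O_zeta \<zeta> x = - x"
proof -
  have z: "\<zeta> \<bullet> \<zeta> = 1"
    using assms by (simp add: dot_square_norm)
  have "linear (O_zeta \<zeta>)"
    by (rule linearI) (simp_all add: O_zeta_def inner_add_left algebra_simps)
  moreover have "O_zeta \<zeta> x \<bullet> O_zeta \<zeta> y = x \<bullet> y" for x y
    by (simp add: O_zeta_def inner_diff_left inner_diff_right z inner_commute)
  ultimately show "orthogonal_transformation (O_zeta \<zeta>)"
    by (simp add: orthogonal_transformation_def)
  show "O_zeta \<zeta> \<zeta> = \<zeta>"
    by (simp add: O_zeta_def z scaleR_2)
  show "O_zeta \<zeta> x = - x" if "x \<in> {\<zeta>}\<^sup>\<bottom>" for x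
    using that by (simp add: O_zeta_def orthogonal_comp_def orthogonal_def inner_commute)
qed

end

theory Submission
  imports Defs
begin

text \<open>
  Translate so that the diameters of \<open>K\<close> and \<open>L\<close> parallel to \<open>\<zeta>\<close> coincide and are centred at the
  origin. Since \<open>L\<close> has only countably many diameters, for a dense set of 3-dimensional subspaces
  \<open>H\<close> through \<open>\<zeta>\<close> the congruence of the projections maps \<open>\<zeta>\<close> to \<open>\<plusminus>\<zeta>\<close> and involves no translation;
  by compactness such a congruence then exists for every \<open>H\<close>. With \<open>F t v = h\<^sub>K (v + t *\<^sub>R \<zeta>)\<close> and
  \<open>G t v = h\<^sub>L (v + t *\<^sub>R \<zeta>)\<close> this says that on every great circle of the unit sphere of the hyperplane
  orthogonal to \<open>\<zeta>\<close>, either \<open>F\<close> is obtained from \<open>G\<close> by a rotation of the circle, or it is obtained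
  by a reflection together with \<open>t \<mapsto> - t\<close>. Both cannot happen on the same circle by the assumption
  on \<open>(u, \<pi>)\<close>-symmetries, so by connectedness one of them holds on all circles.

  Reflections on all circles are impossible: some fixed multiple of the angle of the reflection
  axis would be a continuous function on the pairs of orthonormal vectors that winds around the
  circle a nonzero number of times along a loop homotopic to its inverse.

  For rotations, injectivity of the Funk transform applied to \<open>F t\<close> and \<open>F t * F u\<close> shows that at each
  point \<open>v\<close> either \<open>F t v = G t v\<close> for all \<open>t\<close> or \<open>F t v = G t (- v)\<close> for all \<open>t\<close>. If both kinds of
  points occurred essentially on one circle, then on all neighbouring circles the zero set \<open>Z\<close> of
  the odd part of \<open>F\<close> would be nonempty, proper and invariant under the rotation. Irrational
  rotations are excluded by density of orbits; otherwise, by Baire, the angle can be taken constant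
  on an open set of circles, and walking along these circles shows that \<open>Z\<close> contains a whole circle,
  a \<open>(\<zeta>, \<pi>)\<close>-symmetry. Hence \<open>F t v = G t v\<close> throughout or \<open>F t v = G t (- v)\<close> throughout.
\<close>

section \<open>Circles in the hyperplane orthogonal to a vector\<close>

text \<open>A diameter of \<open>L\<close> parallel to \<zeta> is not assumed. It appears because a
  congruence sends \<zeta> to one of the countably many directions of maximal width of
  \<open>L\<close>, while a generic subspace contains no such direction off the line of \<zeta>. The
  bodies themselves are never moved: a linear term \<open>m \<bullet> x\<close> is subtracted from
  the support function instead. By homogeneity, the values at \<open>v + t *\<^sub>R \<zeta>\<close>
  for all \<open>t\<close> recover the support function, and the whole family in \<open>t\<close> is
  kept because products of two members fix one common sign for all \<open>t\<close>. The obstacle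
  throughout is that the angle belonging to a circle is determined only up to the symmetries of
  \<open>F\<close> there, so it is not a continuous function of the circle. For reflections these
  symmetries have bounded order, and a common multiple makes the angle well defined modulo a full
  turn. For rotations no such global choice is made; Baire supplies an open set with a constant
  angle instead. Dimension at least four leaves room for a third orthonormal vector in the
  hyperplane, so that circles can be tilted.\<close>

definition opair :: "'a::euclidean_space \<Rightarrow> ('a \<times> 'a) set" where
  "opair \<zeta> = {(x, y). norm x = 1 \<and> norm y = 1 \<and> x \<bullet> y = 0 \<and> \<zeta> \<bullet> x = 0 \<and> \<zeta> \<bullet> y = 0}"

definition circ :: "'a::real_normed_vector \<times> 'a \<Rightarrow> real \<Rightarrow> 'a" where
  "circ p s = cos s *\<^sub>R fst p + sin s *\<^sub>R snd p"

text \<open>The same oriented circle with its base point moved by the angle \<open>a\<close>. Pairs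
  thus carry more data than circles, and how an angle changes under \<open>rot\<close> decides the
  topological argument.\<close>

definition rot :: "'a::real_normed_vector \<times> 'a \<Rightarrow> real \<Rightarrow> 'a \<times> 'a" where
  "rot p a = (circ p a, circ p (a + pi / 2))"

lemma circ_0 [simp]: "circ p 0 = fst p"
  by (simp add: circ_def)

lemma circ_add_pi [simp]: "circ p (s + pi) = - circ p s"
  by (simp add: circ_def)

lemma circ_add_2pi: "circ p (s + 2 * pi * of_int n) = circ p s"
proof -
  have "cos (s + 2 * pi * of_int n) = cos s" "sin (s + 2 * pi * of_int n) = sin s"
    by (simp_all add: cos_add sin_add)
  thus ?thesis by (simp add: circ_def)
qed

lemma rot_eq: "rot p a = (cos a *\<^sub>R fst p + sin a *\<^sub>R snd p, cos a *\<^sub>R snd p - sin a *\<^sub>R fst p)"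
  by (simp add: rot_def circ_def cos_add sin_add)

lemma circ_rot [simp]: "circ (rot p a) s = circ p (a + s)"
  by (simp add: rot_eq circ_def cos_add sin_add algebra_simps)

lemma rot_rot [simp]: "rot (rot p a) b = rot p (a + b)"
  by (simp add: rot_def[of "rot p a"] rot_def[of p "a + b"] add.assoc)

lemma rot_0 [simp]: "rot p 0 = p"
  by (simp add: rot_eq)

lemma circ_minus: "circ (x, - y) s = circ (x, y) (- s)"
  by (simp add: circ_def)

lemma opair_iff: "p \<in> opair \<zeta> \<longleftrightarrow> norm (fst p) = 1 \<and> norm (snd p) = 1 \<and> fst p \<bullet> snd p = 0
    \<and> \<zeta> \<bullet> fst p = 0 \<and> \<zeta> \<bullet> snd p = 0"
  by (auto simp: opair_def)

lemma rot_in_opair [simp]: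
  assumes "p \<in> opair \<zeta>" shows "rot p a \<in> opair \<zeta>"
proof -
  obtain x y where p: "p = (x, y)" by fastforce
  have xy: "x \<bullet> x = 1" "y \<bullet> y = 1" "x \<bullet> y = 0" "y \<bullet> x = 0" "\<zeta> \<bullet> x = 0" "\<zeta> \<bullet> y = 0"
    using assms by (auto simp: p opair_def norm_eq_1 inner_commute)
  show ?thesis
    by (simp add: p opair_iff rot_eq norm_eq_1 inner_add_left inner_add_right inner_diff_left
        inner_diff_right xy flip: power2_eq_square)
qed

lemma norm_circ [simp]: "p \<in> opair \<zeta> \<Longrightarrow> norm (circ p s) = 1"
  and inner_circ [simp]: "p \<in> opair \<zeta> \<Longrightarrow> \<zeta> \<bullet> circ p s = 0"
  using rot_in_opair[of p \<zeta> s] by (auto simp: opair_iff rot_def)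

lemma swap_in_opair: "(x, y) \<in> opair \<zeta> \<Longrightarrow> (y, x) \<in> opair \<zeta>"
  and uminus_in_opair: "(x, y) \<in> opair \<zeta> \<Longrightarrow> (x, - y) \<in> opair \<zeta>"
  by (auto simp: opair_def inner_commute)

lemma closed_opair: "closed (opair \<zeta>)"
proof -
  have "opair \<zeta> = {p. norm (fst p) = 1} \<inter> {p. norm (snd p) = 1} \<inter> {p. fst p \<bullet> snd p = 0}
    \<inter> {p. \<zeta> \<bullet> fst p = 0} \<inter> {p. \<zeta> \<bullet> snd p = 0}"
    by (auto simp: opair_iff)
  moreover have "closed \<dots>"
    by (intro closed_Int closed_Collect_eq continuous_intros)
  ultimately show ?thesis by simp
qed

lemma compact_opair: "compact (opair \<zeta>)"
proof -
  have "opair \<zeta> \<subseteq> cball 0 1 \<times> cball 0 1"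
    by (auto simp: opair_def)
  then show ?thesis
    using closed_opair by (metis bounded_cball bounded_Times bounded_subset compact_eq_bounded_closed)
qed

lemma continuous_on_circ [continuous_intros]:
  fixes f :: "'b::t2_space \<Rightarrow> _"
  assumes "continuous_on A f" "continuous_on A g"
  shows "continuous_on A (\<lambda>x. circ (f x) (g x))"
  unfolding circ_def by (intro continuous_intros assms)

lemma tendsto_circ [tendsto_intros]:
  assumes "(f \<longlongrightarrow> p) Fi" "(g \<longlongrightarrow> s) Fi"
  shows "((\<lambda>x. circ (f x) (g x)) \<longlongrightarrow> circ p s) Fi"
  unfolding circ_def
  by (intro tendsto_intros assms isCont_tendsto_compose[OF isCont_cos] isCont_tendsto_compose[OF isCont_sin])

lemma continuous_on_rot [continuous_intros]:
  fixes f :: "'b::t2_space \<Rightarrow> _"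
  assumes "continuous_on A f" "continuous_on A g"
  shows "continuous_on A (\<lambda>x. rot (f x) (g x))"
  unfolding rot_def by (intro continuous_intros assms)

section \<open>Orthonormal frames in the hyperplane\<close>

lemma exists_unit_orthogonal_vector:
  fixes S :: "'a::euclidean_space set"
  assumes "finite S" "card S < DIM('a)"
  obtains w where "norm w = 1" "\<And>v. v \<in> S \<Longrightarrow> v \<bullet> w = 0"
proof -
  have "dim (span S) < DIM('a)"
    using assms dim_le_card'[of S] by simp
  then have "span S \<noteq> UNIV" by force
  then obtain a where a: "a \<noteq> 0" "\<And>x. x \<in> span S \<Longrightarrow> a \<bullet> x = 0"
    using span_not_UNIV_orthogonal by blast
  show thesis
  proof (rule that[of "(1 / norm a) *\<^sub>R a"])
    show "norm ((1 / norm a) *\<^sub>R a) = 1" using a by simp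
    show "v \<bullet> ((1 / norm a) *\<^sub>R a) = 0" if "v \<in> S" for v
      using a(2)[of v] that by (simp add: span_base inner_commute)
  qed
qed

text \<open>In dimension at least four the vectors \<open>x\<close>, \<open>y\<close>, \<zeta> leave
  an orthogonal direction. The extra vector \<open>w\<close> is what allows a circle to be
  tilted.\<close>

lemma opair_frame:
  fixes \<zeta> :: "'a::euclidean_space"
  assumes "4 \<le> DIM('a)" "(x, y) \<in> opair \<zeta>"
  obtains w where "(x, w) \<in> opair \<zeta>" "(y, w) \<in> opair \<zeta>"
proof -
  have "card {x, y, \<zeta>} \<le> 3" by (simp add: card_insert_if)
  with assms(1) have "card {x, y, \<zeta>} < DIM('a)" by linarith
  then obtain w where "norm w = 1" "\<And>v. v \<in> {x, y, \<zeta>} \<Longrightarrow> v \<bullet> w = 0"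
    by (rule exists_unit_orthogonal_vector[rotated]) auto
  then show thesis using assms(2) that[of w] by (auto simp: opair_def)
qed

lemma opair_nonempty:
  fixes \<zeta> x :: "'a::euclidean_space"
  assumes dim: "4 \<le> DIM('a)" and x: "norm x = 1" "\<zeta> \<bullet> x = 0"
  obtains y where "(x, y) \<in> opair \<zeta>"
proof -
  have "card {x, \<zeta>} \<le> 2" by (simp add: card_insert_if)
  with dim have "card {x, \<zeta>} < DIM('a)" by linarith
  then obtain y where "norm y = 1" "\<And>u. u \<in> {x, \<zeta>} \<Longrightarrow> u \<bullet> y = 0"
    by (rule exists_unit_orthogonal_vector[rotated]) auto
  then have "(x, y) \<in> opair \<zeta>" using x by (auto simp: opair_def)
  then show thesis by (rule that)
qed

lemma opair_snd_circ:
  assumes "(x, y) \<in> opair \<zeta>" "(x, w) \<in> opair \<zeta>" "(y, w) \<in> opair \<zeta>"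
  shows "(x, circ (y, w) u) \<in> opair \<zeta>"
proof -
  have "x \<bullet> circ (y, w) u = 0" using assms by (simp add: circ_def inner_add_right opair_def)
  then show ?thesis using norm_circ[OF assms(3), of u] inner_circ[OF assms(3), of u] assms(1)
    by (simp add: opair_def)
qed

lemma inner_circ_circ:
  assumes "p \<in> opair \<zeta>" shows "circ p a \<bullet> circ p b = cos (a - b)"
proof -
  obtain x y where xy: "p = (x, y)" by fastforce
  have "x \<bullet> x = 1" "y \<bullet> y = 1" "x \<bullet> y = 0" "y \<bullet> x = 0"
    using assms by (auto simp: xy opair_def norm_eq_1 inner_commute)
  then show ?thesis by (simp add: circ_def xy inner_add_left inner_add_right cos_diff)
qed

text \<open>The loops \<open>a \<mapsto> rot (x, y) a\<close> and \<open>a \<mapsto> rot (x, y) (- a)\<close> are rotations about opposite axes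
  of a 3-dimensional space, so they are homotopic and have equal winding numbers under \<open>\<mu>\<close>.\<close>

lemma no_equivariant_circle_map:
  fixes \<zeta> :: "'a::euclidean_space" and \<mu> :: "'a \<times> 'a \<Rightarrow> complex" and d :: real
  assumes dim: "4 \<le> DIM('a)" and p0: "p0 \<in> opair \<zeta>"
    and cont: "continuous_on (opair \<zeta>) \<mu>"
    and nz: "\<And>p. p \<in> opair \<zeta> \<Longrightarrow> \<mu> p \<noteq> 0"
    and equiv: "\<And>p a. p \<in> opair \<zeta> \<Longrightarrow> \<mu> (rot p a) = exp (\<i> * of_real (d * a)) * \<mu> p"
  shows "d = 0"
proof -
  obtain x y where p0_eq: "p0 = (x, y)" by fastforce
  with p0 have xy: "(x, y) \<in> opair \<zeta>" by simp
  obtain w where w: "(x, w) \<in> opair \<zeta>" "(y, w) \<in> opair \<zeta>"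
    using opair_frame[OF dim xy] .
  \<comment> \<open>Rodrigues' formula: \<open>x\<close> and \<open>y\<close> are rotated by the
    angle \<open>a\<close> about the unit axis \<open>cos s *\<^sub>R w + sin s *\<^sub>R x\<close>.
    The axis moves from \<open>w\<close> at \<open>s = 0\<close> to \<open>- w\<close> at
    \<open>s = pi\<close>, which reverses the sense of rotation.\<close>
  define h where "h = (\<lambda>q::real \<times> real. let s = fst q; a = snd q in
     (cos a *\<^sub>R x + (sin a * cos s) *\<^sub>R y + ((1 - cos a) * sin s) *\<^sub>R (cos s *\<^sub>R w + sin s *\<^sub>R x),
      cos a *\<^sub>R y + sin a *\<^sub>R (sin s *\<^sub>R w - cos s *\<^sub>R x)))"
  have frame: "x \<bullet> x = 1" "y \<bullet> y = 1" "w \<bullet> w = 1" "x \<bullet> y = 0" "y \<bullet> x = 0" "x \<bullet> w = 0" "w \<bullet> x = 0"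
    "y \<bullet> w = 0" "w \<bullet> y = 0" "\<zeta> \<bullet> x = 0" "\<zeta> \<bullet> y = 0" "\<zeta> \<bullet> w = 0"
    using xy w by (auto simp: opair_def norm_eq_1 inner_commute)
  have h_opair: "h q \<in> opair \<zeta>" for q
  proof -
    obtain s a where q: "q = (s, a)" by fastforce
    have *: "cos s * cos s + sin s * sin s = 1" "cos a * cos a + sin a * sin a = 1"
      using sin_cos_squared_add3 by auto
    define A B C D where abcd: "A = cos s" "B = sin s" "C = cos a" "D = sin a"
    have **: "A * A + B * B = 1" "C * C + D * D = 1" using * by (auto simp: abcd)
    have h: "h q = (C *\<^sub>R x + (D * A) *\<^sub>R y + ((1 - C) * B) *\<^sub>R (A *\<^sub>R w + B *\<^sub>R x),
      C *\<^sub>R y + D *\<^sub>R (B *\<^sub>R w - A *\<^sub>R x))"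
      by (simp add: h_def q Let_def abcd)
    show ?thesis unfolding h opair_iff norm_eq_1 fst_conv snd_conv
      apply (simp add: inner_add_left inner_add_right inner_diff_left inner_diff_right frame)
      using ** by algebra
  qed
  have "continuous_on UNIV h"
    unfolding h_def Let_def by (intro continuous_intros)
  then have "continuous_on UNIV (\<mu> \<circ> h)"
    by (intro continuous_on_compose continuous_on_subset[OF cont]) (auto simp: h_opair)
  then obtain g where g: "continuous_on UNIV g" "\<And>q. \<mu> (h q) = exp (g q)"
    using continuous_logarithm_on_contractible[of UNIV "\<mu> \<circ> h"]
    by (auto simp: nz h_opair convex_imp_contractible)
  \<comment> \<open>A logarithm of the constant 1 takes values in a discrete set, so a continuous
    one cannot vary.\<close>
  have const: "f a = f b"
    if "continuous_on UNIV f" "\<And>t. exp (f t) = 1" for f :: "real \<Rightarrow> complex" and a b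
  proof -
    have rng: "f t \<in> (\<lambda>n::int. 2 * of_int n * of_real pi * \<i>) ` UNIV" for t
    proof -
      have "Re (f t) = 0 \<and> (\<exists>n::int. Im (f t) = of_int (2 * n) * pi)"
        using that(2)[of t] by (simp only: exp_eq_1)
      then obtain n :: int where "Re (f t) = 0" "Im (f t) = of_int (2 * n) * pi"
        by blast
      then have "f t = 2 * of_int n * of_real pi * \<i>" by (simp add: complex_eq_iff)
      then show ?thesis by blast
    qed
    have "f constant_on UNIV"
    proof (rule continuous_discrete_range_constant[OF _ that(1)])
      show "\<exists>e>0. \<forall>y. y \<in> UNIV \<and> f y \<noteq> f t \<longrightarrow> e \<le> norm (f y - f t)" if "t \<in> UNIV" for t
      proof (intro exI[of _ "2 * pi"] conjI allI impI)
        fix y assume y: "y \<in> UNIV \<and> f y \<noteq> f t"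
        obtain m n :: int where mn: "f y = 2 * of_int m * of_real pi * \<i>" "f t = 2 * of_int n * of_real pi * \<i>"
          using rng[of y] rng[of t] by auto
        then have "m \<noteq> n" using y by auto
        then have "1 \<le> \<bar>m - n\<bar>" by linarith
        then have "1 \<le> \<bar>real_of_int m - of_int n\<bar>" by linarith
        moreover have "f y - f t = of_real (2 * pi * (real_of_int m - of_int n)) * \<i>"
          by (simp add: mn algebra_simps)
        then have "norm (f y - f t) = 2 * pi * \<bar>real_of_int m - of_int n\<bar>"
          by (simp add: norm_mult abs_mult del: of_real_mult of_real_diff)
        ultimately show "2 * pi \<le> norm (f y - f t)" by simp
      qed simp
    qed simp
    then show ?thesis by (metis constant_on_def UNIV_I)
  qed
  have gc: "continuous_on UNIV (\<lambda>t. g (u t, v t))"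
    if "continuous_on UNIV u" "continuous_on UNIV v" for u v :: "real \<Rightarrow> real"
    by (rule continuous_on_compose2[OF g(1)]) (auto intro!: continuous_intros that)
  define X where "X = \<i> * complex_of_real (d * (2 * pi))"
  \<comment> \<open>By equivariance the logarithm \<open>g\<close> of \<open>\<mu> \<circ> h\<close>
    grows by \<open>X\<close> over one turn at \<open>s = 0\<close>, and by \<open>- X\<close> at
    \<open>s = pi\<close>.\<close>
  have e1: "g (0, 2 * pi) - \<i> * of_real (d * (2 * pi)) - g (0, 0)
      = g (0, 0) - \<i> * of_real (d * 0) - g (0, 0)"
  proof (rule const)
    show "continuous_on UNIV (\<lambda>a. g (0, a) - \<i> * of_real (d * a) - g (0, 0))"
      by (intro continuous_intros gc)
    fix a
    have "h (0, a) = rot (x, y) a" "h (0, 0) = (x, y)" by (simp_all add: h_def rot_eq)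
    then have "exp (g (0, a)) = exp (\<i> * of_real (d * a)) * exp (g (0, 0))"
      by (metis equiv g(2) xy)
    then show "exp (g (0, a) - \<i> * of_real (d * a) - g (0, 0)) = 1"
      by (simp add: exp_diff)
  qed
  have e2: "g (pi, 2 * pi) - \<i> * of_real (- d * (2 * pi)) - g (pi, 0)
      = g (pi, 0) - \<i> * of_real (- d * 0) - g (pi, 0)"
  proof (rule const)
    show "continuous_on UNIV (\<lambda>a. g (pi, a) - \<i> * of_real (- d * a) - g (pi, 0))"
      by (intro continuous_intros gc)
    fix a
    have "h (pi, a) = rot (x, y) (- a)" "h (pi, 0) = (x, y)" by (simp_all add: h_def rot_eq)
    then have "exp (g (pi, a)) = exp (\<i> * of_real (d * - a)) * exp (g (pi, 0))"
      by (metis equiv g(2) xy)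
    then show "exp (g (pi, a) - \<i> * of_real (- d * a) - g (pi, 0)) = 1"
      by (simp add: exp_diff exp_add exp_minus)
  qed
  \<comment> \<open>For each \<open>s\<close> the map \<open>a \<mapsto> h (s, a)\<close> closes up
    after \<open>2 * pi\<close>, so the growth of \<open>g\<close> over a turn is discrete and
    cannot depend on \<open>s\<close>.\<close>
  have e3: "g (0, 2 * pi) - g (0, 0) = g (pi, 2 * pi) - g (pi, 0)"
  proof (rule const)
    show "continuous_on UNIV (\<lambda>s. g (s, 2 * pi) - g (s, 0))"
      by (intro continuous_intros gc)
    fix s
    have "h (s, 2 * pi) = h (s, 0)" by (simp add: h_def)
    then have "exp (g (s, 2 * pi)) = exp (g (s, 0))" by (metis g(2))
    then show "exp (g (s, 2 * pi) - g (s, 0)) = 1" by (simp add: exp_diff)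
  qed
  have "g (0, 2 * pi) - g (0, 0) = X" using e1 by (simp add: X_def algebra_simps)
  moreover have "g (pi, 2 * pi) - g (pi, 0) = - X" using e2 by (simp add: X_def algebra_simps)
  ultimately have "X = - X" using e3 by simp
  then have "Re X = 0" "Im X = 0" by (simp_all add: complex_eq_iff)
  then have "X = 0" by (simp add: complex_eq_iff)
  then show "d = 0" by (simp add: X_def)
qed

section \<open>Reflections on all circles\<close>

lemma circ_angle_range:
  obtains b where "b \<in> {0..2*pi}" "\<forall>u. circ p (b + u) = circ p (c + u)"
proof (rule that)
  define b where "b = 2 * pi * frac (c / (2 * pi))"
  have "b \<le> 2 * pi * 1" unfolding b_def
    by (intro mult_left_mono) (auto simp: less_imp_le frac_lt_1)
  then show "b \<in> {0..2*pi}" by (simp add: b_def)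
  have c: "c = b + 2 * pi * of_int \<lfloor>c / (2 * pi)\<rfloor>" by (simp add: b_def frac_def algebra_simps)
  have "circ p (b + u) = circ p (c + u)" for u
    using circ_add_2pi[of p "b + u" "\<lfloor>c / (2 * pi)\<rfloor>"] by (subst c) (simp only: add_ac)
  then show "\<forall>u. circ p (b + u) = circ p (c + u)" ..
qed

lemma continuous_on_compose_UNIV:
  "continuous_on UNIV f \<Longrightarrow> continuous_on A h \<Longrightarrow> continuous_on A (\<lambda>x. f (h x))"
  by (rule continuous_on_compose2) auto

text \<open>The sign \<tau> is 1 for rotations of the circle and - 1 for reflections. Keeping the
  angle in a compact interval allows it to be projected away without losing closedness.\<close>

lemma compact_circle_isometries:
  fixes F G :: "real \<Rightarrow> 'a::euclidean_space \<Rightarrow> real"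
  assumes cF: "\<And>t. continuous_on UNIV (F t)" and cG: "\<And>t. continuous_on UNIV (G t)"
  shows "compact {(p, c). p \<in> opair \<zeta> \<and> c \<in> {0..2*pi} \<and> (\<forall>s t. F t (circ p s) = G t (circ p (c + \<tau> * s)))}"
proof -
  have "compact ((opair \<zeta> \<times> {0..2*pi}) \<inter> {q. \<forall>s t. F t (circ (fst q) s) = G t (circ (fst q) (snd q + \<tau> * s))})"
    by (intro compact_Int_closed compact_Times compact_opair compact_Icc closed_Collect_all
        closed_Collect_eq continuous_on_compose_UNIV[OF cF] continuous_on_compose_UNIV[OF cG] continuous_intros)
  then show ?thesis by (rule back_subst[of compact]) auto
qed

text \<open>The set is the image of a compact set under \<open>fst\<close>. Its closedness both
  extends a congruence from generic circles to all circles and feeds the connectedness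
  argument.\<close>

lemma closed_circle_isometric:
  fixes F G :: "real \<Rightarrow> 'a::euclidean_space \<Rightarrow> real"
  assumes cF: "\<And>t. continuous_on UNIV (F t)" and cG: "\<And>t. continuous_on UNIV (G t)"
  shows "closed {p \<in> opair \<zeta>. \<exists>a. \<forall>s t. F t (circ p s) = G t (circ p (a + \<tau> * s))}"
proof -
  define C where "C = {(p, c). p \<in> opair \<zeta> \<and> c \<in> {0..2*pi} \<and> (\<forall>s t. F t (circ p s) = G t (circ p (c + \<tau> * s)))}"
  have "p \<in> fst ` C"
    if "p \<in> opair \<zeta>" and a: "\<forall>s t. F t (circ p s) = G t (circ p (a + \<tau> * s))" for p a
  proof -
    obtain b where "b \<in> {0..2*pi}" "\<forall>u. circ p (b + u) = circ p (a + u)" by (rule circ_angle_range)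
    then have "(p, b) \<in> C" using that by (simp add: C_def)
    then show ?thesis by force
  qed
  then have "fst ` C = {p \<in> opair \<zeta>. \<exists>a. \<forall>s t. F t (circ p s) = G t (circ p (a + \<tau> * s))}"
    by (auto simp: C_def)
  moreover have "compact (fst ` C)"
    unfolding C_def by (intro compact_continuous_image compact_circle_isometries cF cG continuous_intros)
  ultimately show ?thesis by (metis compact_imp_closed)
qed

text \<open>If \<open>F\<close> had arbitrarily small periods on circles, then by compactness \<open>F\<close> would be constant
  on some circle.\<close>

lemma periods_bounded_below:
  fixes F :: "real \<Rightarrow> 'a::euclidean_space \<Rightarrow> real"
  assumes cF: "\<And>t. continuous_on UNIV (F t)"
    and nopi: "\<And>p. p \<in> opair \<zeta> \<Longrightarrow> \<not> (\<forall>s t. F t (circ p (s + pi)) = F t (circ p s))"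
  obtains r where "r > 0"
    "\<And>p e. p \<in> opair \<zeta> \<Longrightarrow> (\<forall>s t. F t (circ p (s + e)) = F t (circ p s)) \<Longrightarrow> 0 < e \<Longrightarrow> r \<le> e"
proof (rule ccontr)
  assume "\<not> thesis"
  then have "\<forall>n. \<exists>p e. p \<in> opair \<zeta> \<and> (\<forall>s t. F t (circ p (s + e)) = F t (circ p s)) \<and> 0 < e
      \<and> e < 1 / real (Suc n)"
    by (metis not_le_imp_less of_nat_0_less_iff that zero_less_Suc zero_less_divide_1_iff)
  then obtain P e where P: "\<And>n. P n \<in> opair \<zeta>"
    and per: "\<And>n s t. F t (circ (P n) (s + e n)) = F t (circ (P n) s)"
    and e: "\<And>n. 0 < e n" "\<And>n. e n < 1 / real (Suc n)"
    by metis
  obtain q \<sigma> where q: "q \<in> opair \<zeta>" and \<sigma>: "strict_mono \<sigma>" "(P \<circ> \<sigma>) \<longlonglongrightarrow> q"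
    using compact_opair P unfolding compact_def by blast
  \<comment> \<open>The largest multiple of the period \<open>e n\<close> not exceeding pi; it
    misses pi by less than \<open>e n\<close>, so in the limit pi itself becomes a period.\<close>
  define m where "m n = nat \<lfloor>pi / e n\<rfloor>" for n
  have per_mult: "F t (circ (P n) (s + real k * e n)) = F t (circ (P n) s)" for n s t k
  proof (induction k)
    case (Suc k)
    then show ?case using per[of t n "s + real k * e n"] by (simp add: algebra_simps)
  qed simp
  have m: "\<bar>real (m n) * e n - pi\<bar> \<le> 1 / real (Suc n)" for n
  proof -
    have "real (m n) = of_int \<lfloor>pi / e n\<rfloor>" using e(1)[of n] by (simp add: m_def)
    then have "real (m n) \<le> pi / e n" "pi / e n < real (m n) + 1" by linarith+
    then have "real (m n) * e n \<le> pi" "pi < real (m n) * e n + e n"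
      using e(1)[of n] by (simp_all add: field_simps)
    then show ?thesis using e(2)[of n] by linarith
  qed
  have "(\<lambda>n. real (m n) * e n - pi) \<longlonglongrightarrow> 0"
    by (rule Lim_null_comparison[OF _ LIMSEQ_inverse_real_of_nat])
       (use m in \<open>simp add: inverse_eq_divide\<close>)
  then have "(\<lambda>n. real (m n) * e n) \<longlonglongrightarrow> pi" by (simp add: LIM_zero_iff)
  then have lim: "(\<lambda>n. real (m (\<sigma> n)) * e (\<sigma> n)) \<longlonglongrightarrow> pi"
    using LIMSEQ_subseq_LIMSEQ[OF _ \<sigma>(1)] by (auto simp: o_def)
  have "F t (circ q (s + pi)) = F t (circ q s)" for s t
  proof -
    have iso: "isCont (F t) v" for v using cF[of t] by (simp add: continuous_on_eq_continuous_at)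
    have "(\<lambda>n. F t (circ (P (\<sigma> n)) (s + real (m (\<sigma> n)) * e (\<sigma> n)))) \<longlonglongrightarrow> F t (circ q (s + pi))"
      by (intro isCont_tendsto_compose[OF iso] tendsto_intros lim) (use \<sigma>(2) in \<open>simp add: o_def\<close>)
    moreover have "(\<lambda>n. F t (circ (P (\<sigma> n)) s)) \<longlonglongrightarrow> F t (circ q s)"
      by (intro isCont_tendsto_compose[OF iso] tendsto_intros) (use \<sigma>(2) in \<open>simp add: o_def\<close>)
    ultimately show ?thesis by (simp add: per_mult LIMSEQ_unique)
  qed
  with nopi[OF q] show False by blast
qed

text \<open>By Dirichlet, some multiple \<open>k * e\<close> with \<open>k \<le> M\<close> lies
  within \<open>2 * pi / M < r\<close> of a whole number of turns. The difference is again a period,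
  too small to be nonzero. So every period is a rational part of a turn with denominator at most
  \<open>M\<close>, and \<open>fact M\<close> clears all these denominators at once.\<close>

lemma common_period_multiple:
  fixes F :: "real \<Rightarrow> 'a::euclidean_space \<Rightarrow> real"
  assumes cF: "\<And>t. continuous_on UNIV (F t)"
    and nopi: "\<And>p. p \<in> opair \<zeta> \<Longrightarrow> \<not> (\<forall>s t. F t (circ p (s + pi)) = F t (circ p s))"
  obtains K :: nat where "K > 0"
    "\<And>p e. p \<in> opair \<zeta> \<Longrightarrow> (\<forall>s t. F t (circ p (s + e)) = F t (circ p s)) \<Longrightarrow>
       \<exists>n::int. real K * e = 2 * pi * of_int n"
proof -
  obtain r where r: "r > 0"
    "\<And>p e. p \<in> opair \<zeta> \<Longrightarrow> (\<forall>s t. F t (circ p (s + e)) = F t (circ p s)) \<Longrightarrow> 0 < e \<Longrightarrow> r \<le> e"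
    using periods_bounded_below[OF assms] by blast
  obtain M :: nat where M: "2 * pi / r < real M" using reals_Archimedean2 by blast
  have "0 < 2 * pi / r" using r(1) by simp
  with M have M0: "0 < M" by (metis less_trans of_nat_0_less_iff)
  show thesis
  proof (rule that[of "fact M"])
    fix p e assume p: "p \<in> opair \<zeta>" and per: "\<forall>s t. F t (circ p (s + e)) = F t (circ p s)"
    have per_mult: "F t (circ p (s + real k * e)) = F t (circ p s)" for s t k
    proof (induction k)
      case (Suc k)
      then show ?case using per[rule_format, of t "s + real k * e"] by (simp add: algebra_simps)
    qed simp
    obtain h k where k: "0 < k" "k \<le> int M" "\<bar>of_int k * (e / (2 * pi)) - of_int h\<bar> < 1 / M"
      by (rule Dirichlet_approx[OF M0])
    define j where "j = nat k"
    define \<delta> where "\<delta> = real j * e + 2 * pi * of_int (- h)"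
    have per_\<delta>: "F t (circ p (s + \<delta>)) = F t (circ p s)" for s t
      using per_mult[of t s j] circ_add_2pi[of p "s + real j * e" "- h"] by (simp only: \<delta>_def add.assoc)
    have per_neg: "F t (circ p (s + - \<delta>)) = F t (circ p s)" for s t
      using per_\<delta>[of t "s - \<delta>"] by simp
    have "\<delta> = 2 * pi * (of_int k * (e / (2 * pi)) - of_int h)"
      using k(1) by (simp add: \<delta>_def j_def right_diff_distrib)
    then have "\<bar>\<delta>\<bar> = 2 * pi * \<bar>of_int k * (e / (2 * pi)) - of_int h\<bar>" by (simp only: abs_mult) simp
    also have "\<dots> < 2 * pi * (1 / M)" using k(3) by (intro mult_strict_left_mono) auto
    also have "\<dots> < r" using M M0 r(1) by (simp add: field_simps)
    finally have "\<delta> = 0" using r(2)[OF p, of \<delta>] r(2)[OF p, of "- \<delta>"] per_\<delta> per_neg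
      by (smt (verit))
    then have j: "1 \<le> j" "j \<le> M" "real j * e = 2 * pi * of_int h"
      using k by (simp_all add: \<delta>_def j_def nat_le_iff)
    then obtain c where c: "fact M = j * c" using dvd_fact[of j M] by (auto elim: dvdE)
    have "real (fact M) * e = 2 * pi * of_int (int c * h)"
      using j(3) by (simp add: c del: of_nat_fact)
    then show "\<exists>n::int. real (fact M) * e = 2 * pi * of_int n" by blast
  qed simp
qed

text \<open>The axis of the reflection is unique up to the finite symmetry group of \<open>F\<close> on the circle,
  so a fixed multiple of its angle depends continuously on the circle.\<close>

lemma no_reflections_on_all_circles:
  fixes F G :: "real \<Rightarrow> 'a::euclidean_space \<Rightarrow> real"
  assumes dim: "4 \<le> DIM('a)" and p0: "p0 \<in> opair \<zeta>"
    and cF: "\<And>t. continuous_on UNIV (F t)" and cG: "\<And>t. continuous_on UNIV (G t)"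
    and nopi: "\<And>p. p \<in> opair \<zeta> \<Longrightarrow> \<not> (\<forall>s t. F t (circ p (s + pi)) = F t (circ p s))"
    and refls: "\<And>p. p \<in> opair \<zeta> \<Longrightarrow> \<exists>c. \<forall>s t. F t (circ p s) = G t (circ p (c - s))"
  shows False
proof -
  obtain K where K: "K > 0"
    "\<And>p e. p \<in> opair \<zeta> \<Longrightarrow> (\<forall>s t. F t (circ p (s + e)) = F t (circ p s)) \<Longrightarrow>
       \<exists>n::int. real K * e = 2 * pi * of_int n"
    using common_period_multiple[OF cF nopi] by blast
  define R where "R p c \<longleftrightarrow> (\<forall>s t. F t (circ p s) = G t (circ p (c - s)))" for p c
  \<comment> \<open>Two reflection constants of one circle differ by a period of \<open>F\<close>,
    which the factor \<open>K\<close> turns into whole turns; hence the value does not depend on the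
    choice.\<close>
  define \<mu> where "\<mu> p = cis (real K * (SOME c. R p c))" for p
  have \<mu>: "\<mu> p = cis (real K * c)" if p: "p \<in> opair \<zeta>" and c: "R p c" for p c
  proof -
    define b where "b = (SOME c. R p c)"
    have b: "R p b" using c unfolding b_def by (rule someI)
    have "F t (circ p (s + (b - c))) = F t (circ p s)" for s t
    proof -
      have "F t (circ p (s + (b - c))) = G t (circ p (b - (s + (b - c))))"
        using b by (simp add: R_def)
      also have "b - (s + (b - c)) = c - s" by simp
      finally show ?thesis using c by (simp add: R_def)
    qed
    then obtain n :: int where "real K * (b - c) = 2 * pi * of_int n" using K(2)[OF p] by blast
    then have "real K * b = real K * c + 2 * pi * of_int n" by (simp add: algebra_simps)
    then have "cis (real K * b) = cis (real K * c) * cis (2 * pi * of_int n)"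
      by (metis cis_mult)
    then show ?thesis by (simp add: \<mu>_def b_def cis_multiple_2pi)
  qed
  \<comment> \<open>The chosen constant itself may jump. The values of \<mu> lie in a compact
    circle, so a closed graph suffices, and the graph is a continuous image of the compact set
    \<open>C\<close> of all admissible choices.\<close>
  have "continuous_on (opair \<zeta>) \<mu>"
  proof (rule continuous_from_closed_graph[of "sphere 0 1"])
    show "\<mu> \<in> opair \<zeta> \<rightarrow> sphere 0 1" by (auto simp: \<mu>_def)
    define C where "C = {(p, c). p \<in> opair \<zeta> \<and> c \<in> {0..2*pi} \<and> (\<forall>s t. F t (circ p s) = G t (circ p (c + (- 1) * s)))}"
    have C: "(p, c) \<in> C \<longleftrightarrow> p \<in> opair \<zeta> \<and> c \<in> {0..2*pi} \<and> R p c" for p c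
      by (simp add: C_def R_def)
    have "(p, \<mu> p) \<in> (\<lambda>q. (fst q, cis (real K * snd q))) ` C" if p: "p \<in> opair \<zeta>" for p
    proof -
      obtain c where c: "R p c" using refls[OF p] by (auto simp: R_def)
      obtain b where b: "b \<in> {0..2*pi}" "\<forall>u. circ p (b + u) = circ p (c + u)" by (rule circ_angle_range)
      have "R p b" unfolding R_def
        using c[unfolded R_def] b(2) by (simp only: diff_conv_add_uminus) simp
      then show ?thesis using \<mu>[OF p] b(1) p C by (intro image_eqI[of _ _ "(p, b)"]) simp_all
    qed
    then have "(\<lambda>x. (x, \<mu> x)) ` opair \<zeta> = (\<lambda>q. (fst q, cis (real K * snd q))) ` C"
      using \<mu> C by (auto simp: image_iff)
    moreover have "compact ((\<lambda>q. (fst q, cis (real K * snd q))) ` C)"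
      unfolding C_def cis_conv_exp
      by (intro compact_continuous_image compact_circle_isometries cF cG continuous_intros)
    ultimately show "closed ((\<lambda>x. (x, \<mu> x)) ` opair \<zeta>)" by (metis compact_imp_closed)
  qed simp
  moreover have "\<mu> (rot p a) = exp (\<i> * of_real ((- 2 * real K) * a)) * \<mu> p" if p: "p \<in> opair \<zeta>" for p a
  proof -
    obtain c where c: "R p c" using refls[OF p] by (auto simp: R_def)
    \<comment> \<open>Moving the base point by \<open>a\<close> lowers the reflection constant by
      \<open>2 * a\<close>, whereas the constant of a rotation would stay the same. This is the
      source of the nonzero degree \<open>- 2 * K\<close>.\<close>
    have "R (rot p a) (c - 2 * a)" unfolding R_def
    proof (intro allI)
      fix s t
      have "c - (a + s) = a + (c - 2 * a - s)" by simp
      then show "F t (circ (rot p a) s) = G t (circ (rot p a) (c - 2 * a - s))"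
        using c[unfolded R_def, rule_format, of t "a + s"] by (simp add: algebra_simps)
    qed
    then have "\<mu> (rot p a) = cis (real K * (c - 2 * a))" using \<mu> rot_in_opair[OF p] by blast
    also have "\<dots> = cis ((- 2 * real K) * a) * cis (real K * c)"
      by (simp add: cis_mult algebra_simps)
    also have "\<dots> = exp (\<i> * of_real ((- 2 * real K) * a)) * \<mu> p"
      using \<mu>[OF p c] by (simp add: cis_conv_exp)
    finally show ?thesis .
  qed
  ultimately have "- 2 * real K = 0"
    by (intro no_equivariant_circle_map[OF dim p0, of \<mu>]) (auto simp: \<mu>_def)
  with K(1) show False by simp
qed

section \<open>Injectivity of the Funk transform\<close>

text \<open>With an antiderivative \<Phi> on the whole line, the derivative of
  \<open>\<Phi> (x + 2 * pi) - \<Phi> x\<close> is \<open>f (x + 2 * pi) - f x = 0\<close>.\<close>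

lemma integral_periodic_shift:
  fixes f :: "real \<Rightarrow> real"
  assumes cont: "continuous_on UNIV f" and per: "\<And>s. f (s + 2 * pi) = f s"
  shows "integral {0..2*pi} (\<lambda>s. f (s + c)) = integral {0..2*pi} f"
proof -
  \<comment> \<open>The signed integral from 0 to \<open>x\<close>: at most one of the two terms is
    nonzero, since the integral over an empty interval is 0.\<close>
  define \<Phi> where "\<Phi> x = integral {0..x} f - integral {x..0} f" for x
  have int: "f integrable_on {a..b}" for a b
    by (intro integrable_continuous_interval continuous_on_subset[OF cont]) simp
  have \<Phi>: "(\<Phi> has_real_derivative f x) (at x)" for x
  proof -
    define m where "m = \<bar>x\<bar> + 1"
    define \<Psi> where "\<Psi> y = integral {-m..y} f - integral {-m..0} f" for y
    have "((\<lambda>y. integral {-m..y} f) has_real_derivative f x) (at x within {-m..m})"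
      by (rule integral_has_real_derivative) (auto intro: continuous_on_subset[OF cont] simp: m_def)
    then have "((\<lambda>y. integral {-m..y} f) has_real_derivative f x) (at x)"
      using at_within_Icc_at[of "-m" x m] by (simp add: m_def)
    then have "(\<Psi> has_real_derivative f x) (at x)"
      unfolding \<Psi>_def by (auto intro!: derivative_eq_intros)
    moreover have eq: "\<Phi> y = \<Psi> y" if y: "y \<in> {-m<..<m}" for y
    proof (cases "0 \<le> y")
      case True
      have "integral {-m..0} f + integral {0..y} f = integral {-m..y} f"
        using True y int by (intro Henstock_Kurzweil_Integration.integral_combine) auto
      moreover have "integral {y..0} f = 0" using True by (cases "y = 0") auto
      ultimately show ?thesis by (simp add: \<Phi>_def \<Psi>_def)
    next
      case False
      have "integral {-m..y} f + integral {y..0} f = integral {-m..0} f"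
        using False y int by (intro Henstock_Kurzweil_Integration.integral_combine) auto
      moreover have "integral {0..y} f = 0" using False by auto
      ultimately show ?thesis by (simp add: \<Phi>_def \<Psi>_def)
    qed
    moreover have "eventually (\<lambda>y. \<Phi> y = \<Psi> y) (nhds x)"
      unfolding eventually_nhds by (rule exI[of _ "{-m<..<m}"]) (use eq in \<open>auto simp: m_def\<close>)
    ultimately show ?thesis
      using DERIV_cong_ev[OF refl _ refl, of \<Phi> \<Psi> x "f x"] by blast
  qed
  have F1: "integral {0..2*pi} f = \<Phi> (2 * pi) - \<Phi> 0"
    by (intro integral_unique fundamental_theorem_of_calculus)
       (auto intro!: has_field_derivative_at_within[OF \<Phi>] simp flip: has_real_derivative_iff_has_vector_derivative)
  have F2: "integral {0..2*pi} (\<lambda>s. f (s + c)) = \<Phi> (2 * pi + c) - \<Phi> (0 + c)"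
    by (intro integral_unique fundamental_theorem_of_calculus)
       (auto intro!: has_field_derivative_at_within[OF DERIV_shift[THEN iffD1, OF \<Phi>]]
         simp flip: has_real_derivative_iff_has_vector_derivative)
  have "((\<lambda>x. \<Phi> (x + 2 * pi) - \<Phi> x) has_real_derivative 0) (at x)" for x
    using DERIV_diff[OF DERIV_shift[THEN iffD1, OF \<Phi>[of "x + 2 * pi"]] \<Phi>[of x]] by (simp add: per)
  then have "\<Phi> (c + 2 * pi) - \<Phi> c = \<Phi> (0 + 2 * pi) - \<Phi> 0"
    using DERIV_isconst_all[of "\<lambda>x. \<Phi> (x + 2 * pi) - \<Phi> x" c 0] by blast
  then show ?thesis using F1 F2 by (simp add: add.commute)
qed

section \<open>Wallis integrals and an Abel-type transform\<close>

definition wallis :: "nat \<Rightarrow> real" where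
  "wallis k = integral {0..pi/2} (\<lambda>t. sin t ^ k)"

lemma wallis_0: "wallis 0 = pi / 2" by (simp add: wallis_def)

lemma wallis_1: "wallis 1 = 1"
proof -
  have "((\<lambda>t. sin t) has_integral (- cos (pi/2) - (- cos 0))) {0..pi/2}"
    by (rule fundamental_theorem_of_calculus)
       (auto intro!: derivative_eq_intros simp flip: has_real_derivative_iff_has_vector_derivative)
  then show ?thesis by (simp add: wallis_def integral_unique)
qed

text \<open>Integrate the derivative of \<open>cos t * sin t ^ (k + 1)\<close>, which vanishes at
  both ends of the interval.\<close>

lemma wallis_rec: "real (k + 2) * wallis (k + 2) = real (k + 1) * wallis k"
proof -
  have "((\<lambda>t. real (k + 1) * sin t ^ k - real (k + 2) * sin t ^ (k + 2)) has_integral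
      (cos (pi/2) * sin (pi/2) ^ (k+1) - cos 0 * sin 0 ^ (k+1))) {0..pi/2}"
  proof (rule fundamental_theorem_of_calculus)
    fix t :: real
    have D: "((\<lambda>t. cos t * sin t ^ (k + 1)) has_real_derivative
       (- sin t * sin t ^ (k + 1) + cos t * (real (k + 1) * sin t ^ k * cos t))) (at t within {0..pi/2})"
      by (auto intro!: derivative_eq_intros; cases k; simp add: algebra_simps)
    have "- sin t * sin t ^ (k + 1) + cos t * (real (k + 1) * sin t ^ k * cos t)
      = - (sin t ^ (k + 2)) + real (k + 1) * sin t ^ k * (cos t)\<^sup>2"
      by (simp add: power2_eq_square)
    also have "\<dots> = real (k + 1) * sin t ^ k - real (k + 2) * sin t ^ (k + 2)"
    proof -
      have "- (S\<^sup>2 * K) + (m + 1) * K * C\<^sup>2 = (m + 1) * K - (m + 2) * (S\<^sup>2 * K)"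
        if "C\<^sup>2 = 1 - S\<^sup>2" for S C K m :: real
        unfolding that by (simp add: algebra_simps)
      from this[OF cos_squared_eq[of t], of "sin t ^ k" "real k"] show ?thesis
        by (simp add: power_add algebra_simps power2_eq_square)
    qed
    finally have "- sin t * sin t ^ (k + 1) + cos t * (real (k + 1) * sin t ^ k * cos t)
      = real (k + 1) * sin t ^ k - real (k + 2) * sin t ^ (k + 2)" .
    with D show "((\<lambda>t. cos t * sin t ^ (k + 1)) has_vector_derivative
       real (k + 1) * sin t ^ k - real (k + 2) * sin t ^ (k + 2)) (at t within {0..pi/2})"
      by (simp only: has_real_derivative_iff_has_vector_derivative)
  qed simp
  then have "integral {0..pi/2} (\<lambda>t. real (k + 1) * sin t ^ k - real (k + 2) * sin t ^ (k + 2)) = 0"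
    by (simp add: integral_unique)
  moreover have "(\<lambda>t. m * sin t ^ j) integrable_on {0..pi/2}" for j and m :: real
    by (intro integrable_continuous_interval continuous_intros)
  ultimately show ?thesis
    by (simp only: Henstock_Kurzweil_Integration.integral_diff integral_mult_right wallis_def)
qed

text \<open>The recursion makes \<open>(k + 1) * wallis k * wallis (Suc k)\<close> independent of
  \<open>k\<close>. The factor \<open>1 / (k + 1)\<close> that remains is the integral of the
  monomial of degree \<open>k\<close> over the unit interval.\<close>

lemma wallis_mult_Suc: "wallis k * wallis (Suc k) = (pi / 2) / real (k + 1)"
proof (induction k)
  case 0
  then show ?case using wallis_0 wallis_1 by simp
next
  case (Suc k)
  have "real (k + 2) * (wallis (Suc k) * wallis (Suc (Suc k))) = real (k + 1) * (wallis k * wallis (Suc k))"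
    using wallis_rec[of k] by (simp add: algebra_simps)
  also have "\<dots> = pi / 2" unfolding Suc by (simp del: of_nat_add of_nat_Suc)
  finally have "wallis (Suc k) * wallis (Suc (Suc k)) = (pi / 2) / real (k + 2)"
    by (subst nonzero_eq_divide_eq) (simp_all add: mult.commute)
  then show ?case by simp
qed

text \<open>Inversion of the Abel-type transform \<open>Q \<mapsto> (c \<mapsto> \<integral> Q (c sin t) dt)\<close>. Both sides are
  bounded linear in \<open>Q\<close>, so it suffices to check monomials, where it is the Wallis product.\<close>

lemma abel_inversion:
  fixes Q :: "real \<Rightarrow> real"
  assumes cont: "continuous_on UNIV Q"
  shows "integral {0..pi/2} (\<lambda>a. sin a * integral {0..pi/2} (\<lambda>t. Q (sin a * sin t)))
    = (pi / 2) * integral {0..1} Q"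
proof -
  define I where "I P a = integral {0..pi/2} (\<lambda>t. P (sin a * sin t))" for P :: "real \<Rightarrow> real" and a
  define A where "A P = integral {0..pi/2} (\<lambda>a. sin a * I P a)" for P :: "real \<Rightarrow> real"
  define B where "B P = (pi / 2) * integral {0..1} P" for P :: "real \<Rightarrow> real"
  have inner_int: "(\<lambda>t. P (c * sin t)) integrable_on {0..pi/2}" if "continuous_on UNIV P" for P :: "real \<Rightarrow> real" and c
    by (intro integrable_continuous_interval continuous_on_compose2[OF that] continuous_intros) auto
  have inner_cont: "continuous_on UNIV (\<lambda>a. I P a)"
    if "continuous_on UNIV P" for P :: "real \<Rightarrow> real"
  proof -
    have "continuous_on (UNIV \<times> cbox 0 (pi/2)) (\<lambda>(a, t). P (sin a * sin t))"
      unfolding split_beta by (intro continuous_on_compose2[OF that] continuous_intros) auto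
    then show ?thesis unfolding I_def
      using integral_continuous_on_param[of UNIV 0 "pi/2" "\<lambda>a t. P (sin a * sin t)"] by simp
  qed
  have outer_int: "(\<lambda>a. sin a * I P a) integrable_on {0..pi/2}"
    if "continuous_on UNIV P" for P :: "real \<Rightarrow> real"
    by (intro integrable_continuous_interval continuous_intros continuous_on_subset[OF inner_cont[OF that]]) auto
  have mono: "A (\<lambda>u. u ^ k) = B (\<lambda>u. u ^ k)" for k
  proof -
    have "A (\<lambda>u. u ^ k) = integral {0..pi/2} (\<lambda>a. wallis k * sin a ^ Suc k)"
      by (simp add: A_def I_def power_mult_distrib wallis_def algebra_simps)
    also have "\<dots> = wallis k * wallis (Suc k)" by (simp add: wallis_def)
    also have "\<dots> = B (\<lambda>u. u ^ k)"
    proof -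
      have d: "((\<lambda>u. u ^ Suc k / real (Suc k)) has_real_derivative u ^ k) (at u within {0..1})" for u :: real
        by (rule DERIV_cong[OF DERIV_cdivide[OF DERIV_power_Suc[OF DERIV_ident]]]) (simp add: field_simps)
      have "((\<lambda>u::real. u ^ k) has_integral (1 ^ Suc k / real (Suc k) - 0 ^ Suc k / real (Suc k))) {0..1}"
        by (rule fundamental_theorem_of_calculus)
           (auto intro!: d simp del: of_nat_Suc power_Suc simp flip: has_real_derivative_iff_has_vector_derivative)
      then show ?thesis using wallis_mult_Suc[of k] by (simp add: B_def integral_unique)
    qed
    finally show ?thesis .
  qed
  have A_lin: "A (\<lambda>u. \<Sum>i\<le>n. a i * P i u) = (\<Sum>i\<le>n. a i * A (P i))"
    if P: "\<And>i. continuous_on UNIV (P i)" for n :: nat and a :: "nat \<Rightarrow> real" and P :: "nat \<Rightarrow> real \<Rightarrow> real"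
  proof -
    have "A (\<lambda>u. \<Sum>i\<le>n. a i * P i u) = integral {0..pi/2} (\<lambda>b. sin b * (\<Sum>i\<le>n. a i * I (P i) b))"
      unfolding A_def I_def by (subst integral_sum) (auto intro!: integrable_on_mult_right inner_int[where P = "P _"] P)
    also have "\<dots> = integral {0..pi/2} (\<lambda>b. \<Sum>i\<le>n. a i * (sin b * I (P i) b))"
      by (simp add: sum_distrib_left mult.left_commute)
    also have "\<dots> = (\<Sum>i\<le>n. a i * A (P i))"
      unfolding A_def by (subst integral_sum) (auto intro!: integrable_on_mult_right outer_int[where P = "P _"] P)
    finally show ?thesis .
  qed
  have B_lin: "B (\<lambda>u. \<Sum>i\<le>n. a i * P i u) = (\<Sum>i\<le>n. a i * B (P i))"
    if P: "\<And>i. continuous_on UNIV (P i)" for n :: nat and a :: "nat \<Rightarrow> real" and P :: "nat \<Rightarrow> real \<Rightarrow> real"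
    unfolding B_def
    by (subst integral_sum) (auto intro!: integrable_on_mult_right integrable_continuous_interval continuous_intros
        continuous_on_subset[OF P] simp: sum_distrib_left mult.left_commute)
  have A_bd: "\<bar>A P - A P'\<bar> \<le> e * (pi / 2) * (pi / 2)"
    if P: "continuous_on UNIV P" "continuous_on UNIV P'" and e: "\<And>u. u \<in> {0..1} \<Longrightarrow> \<bar>P u - P' u\<bar> \<le> e"
    for P P' :: "real \<Rightarrow> real" and e
  proof -
    have e0: "0 \<le> e" using e[of 0] by auto
    have inn: "\<bar>I P a - I P' a\<bar> \<le> e * (pi / 2)"
      if a: "a \<in> {0..pi/2}" for a
    proof -
      have "I P a - I P' a
        = integral {0..pi/2} (\<lambda>t. P (sin a * sin t) - P' (sin a * sin t))"
        unfolding I_def by (intro Henstock_Kurzweil_Integration.integral_diff[symmetric] inner_int P)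
      also have "norm \<dots> \<le> e * (pi / 2 - 0)"
      proof (rule integral_bound)
        show "continuous_on {0..pi/2} (\<lambda>t. P (sin a * sin t) - P' (sin a * sin t))"
          by (intro continuous_intros continuous_on_compose2[OF P(1)] continuous_on_compose2[OF P(2)]) auto
        show "norm (P (sin a * sin t) - P' (sin a * sin t)) \<le> e" if "t \<in> {0..pi/2}" for t
        proof -
          have "0 \<le> sin a" "0 \<le> sin t" using a that by (auto intro: sin_ge_zero)
          then show ?thesis using e by (simp add: mult_le_one)
        qed
      qed simp
      finally show ?thesis by simp
    qed
    have "A P - A P' = integral {0..pi/2} (\<lambda>a. sin a * I P a
        - sin a * I P' a)"
      unfolding A_def by (intro Henstock_Kurzweil_Integration.integral_diff[symmetric] outer_int P)
    also have "norm \<dots> \<le> (e * (pi / 2)) * (pi / 2 - 0)"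
    proof (rule integral_bound)
      show "continuous_on {0..pi/2} (\<lambda>a. sin a * I P a
        - sin a * I P' a)"
        by (intro continuous_intros continuous_on_subset[OF inner_cont] P) auto
      fix a :: real assume a: "a \<in> {0..pi/2}"
      have "norm (sin a * I P a - sin a * I P' a)
        = \<bar>sin a\<bar> * \<bar>I P a - I P' a\<bar>"
        by (simp flip: right_diff_distrib add: abs_mult)
      also have "\<dots> \<le> 1 * (e * (pi / 2))"
        by (intro mult_mono inn a) (auto simp: e0)
      finally show "norm (sin a * I P a - sin a * I P' a) \<le> e * (pi / 2)"
        by simp
    qed simp
    finally show ?thesis by simp
  qed
  have B_bd: "\<bar>B P - B P'\<bar> \<le> e * (pi / 2)"
    if P: "continuous_on UNIV P" "continuous_on UNIV P'" and e: "\<And>u. u \<in> {0..1} \<Longrightarrow> \<bar>P u - P' u\<bar> \<le> e"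
    for P P' :: "real \<Rightarrow> real" and e
  proof -
    have "integral {0..1} P - integral {0..1} P' = integral {0..1} (\<lambda>u. P u - P' u)"
      by (intro Henstock_Kurzweil_Integration.integral_diff[symmetric] integrable_continuous_interval
           continuous_on_subset[OF P(1)] continuous_on_subset[OF P(2)]) auto
    also have "norm \<dots> \<le> e * (1 - 0)"
      by (rule integral_bound) (auto intro!: continuous_intros continuous_on_subset[OF P(1)]
          continuous_on_subset[OF P(2)] e[simplified])
    finally have "\<bar>integral {0..1} P - integral {0..1} P'\<bar> \<le> e" by simp
    then have "pi / 2 * \<bar>integral {0..1} P - integral {0..1} P'\<bar> \<le> pi / 2 * e"
      by (intro mult_left_mono) auto
    moreover have "B P - B P' = pi / 2 * (integral {0..1} P - integral {0..1} P')"
      by (simp only: B_def right_diff_distrib)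
    then have "\<bar>B P - B P'\<bar> = pi / 2 * \<bar>integral {0..1} P - integral {0..1} P'\<bar>"
      by (simp only: abs_mult) simp
    ultimately show ?thesis by (simp add: mult.commute)
  qed
  have "\<bar>A Q - B Q\<bar> \<le> d" if d: "0 < d" for d
  proof -
    \<comment> \<open>The sum of the bounds of \<open>A\<close> and \<open>B\<close> with respect to
      the maximum norm on the unit interval; a polynomial within \<open>d / C\<close> of
      \<open>Q\<close> costs \<open>d\<close> in total.\<close>
    define C where "C = (pi / 2) * (pi / 2) + pi / 2"
    have C: "0 < C" by (simp add: C_def add_pos_pos)
    obtain p where p: "real_polynomial_function p" "\<And>u. u \<in> {0..1} \<Longrightarrow> \<bar>Q u - p u\<bar> < d / C"
    proof (rule Stone_Weierstrass_real_polynomial_function)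
      show "compact {0..1::real}" by simp
      show "continuous_on {0..1} Q" by (rule continuous_on_subset[OF cont]) simp
      show "0 < d / C" using d C by simp
    qed blast
    obtain a n where an: "p = (\<lambda>u. \<Sum>i\<le>n. a i * u ^ i)"
      using real_polynomial_function_imp_sum[OF p(1)] by blast
    have cp: "continuous_on UNIV p" unfolding an by (intro continuous_intros)
    have "A p = B p" unfolding an
      by (subst A_lin, (intro continuous_intros)[1], subst B_lin, (intro continuous_intros)[1]) (simp add: mono)
    moreover have "\<bar>A Q - A p\<bar> \<le> d / C * (pi / 2) * (pi / 2)" "\<bar>B Q - B p\<bar> \<le> d / C * (pi / 2)"
      using p(2) by (intro A_bd B_bd cont cp less_imp_le; simp)+
    moreover have "d / C * (pi / 2) * (pi / 2) + d / C * (pi / 2) = d"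
    proof -
      have "d / C * (pi / 2) * (pi / 2) + d / C * (pi / 2) = d / C * C"
        by (simp add: C_def distrib_left mult.assoc)
      then show ?thesis using C by simp
    qed
    ultimately show ?thesis by linarith
  qed
  then have "A Q = B Q" by (metis abs_le_zero_iff dense_le_bounded eq_iff_diff_eq_0 field_le_epsilon add_0)
  then show ?thesis by (simp add: A_def B_def I_def)
qed


text \<open>Applied to \<open>u \<mapsto> Q (r * u)\<close>, the inversion formula makes the
  integral of \<open>Q\<close> over \<open>{0..r}\<close> vanish for every \<open>r\<close> up to 1.
  Its derivative at the right end point is \<open>Q 1\<close>.\<close>

lemma abel_transform_injective_at_1:
  fixes Q :: "real \<Rightarrow> real"
  assumes cont: "continuous_on UNIV Q"
    and zero: "\<And>c. c \<in> {0..1} \<Longrightarrow> integral {0..pi/2} (\<lambda>t. Q (c * sin t)) = 0"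
  shows "Q 1 = 0"
proof -
  define J where "J r = integral {0..r} Q" for r
  have J0: "J r = 0" if r: "0 \<le> r" "r \<le> 1" for r
  proof (cases "r = 0")
    case False
    have cr: "continuous_on UNIV (\<lambda>u. Q (r * u))"
      by (intro continuous_on_compose2[OF cont] continuous_intros) auto
    have "integral {0..pi/2} (\<lambda>a. sin a * integral {0..pi/2} (\<lambda>t. Q (r * (sin a * sin t))))
       = integral {0..pi/2} (\<lambda>a. 0)"
    proof (rule integral_cong)
      fix a :: real assume "a \<in> {0..pi/2}"
      then have "0 \<le> sin a" by (auto intro: sin_ge_zero)
      then have "r * sin a \<in> {0..1}" using r by (auto intro: mult_le_one)
      then show "sin a * integral {0..pi/2} (\<lambda>t. Q (r * (sin a * sin t))) = 0"
        using zero[of "r * sin a"] by (simp add: mult.assoc)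
    qed
    then have "integral {0..1} (\<lambda>u. Q (r * u)) = 0" using abel_inversion[OF cr] by simp
    moreover have "((\<lambda>u. Q (r * u)) has_integral (1 / r) *\<^sub>R J r) {0..1}"
    proof -
      have "(Q has_integral J r) (cbox 0 r)"
        unfolding J_def by (auto intro!: integrable_integral integrable_continuous_interval continuous_on_subset[OF cont])
      from has_integral_affinity'[OF this, of r 0] False r
      show ?thesis by (simp add: inverse_eq_divide)
    qed
    ultimately show ?thesis using False by (simp add: integral_unique)
  qed (simp add: J_def)
  have "(J has_real_derivative Q 1) (at 1 within {0..1})"
    unfolding J_def by (rule integral_has_real_derivative) (auto intro: continuous_on_subset[OF cont])
  then have "((\<lambda>_. 0) has_real_derivative Q 1) (at 1 within {0..1})"
    by (rule has_field_derivative_transform_within[of _ _ _ _ 1]) (auto simp: J0)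
  moreover have "((\<lambda>_. 0) has_real_derivative 0) (at (1::real) within {0..1})" by simp
  ultimately show "Q 1 = 0"
    unfolding has_real_derivative_iff_has_vector_derivative
    by (intro vector_derivative_unique_within_closed_interval[of 0 1 1 "\<lambda>_. 0" "Q 1" 0]) auto
qed

lemma integral_sin_symmetric:
  fixes Q :: "real \<Rightarrow> real"
  assumes cont: "continuous_on UNIV Q" and even: "\<And>u. Q (- u) = Q u"
  shows "integral {0..2*pi} (\<lambda>t. Q (c * sin t)) = 4 * integral {0..pi/2} (\<lambda>t. Q (c * sin t))"
proof -
  define f where "f t = Q (c * sin t)" for t
  have cf: "continuous_on UNIV f" unfolding f_def
    by (intro continuous_on_compose2[OF cont] continuous_intros) auto
  have int: "f integrable_on {a..b}" for a b
    by (intro integrable_continuous_interval continuous_on_subset[OF cf]) simp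
  have f1: "f (x + pi) = f x" and f2: "f (pi - x) = f x" for x
    using even[of "c * sin x"] by (simp_all add: f_def sin_add)
  have "(f has_integral integral {pi..2*pi} f) (cbox pi (2*pi))"
    using int by (simp add: integrable_integral)
  from has_integral_affinity'[OF this, of 1 pi] have "integral {0..pi} f = integral {pi..2*pi} f"
    by (simp add: f1 integral_unique)
  moreover have "(f has_integral integral {pi/2..pi} f) (cbox (pi/2) pi)"
    using int by (simp add: integrable_integral)
  from has_integral_affinity[OF this, of "-1" pi] have "integral {0..pi/2} f = integral {pi/2..pi} f"
    by (simp add: f1 f2 integral_unique)
  moreover have "integral {0..pi/2} f + integral {pi/2..pi} f = integral {0..pi} f"
    "integral {0..pi} f + integral {pi..2*pi} f = integral {0..2*pi} f"
    using int by (intro Henstock_Kurzweil_Integration.integral_combine; simp)+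
  ultimately have "integral {0..2*pi} f = 4 * integral {0..pi/2} f" by linarith
  moreover have "f = (\<lambda>t. Q (c * sin t))" by (simp add: fun_eq_iff f_def)
  ultimately show ?thesis by simp
qed

text \<open>Averaging over the rotations that fix \<open>v\<close> reduces the claim to a function of one variable.\<close>

lemma funk_transform_injective_aux:
  fixes D :: "'a::euclidean_space \<Rightarrow> real"
  assumes dim: "4 \<le> DIM('a)" and cont: "continuous_on UNIV D" and even: "\<And>u. D (- u) = D u"
    and zero: "\<And>p. p \<in> opair \<zeta> \<Longrightarrow> integral {0..2*pi} (\<lambda>s. D (circ p s)) = 0"
    and v: "norm v = 1" "\<zeta> \<bullet> v = 0"
  shows "D v = 0"
proof -
  obtain a where va: "(v, a) \<in> opair \<zeta>" by (rule opair_nonempty[OF dim v])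
  obtain b where b: "(v, b) \<in> opair \<zeta>" "(a, b) \<in> opair \<zeta>" using opair_frame[OF dim va] .
  have frame: "v \<bullet> v = 1" "a \<bullet> a = 1" "b \<bullet> b = 1" "v \<bullet> a = 0" "a \<bullet> v = 0" "v \<bullet> b = 0" "b \<bullet> v = 0"
    "a \<bullet> b = 0" "b \<bullet> a = 0" "\<zeta> \<bullet> v = 0" "\<zeta> \<bullet> a = 0" "\<zeta> \<bullet> b = 0"
    using va b by (auto simp: opair_def norm_eq_1 inner_commute)
  \<comment> \<open>The integral of \<open>D\<close> over the parallel at height \<open>z\<close> on
    the 2-sphere with pole \<open>v\<close> spanned by \<open>v\<close>, \<open>a\<close>,
    \<open>b\<close>. At the pole the parallel shrinks to a point, so
    \<open>Q 1 = 2 * pi * D v\<close>.\<close>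
  define Q where "Q z = integral {0..2*pi} (\<lambda>s. D (z *\<^sub>R v + sqrt (1 - z\<^sup>2) *\<^sub>R circ (a, b) s))" for z
  have cQ: "continuous_on UNIV Q"
  proof -
    have "continuous_on (UNIV \<times> cbox 0 (2*pi)) (\<lambda>(z, s). D (z *\<^sub>R v + sqrt (1 - z\<^sup>2) *\<^sub>R circ (a, b) s))"
      unfolding split_beta by (intro continuous_on_compose2[OF cont] continuous_intros) auto
    then show ?thesis unfolding Q_def
      using integral_continuous_on_param[of UNIV 0 "2*pi" "\<lambda>z s. D (z *\<^sub>R v + sqrt (1 - z\<^sup>2) *\<^sub>R circ (a, b) s)"] by simp
  qed
  have shift: "integral {0..2*pi} (\<lambda>s. D (z *\<^sub>R v + r *\<^sub>R circ (a, b) (s + w)))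
      = integral {0..2*pi} (\<lambda>s. D (z *\<^sub>R v + r *\<^sub>R circ (a, b) s))" for z r w
  proof (rule integral_periodic_shift[of "\<lambda>s. D (z *\<^sub>R v + r *\<^sub>R circ (a, b) s)"])
    show "continuous_on UNIV (\<lambda>s. D (z *\<^sub>R v + r *\<^sub>R circ (a, b) s))"
      by (intro continuous_on_compose2[OF cont] continuous_intros) auto
    show "D (z *\<^sub>R v + r *\<^sub>R circ (a, b) (s + 2 * pi)) = D (z *\<^sub>R v + r *\<^sub>R circ (a, b) s)" for s
      using circ_add_2pi[of "(a, b)" s 1] by simp
  qed
  have Q_even: "Q (- u) = Q u" for u
  proof -
    have "Q (- u) = integral {0..2*pi} (\<lambda>s. D (- (u *\<^sub>R v + sqrt (1 - u\<^sup>2) *\<^sub>R circ (a, b) (s + pi))))"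
      by (simp add: Q_def algebra_simps)
    then show ?thesis by (simp only: even shift Q_def)
  qed
  have "integral {0..pi/2} (\<lambda>t. Q (c * sin t)) = 0" if c: "c \<in> {0..1}" for c
  proof -
    define d where "d = sqrt (1 - c\<^sup>2)"
    have "c\<^sup>2 \<le> 1" using c by (simp add: power_le_one)
    then have d: "d * d = 1 - c * c" unfolding d_def by (simp add: power2_eq_square)
    \<comment> \<open>For fixed \<open>c\<close> these are the great circles of that 2-sphere whose
      greatest height is \<open>c\<close>, one for each rotation \<open>s\<close> about
      \<open>v\<close>.\<close>
    define p where "p s = (circ (a, b) (s + pi/2), c *\<^sub>R v + d *\<^sub>R circ (a, b) s)" for s
    have p: "p s \<in> opair \<zeta>" for s
    proof -
      have cs: "cos s * cos s + sin s * sin s = 1" using sin_cos_squared_add3[of s] by simp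
      then have "c * c + d * (cos s * (d * cos s) + sin s * (d * sin s)) = 1" using d by algebra
      with cs show ?thesis
        unfolding p_def opair_iff norm_eq_1 fst_conv snd_conv circ_def
        by (simp add: inner_add_left inner_add_right inner_diff_left inner_diff_right frame cos_add sin_add)
    qed
    have Qt: "integral {0..2*pi} (\<lambda>s. D (circ (p s) t)) = Q (c * sin t)" for t
    proof -
      define r where "r = sqrt (1 - (c * sin t)\<^sup>2)"
      have "(c * sin t)\<^sup>2 \<le> 1"
        using c by (simp add: power_mult_distrib mult_le_one power_le_one abs_square_le_1)
      then have rr: "r\<^sup>2 = 1 - (c * sin t)\<^sup>2" unfolding r_def by simp
      also have "\<dots> = (cos t)\<^sup>2 + (d * sin t)\<^sup>2"
        using d sin_cos_squared_add[of t] unfolding power2_eq_square by algebra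
      finally have rr: "r\<^sup>2 = (cos t)\<^sup>2 + (d * sin t)\<^sup>2" .
      \<comment> \<open>The point at parameter \<open>t\<close> has height \<open>c * sin t\<close>
        and longitude \<open>s + w\<close> with \<open>w\<close> independent of \<open>s\<close>, so
        integrating over \<open>s\<close> sweeps the whole parallel.\<close>
      obtain w where w: "cos t = r * sin w" "d * sin t = r * cos w"
      proof (cases "r = 0")
        case True
        then have "cos t = 0" "d * sin t = 0" using rr by (simp_all add: sum_power2_eq_zero_iff)
        then show thesis using True that[of 0] by simp
      next
        case False
        have "(d * sin t / r)\<^sup>2 + (cos t / r)\<^sup>2 = ((cos t)\<^sup>2 + (d * sin t)\<^sup>2) / r\<^sup>2"
          by (simp only: power_divide add_divide_distrib add.commute)
        also have "\<dots> = 1" unfolding rr[symmetric] using False by simp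
        finally obtain w where "d * sin t / r = cos w" "cos t / r = sin w" by (metis sincos_total_2pi)
        then show thesis using False that[of w] by (simp add: field_simps)
      qed
      have "circ (p s) t = (c * sin t) *\<^sub>R v + r *\<^sub>R circ (a, b) (s + w)" for s
      proof -
        have "circ (p s) t = (c * sin t) *\<^sub>R v + (cos t *\<^sub>R circ (a, b) (s + pi/2) + (d * sin t) *\<^sub>R circ (a, b) s)"
          unfolding p_def circ_def[of "(circ (a, b) (s + pi/2), c *\<^sub>R v + d *\<^sub>R circ (a, b) s)" t]
          by (simp add: algebra_simps)
        also have "cos t *\<^sub>R circ (a, b) (s + pi/2) + (d * sin t) *\<^sub>R circ (a, b) s = r *\<^sub>R circ (a, b) (s + w)"
          unfolding w by (simp add: circ_def cos_add sin_add algebra_simps)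
        finally show ?thesis .
      qed
      then show ?thesis by (simp add: shift Q_def r_def)
    qed
    \<comment> \<open>Every inner integral is over a great circle and vanishes. In the other order
      of integration the inner integral is over a parallel and equals
      \<open>Q (c * sin t)\<close>.\<close>
    have "0 = integral (cbox 0 (2*pi)) (\<lambda>s. integral (cbox 0 (2*pi)) (\<lambda>t. D (circ (p s) t)))"
      using zero[OF p] by simp
    also have "\<dots> = integral (cbox 0 (2*pi)) (\<lambda>t. integral (cbox 0 (2*pi)) (\<lambda>s. D (circ (p s) t)))"
    proof (rule integral_swap_continuous)
      show "continuous_on (cbox (0, 0) (2*pi, 2*pi)) (\<lambda>(s, t). D (circ (p s) t))"
        unfolding split_beta p_def by (intro continuous_on_compose2[OF cont] continuous_intros) auto
    qed
    also have "\<dots> = integral {0..2*pi} (\<lambda>t. Q (c * sin t))" using Qt by simp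
    finally show ?thesis using integral_sin_symmetric[OF cQ Q_even] by simp
  qed
  then have "Q 1 = 0" using abel_transform_injective_at_1[OF cQ] by blast
  then show ?thesis by (simp add: Q_def)
qed

lemma funk_transform_injective:
  fixes D :: "'a::euclidean_space \<Rightarrow> real"
  assumes dim: "4 \<le> DIM('a)" and cont: "continuous_on UNIV D"
    and zero: "\<And>p. p \<in> opair \<zeta> \<Longrightarrow> integral {0..2*pi} (\<lambda>s. D (circ p s)) = 0"
    and v: "norm v = 1" "\<zeta> \<bullet> v = 0"
  shows "D v + D (- v) = 0"
proof (rule funk_transform_injective_aux[OF dim _ _ _ v, of "\<lambda>v. D v + D (- v)"])
  have cm: "continuous_on UNIV (\<lambda>v. D (- v))"
    by (intro continuous_on_compose2[OF cont] continuous_intros) auto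
  then show "continuous_on UNIV (\<lambda>v. D v + D (- v))" by (intro continuous_intros cont)
  fix p assume p: "p \<in> opair \<zeta>"
  have c1: "continuous_on UNIV (\<lambda>s. D (circ p s))"
    by (intro continuous_on_compose2[OF cont] continuous_intros) auto
  have c2: "continuous_on UNIV (\<lambda>s. D (- circ p s))"
    by (intro continuous_on_compose2[OF cont] continuous_intros) auto
  have "integral {0..2*pi} (\<lambda>s. D (- circ p s)) = integral {0..2*pi} (\<lambda>s. D (circ p (s + pi)))" by simp
  also have "\<dots> = integral {0..2*pi} (\<lambda>s. D (circ p s))"
    by (rule integral_periodic_shift[OF c1]) (use circ_add_2pi[of p _ 1] in simp)
  finally have "integral {0..2*pi} (\<lambda>s. D (- circ p s)) = 0" using zero[OF p] by simp
  then show "integral {0..2*pi} (\<lambda>s. D (circ p s) + D (- circ p s)) = 0"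
    using zero[OF p] by (subst Henstock_Kurzweil_Integration.integral_add)
      (auto intro!: integrable_continuous_interval continuous_on_subset[OF c1] continuous_on_subset[OF c2])
qed (simp add: add.commute)

section \<open>Rotations on all circles\<close>

text \<open>Gram-Schmidt: \<open>w\<close> is the normalised part of \<open>y'\<close> orthogonal to
  \<open>y\<close>. If that part is zero then \<open>y'\<close> is \<open>y\<close> or
  \<open>- y\<close>, and any completing vector serves.\<close>

lemma opair_arc:
  fixes \<zeta> :: "'a::euclidean_space"
  assumes dim: "4 \<le> DIM('a)" and xy: "(x, y) \<in> opair \<zeta>" and xy': "(x, y') \<in> opair \<zeta>"
  obtains w s where "(x, w) \<in> opair \<zeta>" "(y, w) \<in> opair \<zeta>" "y' = circ (y, w) s"
proof -
  define r where "r = y' - (y' \<bullet> y) *\<^sub>R y"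
  have n: "x \<bullet> x = 1" "y \<bullet> y = 1" "y' \<bullet> y' = 1" "x \<bullet> y = 0" "x \<bullet> y' = 0" "\<zeta> \<bullet> x = 0" "\<zeta> \<bullet> y = 0" "\<zeta> \<bullet> y' = 0"
    using xy xy' by (auto simp: opair_def norm_eq_1)
  have rr: "r \<bullet> r = 1 - (y' \<bullet> y)\<^sup>2" "x \<bullet> r = 0" "y \<bullet> r = 0" "\<zeta> \<bullet> r = 0"
    by (simp_all add: r_def inner_diff_left inner_diff_right n power2_eq_square inner_commute[of y y'])
  show thesis
  proof (cases "r = 0")
    case True
    then have y': "y' = (y' \<bullet> y) *\<^sub>R y" by (simp add: r_def)
    have "(y' \<bullet> y)\<^sup>2 = 1" using rr(1) True by simp
    then have "y' \<bullet> y = 1 \<or> y' \<bullet> y = -1" by (simp add: power2_eq_1_iff)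
    then have "y' = circ (y, w) 0 \<or> y' = circ (y, w) pi" for w
      using y' by (auto simp: circ_def)
    moreover obtain w where "(x, w) \<in> opair \<zeta>" "(y, w) \<in> opair \<zeta>" using opair_frame[OF dim xy] .
    ultimately show thesis using that by blast
  next
    case False
    define w where "w = (1 / norm r) *\<^sub>R r"
    have "(y' \<bullet> y)\<^sup>2 + (norm r)\<^sup>2 = 1" using rr(1) by (simp add: power2_norm_eq_inner)
    then obtain s where s: "y' \<bullet> y = cos s" "norm r = sin s" by (metis sincos_total_2pi)
    have "norm r *\<^sub>R w = r" using False by (simp add: w_def)
    then have "y' = circ (y, w) s" by (simp add: circ_def r_def flip: s)
    moreover have "(x, w) \<in> opair \<zeta>" "(y, w) \<in> opair \<zeta>"
      using xy rr False by (auto simp: opair_def w_def)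
    ultimately show thesis using that by blast
  qed
qed

text \<open>Turning the second vector along an arc is a connected path, on which two disjoint closed
  alternatives cannot switch. Arbitrary pairs are joined through a \<open>z\<close> orthogonal to
  both first vectors: \<open>(x, y)\<close>, \<open>(x, z)\<close>, \<open>(z, x)\<close>,
  \<open>(z, x')\<close>, \<open>(x', z)\<close>, \<open>(x', y')\<close>. So \<open>P\<close>
  spreads from any one pair to all; otherwise \<open>Q\<close> holds throughout.\<close>

lemma opair_connected:
  fixes \<zeta> :: "'a::euclidean_space"
  assumes dim: "4 \<le> DIM('a)"
    and clP: "closed {p \<in> opair \<zeta>. P p}" and clQ: "closed {p \<in> opair \<zeta>. Q p}"
    and cover: "\<And>p. p \<in> opair \<zeta> \<Longrightarrow> P p \<or> Q p" and disj: "\<And>p. p \<in> opair \<zeta> \<Longrightarrow> \<not> (P p \<and> Q p)"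
    and swap: "\<And>x y. (x, y) \<in> opair \<zeta> \<Longrightarrow> P (x, y) \<Longrightarrow> P (y, x)"
  shows "(\<forall>p \<in> opair \<zeta>. P p) \<or> (\<forall>p \<in> opair \<zeta>. Q p)"
proof -
  have move: "P (x, y')" if "P (x, y)" and xy: "(x, y) \<in> opair \<zeta>" and xy': "(x, y') \<in> opair \<zeta>" for x y y'
  proof -
    obtain w s where w: "(x, w) \<in> opair \<zeta>" "(y, w) \<in> opair \<zeta>" and s: "y' = circ (y, w) s"
      using opair_arc[OF dim xy xy'] .
    note mem = opair_snd_circ[OF xy w]
    have cont: "continuous_on UNIV (\<lambda>u. (x, circ (y, w) u))" by (intro continuous_intros)
    define S T where "S = {u. P (x, circ (y, w) u)}" and "T = {u. Q (x, circ (y, w) u)}"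
    have "S = (\<lambda>u. (x, circ (y, w) u)) -` {p \<in> opair \<zeta>. P p}" "T = (\<lambda>u. (x, circ (y, w) u)) -` {p \<in> opair \<zeta>. Q p}"
      using mem by (auto simp: S_def T_def)
    then have cl: "closed S" "closed T"
      using closed_vimage[OF clP cont] closed_vimage[OF clQ cont] by simp_all
    have "S \<inter> T \<inter> UNIV = {}" "UNIV \<subseteq> S \<union> T" using cover[OF mem] disj[OF mem] by (auto simp: S_def T_def)
    then have "S \<inter> UNIV = {} \<or> T \<inter> UNIV = {}"
      using connected_closedD[OF connected_UNIV _ _ cl] by blast
    moreover have "0 \<in> S" using that(1) by (simp add: S_def)
    ultimately have "s \<notin> T" by auto
    then show ?thesis using cover[OF mem[of s]] by (auto simp: T_def s)
  qed
  have "P (x', y')" if P: "P (x, y)" and xy: "(x, y) \<in> opair \<zeta>" and xy': "(x', y') \<in> opair \<zeta>" for x y x' y'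
  proof -
    have "card {x, x', \<zeta>} \<le> 3" by (simp add: card_insert_if)
    with dim have "card {x, x', \<zeta>} < DIM('a)" by linarith
    then obtain z where "norm z = 1" "\<And>u. u \<in> {x, x', \<zeta>} \<Longrightarrow> u \<bullet> z = 0"
      by (rule exists_unit_orthogonal_vector[rotated]) auto
    then have z: "(x, z) \<in> opair \<zeta>" "(x', z) \<in> opair \<zeta>" using xy xy' by (auto simp: opair_def)
    have "P (z, x)" using swap[OF z(1)] move[OF P xy z(1)] by blast
    then have "P (x', z)" using swap move swap_in_opair z by metis
    then show ?thesis using move[OF _ z(2) xy'] by blast
  qed
  then show ?thesis using cover by fastforce
qed

section \<open>Chains of circles linked by a fixed angle\<close>

lemma norm_rot [simp]: "norm (rot p a) = norm p" for p :: "'a::euclidean_space \<times> 'a"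
proof -
  obtain x y where p: "p = (x, y)" by fastforce
  have cs: "cos a * cos a + sin a * sin a = 1" using sin_cos_squared_add3[of a] by simp
  have "(cos a *\<^sub>R x + sin a *\<^sub>R y) \<bullet> (cos a *\<^sub>R x + sin a *\<^sub>R y)
      + (cos a *\<^sub>R y - sin a *\<^sub>R x) \<bullet> (cos a *\<^sub>R y - sin a *\<^sub>R x)
      = (cos a * cos a + sin a * sin a) * (x \<bullet> x + y \<bullet> y)"
    by (simp only: inner_add_left inner_add_right inner_diff_left inner_diff_right inner_scaleR_left
        inner_scaleR_right inner_commute[of y x]) algebra
  then show ?thesis unfolding cs by (simp add: p rot_eq norm_Pair power2_norm_eq_inner)
qed

lemma dist_rot: "dist (rot p a) (rot q a) = dist p q" for p :: "'a::euclidean_space \<times> 'a"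
proof -
  have "rot p a - rot q a = rot (p - q) a"
    by (simp add: rot_eq prod_eq_iff algebra_simps)
  then show ?thesis by (simp add: dist_norm)
qed

text \<open>Two circles, one starting at \<open>x\<close> and one at \<open>p\<close>, both with
  second vector near \<open>y\<close>, meet at the angle \<alpha>. A set invariant under the
  rotation by \<alpha> on both circles contains either both of \<open>x\<close> and \<open>p\<close>
  or neither.\<close>

definition linked :: "'a::euclidean_space \<Rightarrow> real \<Rightarrow> real \<Rightarrow> 'a \<Rightarrow> 'a \<Rightarrow> 'a \<Rightarrow> bool" where
  "linked \<zeta> \<alpha> \<delta> x p y \<longleftrightarrow> (\<exists>y\<^sub>1 y\<^sub>2. (x, y\<^sub>1) \<in> opair \<zeta> \<and> (p, y\<^sub>2) \<in> opair \<zeta> \<and>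
     circ (x, y\<^sub>1) \<alpha> = circ (p, y\<^sub>2) \<alpha> \<and> norm (y\<^sub>1 - y) < \<delta> \<and> norm (y\<^sub>2 - y) < \<delta>)"

text \<open>The common value of the two \<open>circ\<close> terms is \<open>(cos \<alpha> / (1 + x \<bullet> p)) *\<^sub>R (x + p) + d *\<^sub>R \<nu>\<close>, a point
  at spherical distance \<open>\<alpha>\<close> from both \<open>x\<close> and \<open>p\<close>.\<close>

lemma linked_if_close:
  assumes k0: "sin \<alpha> \<noteq> 0" and o: "(x, \<nu>) \<in> opair \<zeta>" "(p, \<nu>) \<in> opair \<zeta>" and \<kappa>: "\<kappa> = x \<bullet> p"
    and pos: "0 < 1 + \<kappa>" "2 * (cos \<alpha>)\<^sup>2 / (1 + \<kappa>) < 1"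
    and small: "\<bar>cos \<alpha>\<bar> * sqrt (1 - \<kappa>\<^sup>2) / (1 + \<kappa>)
      + \<bar>sgn (sin \<alpha>) * sqrt (1 - 2 * (cos \<alpha>)\<^sup>2 / (1 + \<kappa>)) - sin \<alpha>\<bar> < \<delta> * \<bar>sin \<alpha>\<bar>"
  shows "linked \<zeta> \<alpha> \<delta> x p \<nu>"
proof -
  \<comment> \<open>The coefficient \<open>c * A\<close> gives the common point inner product
    \<open>cos \<alpha>\<close> with both \<open>x\<close> and \<open>p\<close>; \<open>d\<close> is
    then forced up to sign by unit length. The sign of \<open>sin \<alpha>\<close> keeps the
    resulting second vectors near \<nu> rather than near \<open>- \<nu>\<close>.\<close>
  define c k A d where "c = cos \<alpha>" and "k = sin \<alpha>" and "A = 1 / (1 + \<kappa>)"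
    and "d = sgn k * sqrt (1 - 2 * c\<^sup>2 / (1 + \<kappa>))"
  have ck: "c\<^sup>2 + k\<^sup>2 = 1" by (simp add: c_def k_def)
  have k: "k \<noteq> 0" using k0 by (simp add: k_def)
  have A: "A * (1 + \<kappa>) = 1" using pos(1) by (simp add: A_def)
  have d2: "d\<^sup>2 = 1 - 2 * c\<^sup>2 * A"
    using k pos(2) by (simp add: d_def power_mult_distrib sgn_if c_def A_def)
  \<comment> \<open>Solves \<open>circ (u, y u v) \<alpha> = (c * A) *\<^sub>R (u + v) + d *\<^sub>R
    \<nu>\<close> for the second vector. The right-hand side is symmetric in \<open>u\<close> and
    \<open>v\<close>, so both circles reach the same point.\<close>
  define y where "y u v = (1 / k) *\<^sub>R ((c * A) *\<^sub>R (v - \<kappa> *\<^sub>R u) + d *\<^sub>R \<nu>)" for u v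
  have y: "(u, y u v) \<in> opair \<zeta> \<and> norm (y u v - \<nu>) < \<delta>
      \<and> circ (u, y u v) \<alpha> = (c * A) *\<^sub>R (u + v) + d *\<^sub>R \<nu>"
    if uv: "(u, \<nu>) \<in> opair \<zeta>" "(v, \<nu>) \<in> opair \<zeta>" "u \<bullet> v = \<kappa>" for u v
  proof -
    have f: "u \<bullet> u = 1" "v \<bullet> v = 1" "\<nu> \<bullet> \<nu> = 1" "u \<bullet> \<nu> = 0" "\<nu> \<bullet> u = 0" "v \<bullet> \<nu> = 0" "\<nu> \<bullet> v = 0"
      "v \<bullet> u = \<kappa>" "\<zeta> \<bullet> u = 0" "\<zeta> \<bullet> v = 0" "\<zeta> \<bullet> \<nu> = 0"
      using uv by (auto simp: opair_def norm_eq_1 inner_commute)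
    have ww: "(v - \<kappa> *\<^sub>R u) \<bullet> (v - \<kappa> *\<^sub>R u) = 1 - \<kappa>\<^sup>2"
      by (simp add: inner_diff_left inner_diff_right f uv(3) power2_eq_square)
    have "y u v \<bullet> y u v = (1 / k)\<^sup>2 * ((c * A)\<^sup>2 * ((v - \<kappa> *\<^sub>R u) \<bullet> (v - \<kappa> *\<^sub>R u)) + d\<^sup>2)"
      by (simp add: y_def inner_add_left inner_add_right inner_diff_left inner_diff_right f uv(3)
          power2_eq_square distrib_left)
    also have "(c * A)\<^sup>2 * ((v - \<kappa> *\<^sub>R u) \<bullet> (v - \<kappa> *\<^sub>R u)) + d\<^sup>2 = k\<^sup>2"
      unfolding ww d2 using A ck by algebra
    finally have "y u v \<bullet> y u v = 1" using k by (simp add: power_divide)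
    then have "(u, y u v) \<in> opair \<zeta>"
      using uv(1) by (simp add: opair_def norm_eq_1 y_def inner_add_right inner_diff_right f uv(3))
    moreover have "norm (y u v - \<nu>) < \<delta>"
    proof -
      have "y u v - \<nu> = (1 / k) *\<^sub>R ((c * A) *\<^sub>R (v - \<kappa> *\<^sub>R u) + (d - k) *\<^sub>R \<nu>)"
        using k by (simp add: y_def algebra_simps)
      then have "norm (y u v - \<nu>) = norm ((c * A) *\<^sub>R (v - \<kappa> *\<^sub>R u) + (d - k) *\<^sub>R \<nu>) / \<bar>k\<bar>" by simp
      also have "\<dots> \<le> (\<bar>c * A\<bar> * sqrt (1 - \<kappa>\<^sup>2) + \<bar>d - k\<bar>) / \<bar>k\<bar>"
        using uv(1) ww
        by (intro divide_right_mono norm_triangle_le) (simp_all add: norm_eq_sqrt_inner[of "v - _"] opair_def)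
      also have "\<dots> < \<delta>" using small k pos(1)
        by (simp add: pos_divide_less_eq abs_mult A_def d_def c_def k_def)
      finally show ?thesis .
    qed
    moreover have "circ (u, y u v) \<alpha> = (c * A) *\<^sub>R (u + v) + d *\<^sub>R \<nu>"
    proof -
      have "circ (u, y u v) \<alpha> = c *\<^sub>R u + k *\<^sub>R y u v" by (simp add: circ_def c_def k_def)
      also have "k *\<^sub>R y u v = (c * A) *\<^sub>R (v - \<kappa> *\<^sub>R u) + d *\<^sub>R \<nu>" using k by (simp add: y_def)
      also have "c *\<^sub>R u = (c * (A * (1 + \<kappa>))) *\<^sub>R u" using A by simp
      finally show ?thesis by (simp add: algebra_simps)
    qed
    ultimately show ?thesis by blast
  qed
  show ?thesis unfolding linked_def
    using y[OF o \<kappa>[symmetric]] y[OF o(2,1)] \<kappa> by (metis add.commute inner_commute)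
qed

definition chain_point :: "'a::real_normed_vector \<Rightarrow> 'a \<Rightarrow> 'a \<Rightarrow> real \<Rightarrow> 'a" where
  "chain_point x y w \<epsilon> = sqrt (1 - sin \<epsilon>) *\<^sub>R circ (x, y) \<epsilon> + sqrt (sin \<epsilon>) *\<^sub>R w"

text \<open>Choosing the height \<open>sqrt (sin \<epsilon>)\<close> of \<open>chain_point\<close> over the circle much larger than \<open>\<epsilon>\<close> makes
  the direction orthogonal to \<open>x\<close> and \<open>chain_point x y w \<epsilon>\<close> close to \<open>y\<close>.\<close>

lemma half_chain:
  fixes \<zeta> :: "'a::euclidean_space"
  assumes k0: "sin \<alpha> \<noteq> 0" and \<delta>: "0 < \<delta>"
  obtains \<epsilon>\<^sub>0 where "0 < \<epsilon>\<^sub>0"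
    "\<And>\<epsilon> x y w. \<lbrakk>0 < \<epsilon>; \<epsilon> < \<epsilon>\<^sub>0; (x, y) \<in> opair \<zeta>; (x, w) \<in> opair \<zeta>; (y, w) \<in> opair \<zeta>\<rbrakk> \<Longrightarrow>
       linked \<zeta> \<alpha> \<delta> x (chain_point x y w \<epsilon>) y \<and> norm (chain_point x y w \<epsilon> - x) < \<delta>"
proof -
  \<comment> \<open>Coordinates of \<open>chain_point\<close> in the frame \<open>x\<close>,
    \<open>y\<close>, \<open>w\<close>, and the ratio \<open>g\<close> with
    \<open>Q e = g e * R e\<close>. That \<open>g\<close> tends to 0 expresses that the height
    dominates the displacement along \<open>y\<close>.\<close>
  define P Q R g where "P e = sqrt (1 - sin e) * cos e" and "Q e = sqrt (1 - sin e) * sin e"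
    and "R e = sqrt (sin e)" and "g e = sqrt (1 - sin e) * sqrt (sin e)" for e :: real
  define S where "S e = sqrt (1 + (g e)\<^sup>2)" for e
  have S: "S e \<noteq> 0" "(S e)\<^sup>2 = 1 + (g e)\<^sup>2" for e
    unfolding S_def by (simp_all add: add_nonneg_eq_0_iff)
  have cont: "isCont P 0" "isCont Q 0" "isCont R 0" "isCont g 0" "isCont S 0"
    unfolding P_def Q_def R_def g_def S_def by (intro continuous_intros)+
  have at0: "P 0 = 1" "Q 0 = 0" "R 0 = 0" "g 0 = 0" "S 0 = 1" by (simp_all add: P_def Q_def R_def g_def S_def)
  define c k where "c = cos \<alpha>" and "k = sin \<alpha>"
  have ck: "1 - c\<^sup>2 = k\<^sup>2" by (simp add: c_def k_def sin_squared_eq)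
  have k: "k \<noteq> 0" using k0 by (simp add: k_def)
  \<comment> \<open>\<open>f0\<close> and \<open>f1\<close> are the two quantities bounded in
    \<open>linked_if_close\<close> at \<open>\<kappa> = P e\<close>; \<open>f2\<close> bounds the
    distance from \<nu> to \<open>y\<close>, and \<open>f3\<close> the distance from the chain point
    to \<open>x\<close>.\<close>
  define f0 f1 f2 f3 where "f0 e = 2 * c\<^sup>2 / (1 + P e)"
    and "f1 e = \<bar>c\<bar> * sqrt (1 - (P e)\<^sup>2) / (1 + P e) + \<bar>sgn k * sqrt (1 - f0 e) - k\<bar>"
    and "f2 e = \<bar>1 / S e - 1\<bar> + \<bar>g e / S e\<bar>" and "f3 e = \<bar>P e - 1\<bar> + \<bar>Q e\<bar> + \<bar>R e\<bar>" for e
  have contf: "isCont f0 0" unfolding f0_def by (intro continuous_intros cont) (simp add: at0)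
  have contf': "isCont f1 0" "isCont f2 0" "isCont f3 0" unfolding f1_def f2_def f3_def
    by (intro continuous_intros cont contf S; simp add: at0)+
  have ev: "\<forall>\<^sub>F e in at_right 0. f e < b" if "isCont f 0" "f 0 < b" for f :: "real \<Rightarrow> real" and b
  proof -
    have "(f \<longlongrightarrow> f 0) (at_right 0)" using that(1) by (simp add: isCont_def filterlim_at_split)
    then show ?thesis using that(2) by (rule order_tendstoD)
  qed
  have "sgn k * sqrt (1 - f0 0) = k" using ck by (simp add: f0_def at0 sgn_mult_abs)
  then have z: "f1 0 = 0" "f2 0 = 0" "f3 0 = 0" by (simp_all add: f1_def f2_def f3_def at0)
  have "0 < k\<^sup>2" using k by simp
  with ck have "c\<^sup>2 < 1" by linarith
  then have "f0 0 < 1" by (simp add: f0_def at0)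
  then have "\<forall>\<^sub>F e in at_right 0. f0 e < 1" by (rule ev[OF contf])
  moreover have "\<forall>\<^sub>F e in at_right 0. - P e < 0" by (intro ev continuous_intros cont) (simp add: at0)
  moreover have "\<forall>\<^sub>F e in at_right 0. f1 e < \<delta> / 2 * \<bar>k\<bar>" "\<forall>\<^sub>F e in at_right 0. f2 e < \<delta> / 2"
    "\<forall>\<^sub>F e in at_right 0. f3 e < \<delta>"
    by (intro ev contf'; simp add: z \<delta> k)+
  moreover have "\<forall>\<^sub>F e in at_right (0::real). 0 < e \<and> e < pi / 2"
    by (auto simp: eventually_at_right_field intro!: exI[of _ "pi / 2"])
  ultimately have "\<forall>\<^sub>F e in at_right 0. f0 e < 1 \<and> - P e < 0 \<and> f1 e < \<delta> / 2 * \<bar>k\<bar> \<and> f2 e < \<delta> / 2 \<and> f3 e < \<delta>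
     \<and> 0 < e \<and> e < pi / 2"
    by eventually_elim blast
  then obtain e0 where e0: "0 < e0" "\<And>e. 0 < e \<Longrightarrow> e < e0 \<Longrightarrow> f0 e < 1 \<and> - P e < 0 \<and> f1 e < \<delta> / 2 * \<bar>k\<bar>
     \<and> f2 e < \<delta> / 2 \<and> f3 e < \<delta> \<and> 0 < e \<and> e < pi / 2"
    by (auto simp: eventually_at_right_field)
  show thesis
  proof (rule that[OF e0(1)])
    fix e x y w assume e: "0 < e" "e < e0" and o: "(x, y) \<in> opair \<zeta>" "(x, w) \<in> opair \<zeta>" "(y, w) \<in> opair \<zeta>"
    note E = e0(2)[OF e]
    have frame: "x \<bullet> x = 1" "y \<bullet> y = 1" "w \<bullet> w = 1" "x \<bullet> y = 0" "y \<bullet> x = 0" "x \<bullet> w = 0" "w \<bullet> x = 0"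
      "y \<bullet> w = 0" "w \<bullet> y = 0" "\<zeta> \<bullet> x = 0" "\<zeta> \<bullet> y = 0" "\<zeta> \<bullet> w = 0" "norm x = 1" "norm y = 1" "norm w = 1"
      using o by (auto simp: opair_def norm_eq_1 inner_commute)
    have sin: "0 \<le> sin e" "sin e \<le> 1" using E by (auto intro: sin_ge_zero)
    have R2: "(R e)\<^sup>2 = sin e" and S2: "(sqrt (1 - sin e))\<^sup>2 = 1 - sin e" using sin by (simp_all add: R_def)
    have PQR: "(P e)\<^sup>2 + (Q e)\<^sup>2 + (R e)\<^sup>2 = 1"
    proof -
      have "(P e)\<^sup>2 + (Q e)\<^sup>2 = (1 - sin e) * ((cos e)\<^sup>2 + (sin e)\<^sup>2)"
        by (simp only: P_def Q_def power_mult_distrib S2 distrib_left)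
      then show ?thesis by (simp add: R2)
    qed
    have QR: "Q e = g e * R e" using R2 by (simp add: Q_def g_def R_def)
    \<comment> \<open>In the span of the frame, \<nu> is a unit vector orthogonal to both
      \<open>x\<close> and \<open>p\<close>; orthogonality to \<open>p\<close> is the identity
      \<open>Q e = g e * R e\<close>.\<close>
    define p \<nu> where "p = P e *\<^sub>R x + Q e *\<^sub>R y + R e *\<^sub>R w" and "\<nu> = (1 / S e) *\<^sub>R y - (g e / S e) *\<^sub>R w"
    have p: "chain_point x y w e = p"
      by (simp add: p_def chain_point_def circ_def P_def Q_def R_def algebra_simps)
    have "(1 / S e)\<^sup>2 + (g e / S e)\<^sup>2 = (1 + (g e)\<^sup>2) / (S e)\<^sup>2" by (simp add: power_divide add_divide_distrib)
    also have "\<dots> = 1" using S[of e] by (metis divide_self power_not_zero)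
    finally have x\<nu>: "(x, \<nu>) \<in> opair \<zeta>"
      using o(1) by (simp add: opair_def norm_eq_1 \<nu>_def inner_diff_left inner_diff_right frame power2_eq_square)
    have p\<nu>: "(p, \<nu>) \<in> opair \<zeta>"
      using x\<nu> PQR by (simp add: opair_def norm_eq_1 \<nu>_def p_def inner_add_left inner_add_right
          inner_diff_right frame power2_eq_square QR)
    have P: "P e = x \<bullet> p" by (simp add: p_def inner_add_right frame)
    have "0 < 1 + P e" using E by linarith
    from linked_if_close[OF k0 x\<nu> p\<nu> P this, of "\<delta> / 2"] have "linked \<zeta> \<alpha> (\<delta> / 2) x p \<nu>"
      using E unfolding f0_def f1_def c_def k_def by blast
    then obtain y1 y2 where y12: "(x, y1) \<in> opair \<zeta>" "(p, y2) \<in> opair \<zeta>" "circ (x, y1) \<alpha> = circ (p, y2) \<alpha>"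
      "norm (y1 - \<nu>) < \<delta> / 2" "norm (y2 - \<nu>) < \<delta> / 2" by (auto simp: linked_def)
    have "\<nu> - y = (1 / S e - 1) *\<^sub>R y + (- (g e / S e)) *\<^sub>R w" by (simp add: \<nu>_def algebra_simps)
    then have "norm (\<nu> - y) \<le> f2 e"
      unfolding f2_def by (metis abs_minus_cancel frame(14,15) mult.right_neutral norm_scaleR norm_triangle_ineq)
    then have "norm (\<nu> - y) < \<delta> / 2" using E by linarith
    then have "norm (y1 - y) < \<delta>" "norm (y2 - y) < \<delta>"
      using norm_triangle_ineq[of "y1 - \<nu>" "\<nu> - y"] norm_triangle_ineq[of "y2 - \<nu>" "\<nu> - y"] y12(4,5) by simp_all
    moreover have "norm (p - x) \<le> f3 e"
    proof -
      have "p - x = (P e - 1) *\<^sub>R x + Q e *\<^sub>R y + R e *\<^sub>R w" by (simp add: p_def algebra_simps)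
      also have "norm \<dots> \<le> f3 e" unfolding f3_def
        by (rule norm_triangle_le, rule add_mono, rule norm_triangle_le) (simp_all add: frame)
      finally show ?thesis .
    qed
    ultimately show "linked \<zeta> \<alpha> \<delta> x (chain_point x y w e) y \<and> norm (chain_point x y w e - x) < \<delta>"
      unfolding p linked_def using y12(1-3) E by (meson le_less_trans)
  qed
qed

text \<open>One link leads from \<open>circ q s\<close> up to a chain point above the angle
  \<open>s + \<epsilon>\<close>, and the mirror image of that link leads down to
  \<open>circ q (s + 2 * \<epsilon>)\<close>. So membership in \<open>Z\<close> is preserved by
  every sufficiently small step, not only by \<alpha>, and every angle can be reached
  exactly.\<close>

lemma invariant_set_contains_circle:
  fixes \<zeta> :: "'a::euclidean_space"
  assumes dim: "4 \<le> DIM('a)" and q: "q \<in> opair \<zeta>" and \<alpha>: "sin \<alpha> \<noteq> 0" and \<delta>: "0 < \<delta>"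
    and inv: "\<And>p s. p \<in> opair \<zeta> \<Longrightarrow> dist p q < \<delta> \<Longrightarrow> circ p s \<in> Z \<longleftrightarrow> circ p (s + \<alpha>) \<in> Z"
    and Z: "circ q s\<^sub>0 \<in> Z"
  shows "circ q s \<in> Z"
proof -
  have inv': "circ p s \<in> Z \<longleftrightarrow> circ p (s + \<alpha>) \<in> Z" if "p \<in> opair \<zeta>" "dist p (rot q a) < \<delta>" for p s a
  proof -
    have "dist (rot p (- a)) q < \<delta>" using dist_rot[of p "- a" "rot q a"] that(2) by simp
    then show ?thesis using inv[of "rot p (- a)" "s + a"] that(1) by (simp add: algebra_simps)
  qed
  have near: "dist (u, v) (u', v') < \<delta>" if "norm (u - u') < \<delta> / 2" "norm (v - v') < \<delta> / 2" for u v u' v' :: 'a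
  proof -
    have "dist (u, v) (u', v') \<le> norm (u - u') + norm (v - v')"
      using norm_Pair_le[of "u - u'" "v - v'"] by (simp add: dist_norm)
    with that show ?thesis by simp
  qed
  obtain \<epsilon>\<^sub>0 where \<epsilon>\<^sub>0: "0 < \<epsilon>\<^sub>0"
    "\<And>\<epsilon> x y w. \<lbrakk>0 < \<epsilon>; \<epsilon> < \<epsilon>\<^sub>0; (x, y) \<in> opair \<zeta>; (x, w) \<in> opair \<zeta>; (y, w) \<in> opair \<zeta>\<rbrakk> \<Longrightarrow>
       linked \<zeta> \<alpha> (\<delta> / 2) x (chain_point x y w \<epsilon>) y \<and> norm (chain_point x y w \<epsilon> - x) < \<delta> / 2"
    using half_chain[OF \<alpha>, of "\<delta> / 2" \<zeta>] \<delta> by (metis half_gt_zero)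
  have step: "circ q s \<in> Z \<longleftrightarrow> circ q (s + 2 * \<epsilon>) \<in> Z" if \<epsilon>: "0 < \<epsilon>" "\<epsilon> < \<epsilon>\<^sub>0" for s \<epsilon>
  proof -
    \<comment> \<open>\<open>y'\<close> points backwards along the circle, so that the chain point
      built from \<open>x'\<close> coincides with the one built from \<open>x\<close>. The reversed
      orientation is the reason for the angle \<open>- \<alpha>\<close> on the second pair of
      circles.\<close>
    define x y x' y' where "x = circ q s" and "y = circ q (s + pi / 2)"
      and "x' = circ q (s + 2 * \<epsilon>)" and "y' = - circ q (s + 2 * \<epsilon> + pi / 2)"
    have r1: "(x, y) = rot q s" and r2: "(x', - y') = rot q (s + 2 * \<epsilon>)"
      by (simp_all add: x_def y_def x'_def y'_def rot_def)
    have xy: "(x, y) \<in> opair \<zeta>" using r1 q by simp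
    have "(x', - y') \<in> opair \<zeta>" using r2 q by simp
    from uminus_in_opair[OF this] have xy': "(x', y') \<in> opair \<zeta>" by simp
    obtain w where w: "(x, w) \<in> opair \<zeta>" "(y, w) \<in> opair \<zeta>" using opair_frame[OF dim xy] .
    have wc: "(circ q u, w) \<in> opair \<zeta>" for u
    proof -
      have "circ q u = circ (x, y) (u - s)" unfolding r1 by simp
      moreover have "circ (x, y) (u - s) \<bullet> w = 0" using w by (simp add: circ_def inner_add_left opair_def)
      ultimately have "circ q u \<bullet> w = 0" by simp
      then show ?thesis using w norm_circ[OF q] inner_circ[OF q] by (simp add: opair_def)
    qed
    have w': "(x', w) \<in> opair \<zeta>" "(y', w) \<in> opair \<zeta>"
      using wc[of "s + 2 * \<epsilon>"] wc[of "s + 2 * \<epsilon> + pi / 2"] by (simp_all add: x'_def y'_def opair_def)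
    define p1 where "p1 = chain_point x y w \<epsilon>"
    have "circ (x', y') \<epsilon> = circ (x', - y') (- \<epsilon>)" by (simp add: circ_minus)
    also have "\<dots> = circ (x, y) \<epsilon>" unfolding r1 r2 by (simp add: algebra_simps)
    finally have p1': "p1 = chain_point x' y' w \<epsilon>"
      by (simp add: p1_def chain_point_def)
    obtain y1 y2 where y12: "(x, y1) \<in> opair \<zeta>" "(p1, y2) \<in> opair \<zeta>" "circ (x, y1) \<alpha> = circ (p1, y2) \<alpha>"
      "norm (y1 - y) < \<delta> / 2" "norm (y2 - y) < \<delta> / 2" "norm (p1 - x) < \<delta> / 2"
      using \<epsilon>\<^sub>0(2)[OF \<epsilon> xy w] unfolding p1_def[symmetric] linked_def by blast
    obtain z1 z2 where z12: "(x', z1) \<in> opair \<zeta>" "(p1, z2) \<in> opair \<zeta>" "circ (x', z1) \<alpha> = circ (p1, z2) \<alpha>"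
      "norm (z1 - y') < \<delta> / 2" "norm (z2 - y') < \<delta> / 2" "norm (p1 - x') < \<delta> / 2"
      using \<epsilon>\<^sub>0(2)[OF \<epsilon> xy' w'] unfolding p1'[symmetric] linked_def by blast
    have d: "dist (x, y1) (rot q s) < \<delta>" "dist (p1, y2) (rot q s) < \<delta>"
      unfolding r1[symmetric] using y12 \<delta> by (auto intro!: near)
    have neg: "norm (- z - - y') = norm (z - y')" for z by (metis norm_minus_commute minus_diff_minus norm_minus_cancel)
    have d': "dist (x', - z1) (rot q (s + 2 * \<epsilon>)) < \<delta>" "dist (p1, - z2) (rot q (s + 2 * \<epsilon>)) < \<delta>"
      unfolding r2[symmetric] using z12 \<delta> by (auto intro!: near simp only: neg norm_zero diff_self half_gt_zero)
    have "x \<in> Z \<longleftrightarrow> circ (x, y1) \<alpha> \<in> Z" using inv'[OF y12(1) d(1), of 0] by simp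
    also have "\<dots> \<longleftrightarrow> p1 \<in> Z" unfolding y12(3) using inv'[OF y12(2) d(2), of 0] by simp
    also have "\<dots> \<longleftrightarrow> circ (p1, z2) \<alpha> \<in> Z"
      using inv'[OF uminus_in_opair[OF z12(2)] d'(2), of "- \<alpha>"] by (simp add: circ_minus)
    also have "\<dots> \<longleftrightarrow> x' \<in> Z" unfolding z12(3)[symmetric]
      using inv'[OF uminus_in_opair[OF z12(1)] d'(1), of "- \<alpha>"] by (simp add: circ_minus)
    finally show ?thesis by (simp add: x_def x'_def)
  qed
  \<comment> \<open>Enough full turns to make the way \<open>T\<close> from the starting angle to
    \<open>s\<close> positive; it is then divided into \<open>n\<close> steps of equal length
    \<open>2 * \<epsilon>\<close>.\<close>
  define j where "j = \<lceil>\<bar>s - s\<^sub>0\<bar> / (2 * pi)\<rceil> + 1"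
  define T where "T = s - s\<^sub>0 + 2 * pi * of_int j"
  have "\<bar>s - s\<^sub>0\<bar> / (2 * pi) < of_int j" unfolding j_def by linarith
  then have "\<bar>s - s\<^sub>0\<bar> < 2 * pi * of_int j" by (simp add: field_simps)
  then have T: "0 < T" by (simp add: T_def)
  obtain n :: nat where n: "T / (2 * \<epsilon>\<^sub>0) < real n" using reals_Archimedean2 by blast
  have "0 < T / (2 * \<epsilon>\<^sub>0)" using T \<epsilon>\<^sub>0(1) by simp
  with n have n0: "0 < real n" by linarith
  define \<epsilon> where "\<epsilon> = T / (2 * real n)"
  have \<epsilon>: "0 < \<epsilon>" "\<epsilon> < \<epsilon>\<^sub>0" using T n n0 \<epsilon>\<^sub>0(1) by (simp_all add: \<epsilon>_def field_simps)
  have "circ q (s\<^sub>0 + real m * (2 * \<epsilon>)) \<in> Z" for m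
  proof (induction m)
    case (Suc m)
    then show ?case using step[OF \<epsilon>, of "s\<^sub>0 + real m * (2 * \<epsilon>)"] by (simp add: algebra_simps)
  qed (simp add: Z)
  then have "circ q (s\<^sub>0 + real n * (2 * \<epsilon>)) \<in> Z" .
  moreover have "s\<^sub>0 + real n * (2 * \<epsilon>) = s + 2 * pi * of_int j"
    using n0 by (simp add: \<epsilon>_def T_def field_simps)
  ultimately have "circ q (s + 2 * pi * of_int j) \<in> Z" by simp
  then show ?thesis by (simp only: circ_add_2pi)
qed

text \<open>A rotation does not change integrals over the circle, so the Funk transform equates the
  even parts of \<open>F t\<close> and \<open>G t\<close>, and also of \<open>F t * F u\<close> and
  \<open>G t * G u\<close>. For the odd parts this leaves \<open>f t * f u = g t * g u\<close>;
  taking two different indices makes the sign in \<open>f = g\<close> or \<open>f = - g\<close> the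
  same for all \<open>t\<close>.\<close>

lemma rotations_pointwise:
  fixes F G :: "real \<Rightarrow> 'a::euclidean_space \<Rightarrow> real"
  assumes dim: "4 \<le> DIM('a)"
    and cF: "\<And>t. continuous_on UNIV (F t)" and cG: "\<And>t. continuous_on UNIV (G t)"
    and rots: "\<And>p. p \<in> opair \<zeta> \<Longrightarrow> \<exists>a. \<forall>s t. F t (circ p s) = G t (circ p (s + a))"
    and v: "norm v = 1" "\<zeta> \<bullet> v = 0"
  shows "(\<forall>t. F t v = G t v \<and> F t (- v) = G t (- v)) \<or> (\<forall>t. F t v = G t (- v) \<and> F t (- v) = G t v)"
proof -
  have sum_eq: "D v + D (- v) = E v + E (- v)"
    if cD: "continuous_on UNIV D" and cE: "continuous_on UNIV E"
      and DE: "\<And>p a. p \<in> opair \<zeta> \<Longrightarrow> (\<forall>s t. F t (circ p s) = G t (circ p (s + a))) \<Longrightarrow> \<forall>s. D (circ p s) = E (circ p (s + a))"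
    for D E :: "'a \<Rightarrow> real"
  proof -
    have "(D v - E v) + (D (- v) - E (- v)) = 0"
    proof (rule funk_transform_injective[OF dim _ _ v])
      show "continuous_on UNIV (\<lambda>v. D v - E v)" by (intro continuous_intros cD cE)
      fix p assume p: "p \<in> opair \<zeta>"
      obtain a where a: "\<forall>s t. F t (circ p s) = G t (circ p (s + a))" using rots[OF p] by blast
      have c: "continuous_on UNIV (\<lambda>s. D (circ p s))" "continuous_on UNIV (\<lambda>s. E (circ p s))"
        by (intro continuous_on_compose2[OF cD] continuous_on_compose2[OF cE] continuous_intros; simp)+
      have "integral {0..2*pi} (\<lambda>s. D (circ p s)) = integral {0..2*pi} (\<lambda>s. E (circ p (s + a)))"
        using DE[OF p a] by simp
      also have "\<dots> = integral {0..2*pi} (\<lambda>s. E (circ p s))"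
        by (rule integral_periodic_shift[OF c(2)]) (use circ_add_2pi[of p _ 1] in simp)
      finally show "integral {0..2*pi} (\<lambda>s. D (circ p s) - E (circ p s)) = 0"
        by (subst Henstock_Kurzweil_Integration.integral_diff)
           (auto intro!: integrable_continuous_interval continuous_on_subset[OF c(1)] continuous_on_subset[OF c(2)])
    qed
    then show ?thesis by simp
  qed
  have e: "F t v + F t (- v) = G t v + G t (- v)" for t
    by (rule sum_eq[OF cF cG]) simp
  have ee: "F t v * F u v + F t (- v) * F u (- v) = G t v * G u v + G t (- v) * G u (- v)" for t u
    by (rule sum_eq) (auto intro!: continuous_intros cF cG)
  define f g where "f t = F t v - F t (- v)" and "g t = G t v - G t (- v)" for t
  have fg: "f t * f u = g t * g u" for t u
    using ee[of t u] e[of t] e[of u] unfolding f_def g_def by algebra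
  consider "\<forall>t. f t = g t" | "\<forall>t. f t = - g t"
  proof (cases "\<exists>u. f u \<noteq> 0")
    case True
    then obtain u where u: "f u \<noteq> 0" by blast
    have "g u = f u \<or> g u = - f u" using fg[of u u] square_eq_iff by metis
    then show thesis
    proof
      assume "g u = f u"
      then have "f t = g t" for t using fg[of t u] u by simp
      then show thesis using that by blast
    next
      assume "g u = - f u"
      then have "f t = - g t" for t using fg[of t u] u
        by (metis mult_cancel_right mult_minus_left mult_minus_right)
      then show thesis using that by blast
    qed
  next
    case False
    then have "g t = 0" for t using fg[of t t] by simp
    then show thesis using False that by simp
  qed
  then show ?thesis
  proof cases
    case 1
    have "F t v = G t v" "F t (- v) = G t (- v)" for t using e[of t] spec[OF 1, of t] unfolding f_def g_def by linarith+
    then show ?thesis by simp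
  next
    case 2
    have "F t v = G t (- v)" "F t (- v) = G t v" for t using e[of t] spec[OF 2, of t] unfolding f_def g_def by linarith+
    then show ?thesis by simp
  qed
qed


text \<open>The claim concerns one circle, but the contradiction is reached on a neighbouring one,
  where a single angle is valid on a whole neighbourhood.\<close>

lemma rotations_same_on_each_circle:
  fixes F G :: "real \<Rightarrow> 'a::euclidean_space \<Rightarrow> real"
  assumes dim: "4 \<le> DIM('a)"
    and cF: "\<And>t. continuous_on UNIV (F t)" and cG: "\<And>t. continuous_on UNIV (G t)"
    and nopi: "\<And>p. p \<in> opair \<zeta> \<Longrightarrow> \<not> (\<forall>s t. F t (circ p (s + pi)) = F t (circ p s))"
    and rots: "\<And>p. p \<in> opair \<zeta> \<Longrightarrow> \<exists>a. \<forall>s t. F t (circ p s) = G t (circ p (s + a))"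
    and p0: "p\<^sub>0 \<in> opair \<zeta>"
  shows "(\<forall>s t. F t (circ p\<^sub>0 s) = G t (circ p\<^sub>0 s)) \<or> (\<forall>s t. F t (circ p\<^sub>0 s) = G t (- circ p\<^sub>0 s))"
proof (rule ccontr)
  assume "\<not> ?thesis"
  then obtain s1 t1 s2 t2 where w1: "F t1 (circ p\<^sub>0 s1) \<noteq> G t1 (circ p\<^sub>0 s1)"
    and w2: "F t2 (circ p\<^sub>0 s2) \<noteq> G t2 (- circ p\<^sub>0 s2)" by blast
  \<comment> \<open>The two failures are recorded at the fixed parameters found on the original
    circle, which makes the condition open.\<close>
  define U where "U = {p. F t1 (circ p s1) \<noteq> G t1 (circ p s1) \<and> F t2 (circ p s2) \<noteq> G t2 (- circ p s2)}"
  define Z where "Z = {v. \<forall>t. F t v = F t (- v)}"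
  define N where "N a = {p \<in> opair \<zeta>. \<forall>s t. F t (circ p s) = G t (circ p (s + a))}" for a
  have cont: "continuous_on UNIV (\<lambda>x. F t (h x))" "continuous_on UNIV (\<lambda>x. G t (h x))"
    if "continuous_on UNIV h" for h :: "'b::t2_space \<Rightarrow> 'a" and t
    by (intro continuous_on_compose2[OF cF that] continuous_on_compose2[OF cG that]; simp)+
  have pw: "(\<forall>t. F t (circ p s) = G t (circ p s) \<and> F t (- circ p s) = G t (- circ p s)) \<or>
      (\<forall>t. F t (circ p s) = G t (- circ p s) \<and> F t (- circ p s) = G t (circ p s))" if "p \<in> opair \<zeta>" for p s
    using that by (intro rotations_pointwise[OF dim cF cG rots]) auto
  \<comment> \<open>The rotation carries antipodal symmetry of \<open>F\<close> at \<open>s\<close>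
    to that of \<open>G\<close> at \<open>s + a\<close>. By the pointwise alternative,
    \<open>F\<close> and \<open>G\<close> have the same points of antipodal symmetry.\<close>
  have Zinv: "circ p s \<in> Z \<longleftrightarrow> circ p (s + a) \<in> Z" if "p \<in> N a" for p s a
  proof -
    have p: "p \<in> opair \<zeta>" and eq: "F t (circ p s) = G t (circ p (s + a))" for s t using that by (auto simp: N_def)
    have "- circ p s = circ p (s + pi)" by simp
    moreover have "circ p (s + pi + a) = - circ p (s + a)"
      using circ_add_pi[of p "s + a"] by (simp only: add.assoc add.commute[of pi a])
    ultimately have "F t (- circ p s) = G t (- circ p (s + a))" for t by (metis eq)
    then have "circ p s \<in> Z \<longleftrightarrow> (\<forall>t. G t (circ p (s + a)) = G t (- circ p (s + a)))"
      using eq by (simp add: Z_def)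
    also have "\<dots> \<longleftrightarrow> circ p (s + a) \<in> Z" using pw[OF p, of "s + a"] unfolding Z_def mem_Collect_eq by metis
    finally show ?thesis .
  qed
  have Z_all: False if p: "p \<in> opair \<zeta>" and "\<forall>s. circ p s \<in> Z" for p
    using nopi[OF p] that(2) by (simp add: Z_def)
  \<comment> \<open>The two closed sets of parameters cover the line and are both nonempty on a
    circle in \<open>U\<close>, so they meet. Where both alternatives hold, \<open>F\<close> takes
    equal values at antipodal points.\<close>
  have Z_meets: "\<exists>s. circ p s \<in> Z" if p: "p \<in> opair \<zeta>" and pU: "p \<in> U" for p
  proof -
    define A B where "A = {s. \<forall>t. F t (circ p s) = G t (circ p s)}" and "B = {s. \<forall>t. F t (circ p s) = G t (- circ p s)}"
    have "closed A" "closed B" unfolding A_def B_def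
      by (intro closed_Collect_all closed_Collect_eq cont continuous_intros)+
    moreover have "UNIV \<subseteq> A \<union> B" using pw[OF p] by (auto simp: A_def B_def)
    moreover have "s1 \<in> B" "s2 \<in> A" using pU pw[OF p, of s1] pw[OF p, of s2] by (auto simp: A_def B_def U_def)
    ultimately have "A \<inter> B \<noteq> {}"
      using connected_closedD[OF connected_UNIV, of A B] by auto
    then obtain s where "s \<in> A" "s \<in> B" by blast
    then have "circ p s \<in> Z" using pw[OF p, of s] by (auto simp: A_def B_def Z_def)
    then show ?thesis by blast
  qed
  have closed_Z: "closed {s. circ p s \<in> Z}" for p
    unfolding Z_def mem_Collect_eq by (intro closed_Collect_all closed_Collect_eq cont continuous_intros)
  have rat: "a / (2 * pi) \<in> \<rat>" if pU: "p \<in> U" and pN: "p \<in> N a" for p a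
  proof (rule ccontr)
    assume irr: "a / (2 * pi) \<notin> \<rat>"
    have p: "p \<in> opair \<zeta>" using pN by (simp add: N_def)
    obtain s0 where s0: "circ p s0 \<in> Z" using Z_meets[OF p pU] by blast
    have orbit: "circ p (s0 + real k * a) \<in> Z" for k
    proof (induction k)
      case (Suc k)
      then show ?case using Zinv[OF pN, of "s0 + real k * a"] by (simp add: algebra_simps)
    qed (simp add: s0)
    have "circ p s \<in> Z" for s
    proof -
      have "s \<in> closure {s. circ p s \<in> Z}"
        unfolding closure_approachable
      proof (intro allI impI)
        fix e :: real assume e: "0 < e"
        have "0 < e / (2 * pi)" using e by simp
        \<comment> \<open>Multiples of an irrational part of a turn approach any angle modulo full
          turns, and this with \<open>k > 0\<close>, so the forward orbit suffices.\<close>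
        then obtain h k :: int where k: "0 < k" "\<bar>of_int k * (a / (2 * pi)) - of_int h - (s - s0) / (2 * pi)\<bar> < e / (2 * pi)"
          by (rule sequence_of_fractional_parts_is_dense[OF irr, where \<alpha> = "(s - s0) / (2 * pi)"])
        define u where "u = s0 + real (nat k) * a + 2 * pi * of_int (- h)"
        have "circ p u \<in> Z" using orbit[of "nat k"] unfolding u_def circ_add_2pi .
        moreover have "dist u s < e"
        proof -
          have "u - s = 2 * pi * (of_int k * (a / (2 * pi)) - of_int h - (s - s0) / (2 * pi))"
          proof -
            have "2 * pi * (of_int k * (a / (2 * pi))) = real (nat k) * a" "2 * pi * ((s - s0) / (2 * pi)) = s - s0"
              using k(1) by (simp_all add: of_nat_nat)
            then show ?thesis unfolding u_def right_diff_distrib by linarith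
          qed
          then have "\<bar>u - s\<bar> = 2 * pi * \<bar>of_int k * (a / (2 * pi)) - of_int h - (s - s0) / (2 * pi)\<bar>"
            by (simp only: abs_mult) simp
          also have "\<dots> < 2 * pi * (e / (2 * pi))" using k(2) by (intro mult_strict_left_mono) auto
          finally show ?thesis by (simp add: dist_real_def)
        qed
        ultimately show "\<exists>y\<in>{s. circ p s \<in> Z}. dist y s < e" by blast
      qed
      then show ?thesis using closed_Z[of p] by simp
    qed
    with Z_all[OF p] show False by blast
  qed
  \<comment> \<open>An angle that is a multiple of pi would realise one of the two global
    alternatives on the circle, which \<open>U\<close> excludes. Linking of circles needs this
    nonvanishing.\<close>
  have sin: "sin a \<noteq> 0" if pU: "p \<in> U" and pN: "p \<in> N a" for p a
  proof
    assume "sin a = 0"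
    then obtain i :: int where i: "a = of_int i * pi" by (auto simp: sin_zero_iff_int2)
    have eq: "F t (circ p s) = G t (circ p (s + a))" for s t using pN by (simp add: N_def)
    show False
    proof (cases "even i")
      case True
      then obtain j where "i = 2 * j" by (elim evenE)
      then have "circ p (s + a) = circ p s" for s using circ_add_2pi[of p s j] i by (simp add: algebra_simps)
      then show False using eq pU by (simp add: U_def)
    next
      case False
      then obtain j where "i = 2 * j + 1" by (elim oddE)
      then have "s + a = (s + pi) + 2 * pi * of_int j" for s using i by (simp add: algebra_simps)
      then have "circ p (s + a) = - circ p s" for s by (simp only: circ_add_2pi circ_add_pi)
      then show False using eq pU by (simp add: U_def)
    qed
  qed
  have "open U" unfolding U_def
    by (intro open_Collect_conj open_Collect_neq cont continuous_intros)
  moreover have "p\<^sub>0 \<in> U" using w1 w2 by (simp add: U_def)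
  ultimately obtain r where r: "0 < r" "cball p\<^sub>0 r \<subseteq> U" using open_contains_cball by blast
  have closed_N: "closed (N a)" for a
  proof -
    have "N a = opair \<zeta> \<inter> {p. \<forall>s t. F t (circ p s) = G t (circ p (s + a))}" by (auto simp: N_def)
    then show ?thesis
      by (simp add: closed_Int closed_opair closed_Collect_all closed_Collect_eq cont continuous_intros)
  qed
  define A where "A = {a. a / (2 * pi) \<in> \<rat> \<and> sin a \<noteq> 0}"
  have "A \<subseteq> (\<lambda>x. x * (2 * pi)) ` \<rat>"
  proof
    fix a assume "a \<in> A"
    moreover have "a = a / (2 * pi) * (2 * pi)" by simp
    ultimately show "a \<in> (\<lambda>x. x * (2 * pi)) ` \<rat>" unfolding A_def by blast
  qed
  then have cA: "countable A" using countable_rat by (metis countable_image countable_subset)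
  have cover: "\<exists>a \<in> A. p \<in> N a" if "p \<in> opair \<zeta>" "p \<in> U" for p
    using rots[OF that(1)] rat[OF that(2)] sin[OF that(2)] that(1) by (auto simp: A_def N_def)
  \<comment> \<open>Baire: some angle works for all circles in an open set\<close>
  define W where "W a = opair \<zeta> - (N a \<inter> cball p\<^sub>0 r)" for a
  have "\<exists>a\<in>A. \<not> opair \<zeta> \<subseteq> closure (W a)"
  proof (rule ccontr)
    assume "\<not> ?thesis"
    then have dense: "opair \<zeta> \<subseteq> closure (W a)" if "a \<in> A" for a using that by blast
    have "opair \<zeta> \<subseteq> closure (\<Inter> (W ` A))"
    proof (rule Baire[OF closed_opair])
      show "countable (W ` A)" using cA by simp
      fix T assume "T \<in> W ` A"
      then obtain a where a: "a \<in> A" "T = W a" by blast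
      have "openin (top_of_set (opair \<zeta>)) (opair \<zeta> - N a \<inter> cball p\<^sub>0 r)"
        using closed_N[of a] by (simp add: openin_diff closedin_closed_Int closed_Int Diff_Int_distrib
            closed_subset N_def closedin_closed_subset subset_iff)
      then show "openin (top_of_set (opair \<zeta>)) T \<and> opair \<zeta> \<subseteq> closure T"
        using dense[OF a(1)] a(2) by (simp add: W_def)
    qed
    then obtain p where p: "p \<in> \<Inter> (W ` A)" "dist p p\<^sub>0 < r"
      using p0 r(1) by (meson closure_approachable subsetD)
    have pW: "p \<in> W a" if "a \<in> A" for a using p(1) that by blast
    obtain b where "b \<in> A" using cover[OF p0 \<open>p\<^sub>0 \<in> U\<close>] by blast
    from pW[OF this] have "p \<in> opair \<zeta>" by (simp add: W_def)
    moreover have "p \<in> cball p\<^sub>0 r" using p(2) by (simp add: dist_commute)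
    moreover have "p \<in> U" using calculation(2) r(2) by blast
    ultimately show False using cover[of p] pW by (auto simp: W_def)
  qed
  \<comment> \<open>If \<open>W a\<close> is not dense, some \<open>q\<close> has all its neighbours
    in \<open>opair \<zeta>\<close> inside \<open>N a\<close> and inside the ball: the one angle
    \<open>a\<close> is valid on a neighbourhood of \<open>q\<close>.\<close>
  then obtain a q where a: "a \<in> A" and q: "q \<in> opair \<zeta>" "q \<notin> closure (W a)" by blast
  then obtain \<delta> where \<delta>: "0 < \<delta>" "\<And>p. p \<in> W a \<Longrightarrow> \<not> dist p q < \<delta>"
    by (auto simp: closure_approachable)
  have nbhd: "p \<in> N a \<and> p \<in> U" if "p \<in> opair \<zeta>" "dist p q < \<delta>" for p
  proof -
    have "p \<in> N a \<inter> cball p\<^sub>0 r" using \<delta>(2)[of p] that by (auto simp: W_def)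
    then show ?thesis using r(2) by blast
  qed
  have "q \<in> U" using nbhd[of q] q(1) \<delta>(1) by simp
  then obtain s0 where s0: "circ q s0 \<in> Z" using Z_meets q(1) by blast
  have "sin a \<noteq> 0" using a by (simp add: A_def)
  have "circ q s \<in> Z" for s
    by (rule invariant_set_contains_circle[OF dim q(1) \<open>sin a \<noteq> 0\<close> \<delta>(1) _ s0]) (use Zinv nbhd in blast)
  with Z_all[OF q(1)] show False by blast
qed

text \<open>Both alternatives are closed conditions on the circle, and together they would give
  \<open>F\<close> the period pi there; hence the choice is the same on all circles.\<close>

lemma rotations_on_all_circles:
  fixes F G :: "real \<Rightarrow> 'a::euclidean_space \<Rightarrow> real"
  assumes dim: "4 \<le> DIM('a)"
    and cF: "\<And>t. continuous_on UNIV (F t)" and cG: "\<And>t. continuous_on UNIV (G t)"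
    and nopi: "\<And>p. p \<in> opair \<zeta> \<Longrightarrow> \<not> (\<forall>s t. F t (circ p (s + pi)) = F t (circ p s))"
    and rots: "\<And>p. p \<in> opair \<zeta> \<Longrightarrow> \<exists>a. \<forall>s t. F t (circ p s) = G t (circ p (s + a))"
  shows "(\<forall>v t. norm v = 1 \<longrightarrow> \<zeta> \<bullet> v = 0 \<longrightarrow> F t v = G t v) \<or>
    (\<forall>v t. norm v = 1 \<longrightarrow> \<zeta> \<bullet> v = 0 \<longrightarrow> F t v = G t (- v))"
proof -
  have cont: "continuous_on UNIV (\<lambda>x. F t (h x))" "continuous_on UNIV (\<lambda>x. G t (h x))"
    if "continuous_on UNIV h" for h :: "'b::t2_space \<Rightarrow> 'a" and t
    by (intro continuous_on_compose2[OF cF that] continuous_on_compose2[OF cG that]; simp)+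
  have swap: "circ (y, x) s = circ (x, y) (pi / 2 - s)" for x y :: 'a and s
    by (simp add: circ_def cos_diff sin_diff)
  have "(\<forall>p\<in>opair \<zeta>. \<forall>s t. F t (circ p s) = G t (circ p s)) \<or>
      (\<forall>p\<in>opair \<zeta>. \<forall>s t. F t (circ p s) = G t (- circ p s))"
  proof (rule opair_connected[OF dim])
    show "closed {p \<in> opair \<zeta>. \<forall>s t. F t (circ p s) = G t (circ p s)}"
      unfolding Collect_conj_eq Collect_mem_eq
      by (intro closed_Int closed_opair closed_Collect_all closed_Collect_eq cont continuous_intros)
    show "closed {p \<in> opair \<zeta>. \<forall>s t. F t (circ p s) = G t (- circ p s)}"
      unfolding Collect_conj_eq Collect_mem_eq
      by (intro closed_Int closed_opair closed_Collect_all closed_Collect_eq cont continuous_intros)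
    show "(\<forall>s t. F t (circ p s) = G t (circ p s)) \<or> (\<forall>s t. F t (circ p s) = G t (- circ p s))"
      if "p \<in> opair \<zeta>" for p
      by (rule rotations_same_on_each_circle[OF dim cF cG nopi rots that])
    show "\<not> ((\<forall>s t. F t (circ p s) = G t (circ p s)) \<and> (\<forall>s t. F t (circ p s) = G t (- circ p s)))"
      if "p \<in> opair \<zeta>" for p
    proof
      assume *: "(\<forall>s t. F t (circ p s) = G t (circ p s)) \<and> (\<forall>s t. F t (circ p s) = G t (- circ p s))"
      have "F t (circ p (s + pi)) = F t (circ p s)" for s t
        using conjunct1[OF *, rule_format, of t "s + pi"] conjunct2[OF *, rule_format, of t s] by simp
      with nopi[OF that] show False by blast
    qed
    show "\<forall>s t. F t (circ (y, x) s) = G t (circ (y, x) s)" if "\<forall>s t. F t (circ (x, y) s) = G t (circ (x, y) s)" for x y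
      using that by (simp only: swap[of y x] simp_thms)
  qed
  moreover have ex: "\<exists>p \<in> opair \<zeta>. circ p 0 = v" if v: "norm v = 1" "\<zeta> \<bullet> v = 0" for v
  proof -
    obtain a where "(v, a) \<in> opair \<zeta>" by (rule opair_nonempty[OF dim v])
    then show ?thesis by force
  qed
  ultimately show ?thesis
  proof (elim disjE)
    assume *: "\<forall>p\<in>opair \<zeta>. \<forall>s t. F t (circ p s) = G t (circ p s)"
    have "F t v = G t v" if v: "norm v = 1" "\<zeta> \<bullet> v = 0" for v t
      using ex[OF v] * by blast
    then show ?thesis by blast
  next
    assume *: "\<forall>p\<in>opair \<zeta>. \<forall>s t. F t (circ p s) = G t (- circ p s)"
    have "F t v = G t (- v)" if v: "norm v = 1" "\<zeta> \<bullet> v = 0" for v t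
      using ex[OF v] * by blast
    then show ?thesis by blast
  qed
qed

section \<open>Support functions and projections\<close>

lemma support_fun_upper: "compact K \<Longrightarrow> y \<in> K \<Longrightarrow> x \<bullet> y \<le> support_fun K x"
  for K :: "(real^'n) set"
  unfolding support_fun_def
  by (intro cSUP_upper compact_imp_bounded bounded_imp_bdd_above compact_continuous_image continuous_intros)

lemma support_fun_attained:
  fixes K :: "(real^'n) set"
  assumes "compact K" "K \<noteq> {}"
  obtains y where "y \<in> K" "support_fun K x = x \<bullet> y"
proof -
  have "continuous_on K (\<lambda>y. x \<bullet> y)" by (intro continuous_intros)
  then obtain y where y: "y \<in> K" "\<And>z. z \<in> K \<Longrightarrow> x \<bullet> z \<le> x \<bullet> y"
    using continuous_attains_sup[OF assms] by blast
  then have "support_fun K x = x \<bullet> y"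
    unfolding support_fun_def by (intro cSup_eq_maximum) auto
  with y(1) show thesis by (rule that)
qed

lemma support_fun_cong_inner:
  fixes A B :: "(real^'n) set"
  assumes "\<And>y. y \<in> A \<Longrightarrow> \<exists>z\<in>B. x \<bullet> y = x' \<bullet> z" "\<And>z. z \<in> B \<Longrightarrow> \<exists>y\<in>A. x \<bullet> y = x' \<bullet> z"
  shows "support_fun A x = support_fun B x'"
proof -
  have "(\<lambda>y. x \<bullet> y) ` A = (\<lambda>y. x' \<bullet> y) ` B"
  proof (intro equalityI subsetI)
    fix u assume "u \<in> (\<lambda>y. x \<bullet> y) ` A"
    then obtain y where "y \<in> A" "u = x \<bullet> y" by blast
    then show "u \<in> (\<lambda>y. x' \<bullet> y) ` B" using assms(1)[of y] by auto
  next
    fix u assume "u \<in> (\<lambda>y. x' \<bullet> y) ` B"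
    then obtain z where "z \<in> B" "u = x' \<bullet> z" by blast
    then show "u \<in> (\<lambda>y. x \<bullet> y) ` A" using assms(2)[of z] by (metis imageI)
  qed
  then show ?thesis by (simp add: support_fun_def)
qed

lemma continuous_support_fun:
  fixes K :: "(real^'n) set"
  assumes K: "compact K" "K \<noteq> {}"
  shows "continuous_on UNIV (support_fun K)"
proof -
  obtain B where B: "\<And>y. y \<in> K \<Longrightarrow> norm y \<le> B" using compact_imp_bounded[OF K(1)] by (auto simp: bounded_iff)
  have le: "support_fun K x \<le> support_fun K x' + B * dist x x'" for x x'
  proof -
    obtain y where y: "y \<in> K" "support_fun K x = x \<bullet> y" using support_fun_attained[OF K] .
    have "x \<bullet> y = x' \<bullet> y + (x - x') \<bullet> y" by (simp add: inner_diff_left)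
    also have "\<dots> \<le> support_fun K x' + norm (x - x') * norm y"
      by (intro add_mono support_fun_upper K y norm_cauchy_schwarz)
    also have "norm (x - x') * norm y \<le> norm (x - x') * B" by (intro mult_left_mono B y) simp
    finally show ?thesis by (simp add: y dist_norm mult.commute)
  qed
  obtain y where "y \<in> K" using K(2) by blast
  then have "0 \<le> B" using B norm_ge_zero order_trans by blast
  then have "B-lipschitz_on UNIV (support_fun K)"
  proof (intro lipschitz_onI)
    show "dist (support_fun K x) (support_fun K y) \<le> B * dist x y" for x y
      using le[of x y] le[of y x] by (simp add: dist_real_def abs_le_iff dist_commute[of y x])
  qed
  then show ?thesis by (rule lipschitz_on_continuous_on)
qed

lemma subset_if_support_fun_le:
  fixes K L :: "(real^'n) set"
  assumes K: "compact K" and L: "compact L" "convex L" "L \<noteq> {}"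
    and le: "\<And>x. support_fun K x \<le> support_fun L x"
  shows "K \<subseteq> L"
proof
  fix z assume z: "z \<in> K"
  show "z \<in> L"
  proof (rule ccontr)
    assume "z \<notin> L"
    then obtain a b where ab: "a \<bullet> z < b" "\<forall>x\<in>L. b < a \<bullet> x"
      using separating_hyperplane_closed_point[OF L(2) compact_imp_closed[OF L(1)]] by blast
    obtain y where y: "y \<in> L" "support_fun L (- a) = - a \<bullet> y" using support_fun_attained[OF L(1,3)] .
    have "- a \<bullet> z \<le> support_fun L (- a)" using support_fun_upper[OF K z, of "- a"] le[of "- a"] by linarith
    then show False using y ab by fastforce
  qed
qed

lemma support_fun_eq_imp_eq:
  fixes K L :: "(real^'n) set"
  assumes "compact K" "convex K" "K \<noteq> {}" "compact L" "convex L" "L \<noteq> {}"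
    and "\<And>x. support_fun K x = support_fun L x"
  shows "K = L"
  using subset_if_support_fun_le[of K L] subset_if_support_fun_le[of L K] assms by simp

lemma support_fun_translation:
  fixes K :: "(real^'n) set"
  assumes "compact K" "K \<noteq> {}"
  shows "support_fun ((+) a ` K) x = x \<bullet> a + support_fun K x"
proof -
  obtain y where y: "y \<in> K" "support_fun K x = x \<bullet> y" using support_fun_attained[OF assms] .
  have "support_fun ((+) a ` K) x = x \<bullet> (a + y)"
    unfolding support_fun_def[of "(+) a ` K"]
  proof (rule cSup_eq_maximum)
    show "x \<bullet> (a + y) \<in> (\<bullet>) x ` (+) a ` K" using y(1) by blast
    fix z assume "z \<in> (\<bullet>) x ` (+) a ` K"
    then obtain k where k: "k \<in> K" "z = x \<bullet> (a + k)" by blast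
    then show "z \<le> x \<bullet> (a + y)"
      using support_fun_upper[OF assms(1) k(1), of x] y(2) by (simp add: inner_add_right)
  qed
  then show ?thesis by (simp add: y inner_add_right)
qed

lemma support_fun_orthogonal_image:
  fixes K :: "(real^'n) set" and \<phi> :: "real^'n \<Rightarrow> real^'n"
  assumes "orthogonal_transformation \<phi>"
  shows "support_fun (\<phi> ` K) (\<phi> x) = support_fun K x"
proof -
  have "\<phi> x \<bullet> \<phi> y = x \<bullet> y" for y
    using assms unfolding orthogonal_transformation_def by blast
  then show ?thesis unfolding support_fun_def by (simp add: image_image)
qed

lemma orth_decomposition:
  fixes H :: "(real^'n) set"
  assumes "subspace H"
  obtains p where "p \<in> H" "x - p \<in> H\<^sup>\<bottom>"
proof -
  have "x \<in> H + H\<^sup>\<bottom>" using subspace_sum_orthogonal_comp[OF assms] by simp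
  then obtain p q where "x = p + q" "p \<in> H" "q \<in> H\<^sup>\<bottom>" by (rule set_plus_elim)
  then show thesis by (intro that[of p]) auto
qed

lemma inner_orth_comp: "x \<in> H \<Longrightarrow> y \<in> H\<^sup>\<bottom> \<Longrightarrow> x \<bullet> y = 0"
  by (simp add: orthogonal_comp_def orthogonal_def)

lemma inner_orth_proj: "x \<in> H \<Longrightarrow> y - p \<in> H\<^sup>\<bottom> \<Longrightarrow> x \<bullet> p = x \<bullet> y"
  using inner_orth_comp[of x H "y - p"] by (simp add: inner_diff_right)

lemma orth_proj_subset: "orth_proj K H \<subseteq> H"
  by (auto simp: orth_proj_def)

lemma support_fun_orth_proj:
  fixes H K :: "(real^'n) set"
  assumes H: "subspace H" and x: "x \<in> H"
  shows "support_fun (orth_proj K H) x = support_fun K x"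
proof (rule support_fun_cong_inner)
  fix y assume "y \<in> orth_proj K H"
  then obtain z where "z \<in> K" "z - y \<in> H\<^sup>\<bottom>" by (auto simp: orth_proj_def)
  then show "\<exists>z\<in>K. x \<bullet> y = x \<bullet> z" using inner_orth_proj[OF x] by blast
next
  fix z assume z: "z \<in> K"
  obtain p where p: "p \<in> H" "z - p \<in> H\<^sup>\<bottom>" using orth_decomposition[OF H] .
  then have "p \<in> orth_proj K H" using z by (auto simp: orth_proj_def)
  then show "\<exists>y\<in>orth_proj K H. x \<bullet> y = x \<bullet> z" using inner_orth_proj[OF x p(2)] by blast
qed

lemma convex_compact_orth_proj:
  fixes H K :: "(real^'n) set"
  assumes H: "subspace H" and K: "compact K" "convex K" "K \<noteq> {}"
  shows "compact (orth_proj K H)" "convex (orth_proj K H)" "orth_proj K H \<noteq> {}"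
proof -
  \<comment> \<open>As the intersection of \<open>H\<close> with \<open>K\<close> plus the
    orthogonal complement, the projection is closed because compact plus closed is closed, and
    convex because sums of convex sets are.\<close>
  have eq: "orth_proj K H = H \<inter> (\<Union>x\<in>K. \<Union>y\<in>H\<^sup>\<bottom>. {x + y})"
  proof (intro set_eqI iffI)
    fix y assume "y \<in> orth_proj K H"
    then obtain x where x: "y \<in> H" "x \<in> K" "x - y \<in> H\<^sup>\<bottom>" by (auto simp: orth_proj_def)
    then have "- (x - y) \<in> H\<^sup>\<bottom>" using subspace_neg subspace_orthogonal_comp by blast
    with x show "y \<in> H \<inter> (\<Union>x\<in>K. \<Union>y\<in>H\<^sup>\<bottom>. {x + y})" by (intro IntI UN_I[of x] UN_I[of "y - x"]) auto
  next
    fix y assume "y \<in> H \<inter> (\<Union>x\<in>K. \<Union>y\<in>H\<^sup>\<bottom>. {x + y})"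
    then obtain x u where x: "y \<in> H" "x \<in> K" "y = x + u" "u \<in> H\<^sup>\<bottom>" by auto
    then have "- u \<in> H\<^sup>\<bottom>" using subspace_neg subspace_orthogonal_comp by blast
    moreover have "x - y = - u" using x(3) by simp
    ultimately have "x - y \<in> H\<^sup>\<bottom>" by simp
    then show "y \<in> orth_proj K H" using x(1,2) unfolding orth_proj_def by blast
  qed
  have "closed (H\<^sup>\<bottom>)" by (simp add: closed_subspace subspace_orthogonal_comp)
  then have "closed (\<Union>x\<in>K. \<Union>y\<in>H\<^sup>\<bottom>. {x + y})"
    using compact_closed_sums[OF K(1)] by simp
  then have "closed (orth_proj K H)" unfolding eq using H by (simp add: closed_Int closed_subspace)
  moreover obtain B where B: "\<And>y. y \<in> K \<Longrightarrow> norm y \<le> B" using compact_imp_bounded[OF K(1)] by (auto simp: bounded_iff)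
  have "norm y \<le> B" if y: "y \<in> orth_proj K H" for y
  proof -
    obtain x where x: "y \<in> H" "x \<in> K" "x - y \<in> H\<^sup>\<bottom>" using y by (auto simp: orth_proj_def)
    have "norm y * norm y = y \<bullet> y" by (metis power2_eq_square power2_norm_eq_inner)
    also have "\<dots> = y \<bullet> x" using inner_orth_proj[OF x(1) x(3)] .
    also have "\<dots> \<le> norm y * norm x" by (rule norm_cauchy_schwarz)
    finally have "norm y \<le> norm x" by (cases "norm y = 0") (simp_all add: mult_le_cancel_left_pos)
    then show ?thesis using B[OF x(2)] by linarith
  qed
  then have "bounded (orth_proj K H)" by (auto simp: bounded_iff)
  ultimately show "compact (orth_proj K H)" by (simp add: compact_eq_bounded_closed)
  show "convex (orth_proj K H)" unfolding eq
    by (intro convex_Int convex_sums subspace_imp_convex H K subspace_orthogonal_comp)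
  obtain z where z: "z \<in> K" using K(3) by blast
  obtain p where "p \<in> H" "z - p \<in> H\<^sup>\<bottom>" using orth_decomposition[OF H] .
  then have "p \<in> orth_proj K H" using z unfolding orth_proj_def by auto
  then show "orth_proj K H \<noteq> {}" by blast
qed

lemma O_onD:
  assumes "\<phi> \<in> O_on H"
  shows "orthogonal_transformation \<phi>" "linear \<phi>" "\<And>x. x \<in> H\<^sup>\<bottom> \<Longrightarrow> \<phi> x = x" "\<And>x y. \<phi> x \<bullet> \<phi> y = x \<bullet> y"
  using assms by (auto simp: O_on_def orthogonal_transformation_def)

lemma O_on_maps:
  fixes H :: "(real^'n) set"
  assumes H: "subspace H" and \<phi>: "\<phi> \<in> O_on H"
  shows "\<phi> x \<in> H \<longleftrightarrow> x \<in> H"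
proof -
  have Hpp: "z \<in> H \<longleftrightarrow> (\<forall>u \<in> H\<^sup>\<bottom>. u \<bullet> z = 0)" for z
    using orthogonal_comp_self[OF H] by (auto simp: orthogonal_comp_def orthogonal_def)
  have "u \<bullet> \<phi> x = u \<bullet> x" if "u \<in> H\<^sup>\<bottom>" for u
    using O_onD(3,4)[OF \<phi>] that by metis
  then show ?thesis by (simp add: Hpp)
qed

text \<open>Projecting to \<open>H\<close> does not change the support function on \<open>H\<close>,
  and a compact convex subset of \<open>H\<close> is determined by its support function there.
  Geometry of projections thus becomes an equation between the support functions of the
  bodies.\<close>

lemma congruent_orth_proj_iff:
  fixes H K L :: "(real^'n) set"
  assumes H: "subspace H" and K: "compact K" "convex K" "K \<noteq> {}" and L: "compact L" "convex L" "L \<noteq> {}"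
    and \<phi>: "\<phi> \<in> O_on H" and a: "a \<in> H"
  shows "\<phi> ` orth_proj K H = (+) a ` orth_proj L H \<longleftrightarrow>
    (\<forall>x\<in>H. support_fun K x = \<phi> x \<bullet> a + support_fun L (\<phi> x))"
proof
  note cK = convex_compact_orth_proj[OF H K] and cL = convex_compact_orth_proj[OF H L]
  {
    assume eq: "\<phi> ` orth_proj K H = (+) a ` orth_proj L H"
    show "\<forall>x\<in>H. support_fun K x = \<phi> x \<bullet> a + support_fun L (\<phi> x)"
    proof
      fix x assume x: "x \<in> H"
      have "support_fun K x = support_fun (\<phi> ` orth_proj K H) (\<phi> x)"
        using support_fun_orthogonal_image[OF O_onD(1)[OF \<phi>]] support_fun_orth_proj[OF H x] by simp
      also have "\<dots> = \<phi> x \<bullet> a + support_fun (orth_proj L H) (\<phi> x)"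
        unfolding eq by (rule support_fun_translation[OF cL(1,3)])
      finally show "support_fun K x = \<phi> x \<bullet> a + support_fun L (\<phi> x)"
        using support_fun_orth_proj[OF H] O_on_maps[OF H \<phi>] x by simp
    qed
  next
    assume eq: "\<forall>x\<in>H. support_fun K x = \<phi> x \<bullet> a + support_fun L (\<phi> x)"
    have inH: "\<phi> ` orth_proj K H \<subseteq> H" "(+) a ` orth_proj L H \<subseteq> H"
      using orth_proj_subset O_on_maps[OF H \<phi>] subspace_add[OF H a] by blast+
    have red: "support_fun A x = support_fun A p" if "A \<subseteq> H" "x - p \<in> H\<^sup>\<bottom>" for A x p
    proof (rule support_fun_cong_inner)
      have "x \<bullet> y = p \<bullet> y" if "y \<in> A" for y
        using inner_orth_proj[of y H x p] that \<open>A \<subseteq> H\<close> \<open>x - p \<in> H\<^sup>\<bottom>\<close> by (auto simp: inner_commute)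
      then show "\<And>y. y \<in> A \<Longrightarrow> \<exists>z\<in>A. x \<bullet> y = p \<bullet> z" "\<And>z. z \<in> A \<Longrightarrow> \<exists>y\<in>A. x \<bullet> y = p \<bullet> z" by blast+
    qed
    show "\<phi> ` orth_proj K H = (+) a ` orth_proj L H"
    proof (rule support_fun_eq_imp_eq)
      show "compact (\<phi> ` orth_proj K H)" "convex (\<phi> ` orth_proj K H)" "\<phi> ` orth_proj K H \<noteq> {}"
        using cK O_onD(2)[OF \<phi>]
        by (auto intro!: compact_continuous_image convex_linear_image linear_continuous_on simp: linear_linear)
      show "compact ((+) a ` orth_proj L H)" "convex ((+) a ` orth_proj L H)" "(+) a ` orth_proj L H \<noteq> {}"
        using cL by (auto intro: compact_translation convex_translation)
      fix x
      obtain p where p: "p \<in> H" "x - p \<in> H\<^sup>\<bottom>" using orth_decomposition[OF H] .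
      obtain z where z: "p = \<phi> z" using orthogonal_transformation_surj[OF O_onD(1)[OF \<phi>]] by (metis surjD)
      then have zH: "z \<in> H" using p(1) O_on_maps[OF H \<phi>] by simp
      have "support_fun (\<phi> ` orth_proj K H) x = support_fun (\<phi> ` orth_proj K H) (\<phi> z)"
        using red[OF inH(1) p(2)] z by simp
      also have "\<dots> = support_fun K z"
        using support_fun_orthogonal_image[OF O_onD(1)[OF \<phi>]] support_fun_orth_proj[OF H zH] by simp
      also have "\<dots> = p \<bullet> a + support_fun L p" using eq zH z by simp
      also have "\<dots> = support_fun ((+) a ` orth_proj L H) p"
        using support_fun_orth_proj[OF H p(1)] support_fun_translation[OF cL(1,3)] by simp
      also have "\<dots> = support_fun ((+) a ` orth_proj L H) x" using red[OF inH(2) p(2)] by simp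
      finally show "support_fun (\<phi> ` orth_proj K H) x = support_fun ((+) a ` orth_proj L H) x" .
    qed
  }
qed

section \<open>Hyperplane reflections and their determinants\<close>

definition reflect :: "real^'n \<Rightarrow> real^'n \<Rightarrow> real^'n" where
  "reflect v x = x - (2 * (v \<bullet> x)) *\<^sub>R v"

lemma linear_reflect: "linear (reflect v)"
  by (rule linearI) (simp_all add: reflect_def inner_add_right algebra_simps)

lemma orthogonal_reflect:
  assumes "norm v = 1" shows "orthogonal_transformation (reflect v)"
proof -
  have "v \<bullet> v = 1" using assms by (simp add: norm_eq_1)
  then show ?thesis
    by (simp add: orthogonal_transformation_def linear_reflect)
       (simp add: reflect_def inner_diff_left inner_diff_right inner_commute)
qed

lemma det_compose:
  assumes "linear f" "linear g"
  shows "det (matrix (f \<circ> g) :: real^'n^'n) = det (matrix f) * det (matrix g)"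
  using assms by (simp add: matrix_compose det_mul)

text \<open>The reflection is conjugate, by an orthogonal map, to the one in a coordinate vector,
  whose matrix is diagonal.\<close>

lemma det_reflect:
  fixes v :: "real^'n"
  assumes v: "norm v = 1" shows "det (matrix (reflect v)) = - 1"
proof -
  \<comment> \<open>An arbitrary coordinate; the index type is nonempty.\<close>
  obtain k :: 'n where True by simp
  have "norm (axis k 1 :: real^'n) = 1" by simp
  then obtain f where f: "orthogonal_transformation f" "f (axis k (1::real)) = v"
    using orthogonal_transformation_exists_1[OF _ v] by metis
  have lf: "linear f" using f(1) by (simp add: orthogonal_transformation_def)
  have "(reflect v \<circ> f) x = (f \<circ> reflect (axis k 1)) x" for x
  proof -
    have "v \<bullet> f x = axis k 1 \<bullet> x" using f by (metis orthogonal_transformation_def)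
    then show ?thesis using f(2) by (simp add: reflect_def linear_diff[OF lf] linear_scale[OF lf])
  qed
  then have "reflect v \<circ> f = f \<circ> reflect (axis k 1)" by blast
  then have "det (matrix (reflect v)) * det (matrix f) = det (matrix f) * det (matrix (reflect (axis k 1)))"
    by (metis det_compose linear_reflect lf)
  moreover have "det (matrix f) \<noteq> 0" using orthogonal_transformation_det[OF f(1)] by fastforce
  moreover have "det (matrix (reflect (axis k 1 :: real^'n))) = (\<Prod>i\<in>UNIV. if i = k then - 1 else 1)"
  proof -
    have m: "matrix (reflect (axis k 1 :: real^'n)) $ i $ j = (if i = j then (if i = k then - 1 else 1) else 0)" for i j
      by (simp add: matrix_def reflect_def inner_axis_axis) (auto simp: axis_def)
    then show ?thesis by (subst det_diagonal) (simp_all add: m)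
  qed
  ultimately have "det (matrix (reflect v)) * det (matrix f) = - 1 * det (matrix f)" "det (matrix f) \<noteq> 0"
    by simp_all
  then show ?thesis using mult_right_cancel by blast
qed

section \<open>Rotations of three-dimensional subspaces\<close>

lemma span3_expansion:
  fixes e a b :: "'a::real_inner"
  assumes "norm e = 1" "norm a = 1" "norm b = 1" "e \<bullet> a = 0" "e \<bullet> b = 0" "a \<bullet> b = 0"
    and v: "v \<in> span {e, a, b}"
  shows "v = (v \<bullet> e) *\<^sub>R e + (v \<bullet> a) *\<^sub>R a + (v \<bullet> b) *\<^sub>R b"
proof -
  obtain k l m where v: "v = k *\<^sub>R e + l *\<^sub>R a + m *\<^sub>R b"
    using v unfolding span_breakdown_eq span_empty by (auto simp: algebra_simps)
  have "e \<bullet> e = 1" "a \<bullet> a = 1" "b \<bullet> b = 1" "a \<bullet> e = 0" "b \<bullet> e = 0" "b \<bullet> a = 0"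
    using assms by (simp_all add: norm_eq_1 inner_commute)
  then have "v \<bullet> e = k" "v \<bullet> a = l" "v \<bullet> b = m"
    using assms(4-6) by (simp_all add: v inner_add_left)
  with v show ?thesis by simp
qed

lemma dim_span3:
  fixes e a b :: "'a::euclidean_space"
  assumes "norm e = 1" "norm a = 1" "norm b = 1" "e \<bullet> a = 0" "e \<bullet> b = 0" "a \<bullet> b = 0"
  shows "dim (span {e, a, b}) = 3"
proof -
  have ne: "e \<noteq> a" "e \<noteq> b" "a \<noteq> b" using assms by (auto simp: norm_eq_1)
  have "pairwise orthogonal {e, a, b}" "0 \<notin> {e, a, b}"
    using assms by (auto simp: pairwise_def orthogonal_def inner_commute)
  then have "independent {e, a, b}" by (rule pairwise_orthogonal_independent)
  then have "dim {e, a, b} = card {e, a, b}" by (rule dim_eq_card_independent)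
  then show ?thesis using ne by simp
qed

lemma linear_eq_on_span_orth_comp:
  fixes f g :: "real^'n \<Rightarrow> real^'n"
  assumes "linear f" "linear g" "\<And>x. x \<in> B \<Longrightarrow> f x = g x" "\<And>x. x \<in> (span B)\<^sup>\<bottom> \<Longrightarrow> f x = g x"
  shows "f = g"
proof
  fix x
  obtain p where p: "p \<in> span B" "x - p \<in> (span B)\<^sup>\<bottom>" using orth_decomposition[OF subspace_span] .
  have "f p = g p" using assms(1,2) _ p(1) by (rule linear_eq_on_span) (rule assms(3))
  moreover have "f (x - p) = g (x - p)" by (rule assms(4)[OF p(2)])
  ultimately show "f x = g x" using linear_diff[OF assms(1), of x p] linear_diff[OF assms(2), of x p] by simp
qed

lemma reflect_fixes: "v \<bullet> x = 0 \<Longrightarrow> reflect v x = x"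
  by (simp add: reflect_def)

lemma reflect_self: "norm v = 1 \<Longrightarrow> reflect v v = - v"
  by (simp add: reflect_def norm_eq_1 scaleR_2)

lemma reflect_in_O_on: "norm v = 1 \<Longrightarrow> v \<in> H \<Longrightarrow> reflect v \<in> O_on H"
  by (simp add: O_on_def orthogonal_reflect reflect_fixes inner_orth_comp)

lemma O_on_compose: "f \<in> O_on H \<Longrightarrow> g \<in> O_on H \<Longrightarrow> f \<circ> g \<in> O_on H"
  by (auto simp: O_on_def orthogonal_transformation_compose)

lemma half_turn_in_SO_on:
  assumes "norm a = 1" "norm b = 1" "a \<in> H" "b \<in> H"
  shows "reflect a \<circ> reflect b \<in> SO_on H"
  unfolding SO_on_def using assms
  by (simp add: O_on_compose reflect_in_O_on det_compose linear_reflect det_reflect)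

text \<open>Within the circle the mirror lies at the angle \<open>b + pi / 2\<close>, so
  \<open>s\<close> goes to \<open>2 * b + pi - s\<close>; the minus sign absorbs the half
  turn.\<close>

lemma reflect_circ:
  assumes p: "p \<in> opair \<zeta>"
  shows "reflect (circ p b) (circ p s) = - circ p (2 * b - s)"
proof -
  define d where "d = b - s"
  have "circ p b \<bullet> circ p s = cos d"
    by (simp add: inner_circ_circ[OF p] d_def)
  moreover have "circ p (b - d) + circ p (b + d) = (2 * cos d) *\<^sub>R circ p b"
  proof -
    have "cos (b - d) + cos (b + d) = 2 * cos d * cos b" "sin (b - d) + sin (b + d) = 2 * cos d * sin b"
      by (simp_all add: cos_add cos_diff sin_add sin_diff)
    moreover have "circ p (b - d) + circ p (b + d)
        = (cos (b - d) + cos (b + d)) *\<^sub>R fst p + (sin (b - d) + sin (b + d)) *\<^sub>R snd p"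
      by (simp add: circ_def scaleR_add_left)
    ultimately show ?thesis by (simp add: circ_def scaleR_add_right)
  qed
  moreover have "b - d = s" "b + d = 2 * b - s" by (simp_all add: d_def)
  ultimately show ?thesis by (simp add: reflect_def) (metis add_diff_cancel_left' minus_diff_eq)
qed

abbreviation pspan :: "real^'n \<Rightarrow> (real^'n) \<times> (real^'n) \<Rightarrow> (real^'n) set" where
  "pspan \<zeta> p \<equiv> span {\<zeta>, fst p, snd p}"

lemma circ_in_pspan: "circ p s \<in> pspan \<zeta> p"
  by (simp add: circ_def span_add span_base span_scale)

lemma zeta_in_pspan: "\<zeta> \<in> pspan \<zeta> p"
  by (simp add: span_base)

lemma dim_pspan: "norm \<zeta> = 1 \<Longrightarrow> p \<in> opair \<zeta> \<Longrightarrow> dim (pspan \<zeta> p) = 3"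
  by (intro dim_span3) (auto simp: opair_iff)

text \<open>Cylindrical coordinates with axis \<zeta>.\<close>

lemma pspan_circ_expansion:
  assumes z: "norm \<zeta> = 1" and p: "p \<in> opair \<zeta>" and v: "v \<in> pspan \<zeta> p"
  obtains r s where "v = (v \<bullet> \<zeta>) *\<^sub>R \<zeta> + r *\<^sub>R circ p s" "r\<^sup>2 = v \<bullet> v - (v \<bullet> \<zeta>)\<^sup>2" "0 \<le> r"
proof -
  obtain x y where xy: "p = (x, y)" by fastforce
  have frame: "x \<bullet> x = 1" "y \<bullet> y = 1" "x \<bullet> y = 0" "y \<bullet> x = 0" "\<zeta> \<bullet> x = 0" "\<zeta> \<bullet> y = 0" "x \<bullet> \<zeta> = 0" "y \<bullet> \<zeta> = 0" "\<zeta> \<bullet> \<zeta> = 1"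
    using p z by (auto simp: xy opair_def norm_eq_1 inner_commute)
  define k a b where "k = v \<bullet> \<zeta>" and "a = v \<bullet> x" and "b = v \<bullet> y"
  have "v = (v \<bullet> \<zeta>) *\<^sub>R \<zeta> + (v \<bullet> x) *\<^sub>R x + (v \<bullet> y) *\<^sub>R y"
    using v p z by (intro span3_expansion) (auto simp: xy opair_def)
  then have e: "v = k *\<^sub>R \<zeta> + a *\<^sub>R x + b *\<^sub>R y" by (simp add: k_def a_def b_def)
  have n: "v \<bullet> v = k\<^sup>2 + a\<^sup>2 + b\<^sup>2"
    unfolding e by (simp add: inner_add_left inner_add_right frame power2_eq_square)
  define r where "r = sqrt (a\<^sup>2 + b\<^sup>2)"
  have r2: "r\<^sup>2 = a\<^sup>2 + b\<^sup>2" by (simp add: r_def)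
  have "\<exists>s. a = r * cos s \<and> b = r * sin s"
  proof (cases "r = 0")
    case True
    then show ?thesis using r2 by (simp add: sum_power2_eq_zero_iff)
  next
    case False
    have "(a / r)\<^sup>2 + (b / r)\<^sup>2 = (a\<^sup>2 + b\<^sup>2) / r\<^sup>2" by (simp only: power_divide add_divide_distrib)
    also have "\<dots> = 1" unfolding r2[symmetric] using False by simp
    finally obtain s where "a / r = cos s" "b / r = sin s" by (metis sincos_total_2pi)
    then show ?thesis using False by (intro exI[of _ s]) (simp add: field_simps)
  qed
  then obtain s where s: "a = r * cos s" "b = r * sin s" by blast
  have "v = (v \<bullet> \<zeta>) *\<^sub>R \<zeta> + r *\<^sub>R circ p s"
    using e by (simp add: circ_def xy s k_def algebra_simps)
  moreover have "r\<^sup>2 = v \<bullet> v - (v \<bullet> \<zeta>)\<^sup>2" using n r2 by (simp add: k_def)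
  moreover have "0 \<le> r" by (simp add: r_def)
  ultimately show thesis by (rule that)
qed

lemma O_on_pspan_angle:
  fixes \<zeta> :: "real^'n"
  assumes z: "norm \<zeta> = 1" and p: "p \<in> opair \<zeta>" and \<phi>: "\<phi> \<in> O_on (pspan \<zeta> p)"
    and \<sigma>: "\<phi> \<zeta> = \<sigma> *\<^sub>R \<zeta>" "\<sigma> = 1 \<or> \<sigma> = - 1"
  obtains \<alpha> \<tau> where "\<tau> = 1 \<or> \<tau> = - 1" "\<And>s. \<phi> (circ p s) = circ p (\<alpha> + \<tau> * s)"
proof -
  have plane: "\<exists>c. \<phi> (circ p s) = circ p c" for s
  proof -
    have "\<phi> (circ p s) \<in> pspan \<zeta> p" using O_on_maps[OF subspace_span \<phi>] circ_in_pspan by blast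
    then obtain r c where e: "\<phi> (circ p s) = (\<phi> (circ p s) \<bullet> \<zeta>) *\<^sub>R \<zeta> + r *\<^sub>R circ p c"
      "r\<^sup>2 = \<phi> (circ p s) \<bullet> \<phi> (circ p s) - (\<phi> (circ p s) \<bullet> \<zeta>)\<^sup>2"
      by (rule pspan_circ_expansion[OF z p])
    have "\<phi> (circ p s) \<bullet> \<phi> \<zeta> = 0" using O_onD(4)[OF \<phi>] inner_circ[OF p] by (simp add: inner_commute)
    then have 0: "\<phi> (circ p s) \<bullet> \<zeta> = 0" using \<sigma> by auto
    have "circ p s \<bullet> circ p s = 1" using norm_circ[OF p] by (simp add: norm_eq_1)
    then have "r\<^sup>2 = 1" using e(2) 0 O_onD(4)[OF \<phi>] by simp
    then have "r = 1 \<or> r = - 1" by (simp add: power2_eq_1_iff)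
    then show ?thesis using e(1) 0 circ_add_pi[of p c] by (metis add_0 scaleR_minus1_left scaleR_one scaleR_zero_left)
  qed
  obtain \<alpha> \<beta> where \<alpha>: "\<phi> (circ p 0) = circ p \<alpha>" and \<beta>: "\<phi> (circ p (pi / 2)) = circ p \<beta>" using plane by blast
  note ip = inner_circ_circ[OF p]
  have c0: "cos (\<beta> - \<alpha>) = 0"
    using O_onD(4)[OF \<phi>, of "circ p (pi / 2)" "circ p 0"] by (simp add: \<alpha>[simplified] \<beta> ip ip[of "pi/2" 0, simplified])
  \<comment> \<open>The images of two orthogonal points are orthogonal, so this sine is 1 or - 1; it
    records whether the circle keeps its orientation.\<close>
  define \<tau> where "\<tau> = sin (\<beta> - \<alpha>)"
  have "\<tau>\<^sup>2 = 1" using sin_cos_squared_add[of "\<beta> - \<alpha>"] c0 by (simp add: \<tau>_def)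
  then have \<tau>: "\<tau> = 1 \<or> \<tau> = - 1" by (simp add: power2_eq_1_iff)
  have "circ p \<beta> = circ p (\<alpha> + (\<beta> - \<alpha>))" by simp
  also have "\<dots> = \<tau> *\<^sub>R circ p (\<alpha> + pi / 2)"
    unfolding circ_def cos_add[of \<alpha> "\<beta> - \<alpha>"] sin_add[of \<alpha> "\<beta> - \<alpha>"] c0 \<tau>_def[symmetric]
    by (simp add: cos_add sin_add algebra_simps)
  finally have \<beta>': "circ p \<beta> = \<tau> *\<^sub>R circ p (\<alpha> + pi / 2)" .
  have "\<phi> (circ p s) = circ p (\<alpha> + \<tau> * s)" for s
  proof -
    have "circ p s = cos s *\<^sub>R circ p 0 + sin s *\<^sub>R circ p (pi / 2)" by (simp add: circ_def)
    then have "\<phi> (circ p s) = cos s *\<^sub>R circ p \<alpha> + sin s *\<^sub>R circ p \<beta>"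
      using O_onD(2)[OF \<phi>] \<alpha> \<beta> by (simp only: linear_add linear_scale)
    also have "\<dots> = circ p (\<alpha> + \<tau> * s)"
      unfolding \<beta>' using \<tau> by (auto simp: circ_def cos_add sin_add cos_diff sin_diff algebra_simps)
    finally show ?thesis .
  qed
  with \<tau> show thesis by (rule that)
qed

lemma linear_eq_on_pspan:
  fixes f g :: "real^'n \<Rightarrow> real^'n"
  assumes "f \<in> O_on (pspan \<zeta> p)" "g \<in> O_on (pspan \<zeta> p)" "f \<zeta> = g \<zeta>" "\<And>s. f (circ p s) = g (circ p s)"
  shows "f = g"
proof (rule linear_eq_on_span_orth_comp)
  have "circ p (pi / 2) = snd p" by (simp add: circ_def)
  then have "f (fst p) = g (fst p)" "f (snd p) = g (snd p)" using assms(4)[of 0] assms(4)[of "pi / 2"] by simp_all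
  then show "f x = g x" if "x \<in> {\<zeta>, fst p, snd p}" for x using that assms(3) by auto
  show "f x = g x" if "x \<in> (pspan \<zeta> p)\<^sup>\<bottom>" for x
    using O_onD(3)[OF assms(1) that] O_onD(3)[OF assms(2) that] by simp
qed (use assms O_onD(2) in auto)

text \<open>With the axis fixed, reversing the circle would make the map a single hyperplane
  reflection, of determinant - 1.\<close>

lemma SO_on_pspan_rotation:
  fixes \<zeta> :: "real^'n"
  assumes z: "norm \<zeta> = 1" and p: "p \<in> opair \<zeta>" and \<phi>: "\<phi> \<in> SO_on (pspan \<zeta> p)" and fixed: "\<phi> \<zeta> = \<zeta>"
  obtains \<alpha> where "\<And>s. \<phi> (circ p s) = circ p (s + \<alpha>)"
proof -
  have O: "\<phi> \<in> O_on (pspan \<zeta> p)" and det: "det (matrix \<phi>) = 1" using \<phi> by (auto simp: SO_on_def)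
  obtain \<alpha> \<tau> where \<tau>: "\<tau> = 1 \<or> \<tau> = - 1" and eq: "\<And>s. \<phi> (circ p s) = circ p (\<alpha> + \<tau> * s)"
  proof (rule O_on_pspan_angle[OF z p O])
    show "\<phi> \<zeta> = 1 *\<^sub>R \<zeta>" using fixed by simp
  qed auto
  have "\<tau> \<noteq> - 1"
  proof
    assume "\<tau> = - 1"
    define v where "v = circ p (\<alpha> / 2 + pi / 2)"
    have v: "norm v = 1" "v \<in> pspan \<zeta> p" "v \<bullet> \<zeta> = 0"
      using norm_circ[OF p] inner_circ[OF p] circ_in_pspan by (simp_all add: v_def inner_commute)
    have "\<phi> = reflect v"
    proof (rule linear_eq_on_pspan[OF O reflect_in_O_on[OF v(1,2)]])
      show "\<phi> \<zeta> = reflect v \<zeta>" using fixed v(3) by (simp add: reflect_fixes)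
      fix s
      have e: "2 * (\<alpha> / 2 + pi / 2) - s = (\<alpha> + \<tau> * s) + pi" using \<open>\<tau> = - 1\<close> by (simp add: field_simps)
      then show "\<phi> (circ p s) = reflect v (circ p s)"
        by (simp only: v_def reflect_circ[OF p] eq e circ_add_pi minus_minus)
    qed
    then show False using det_reflect[OF v(1)] det by simp
  qed
  with \<tau> eq show thesis by (intro that[of \<alpha>]) (simp add: add.commute)
qed

text \<open>With the axis reversed, rotating the circle by \<alpha> would make the map a product of
  three reflections, one flipping the axis and two composing to the rotation; its determinant would
  be - 1.\<close>

lemma SO_on_pspan_reflection:
  fixes \<zeta> :: "real^'n"
  assumes z: "norm \<zeta> = 1" and p: "p \<in> opair \<zeta>" and \<phi>: "\<phi> \<in> SO_on (pspan \<zeta> p)" and neg: "\<phi> \<zeta> = - \<zeta>"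
  obtains \<gamma> where "\<And>s. \<phi> (circ p s) = circ p (\<gamma> - s)"
proof -
  have O: "\<phi> \<in> O_on (pspan \<zeta> p)" and det: "det (matrix \<phi>) = 1" using \<phi> by (auto simp: SO_on_def)
  obtain \<alpha> \<tau> where \<tau>: "\<tau> = 1 \<or> \<tau> = - 1" and eq: "\<And>s. \<phi> (circ p s) = circ p (\<alpha> + \<tau> * s)"
  proof (rule O_on_pspan_angle[OF z p O])
    show "\<phi> \<zeta> = (- 1) *\<^sub>R \<zeta>" using neg by simp
  qed auto
  have "\<tau> \<noteq> 1"
  proof
    assume "\<tau> = 1"
    define u v where "u = circ p (\<alpha> / 2)" and "v = circ p 0"
    have uv: "norm u = 1" "u \<in> pspan \<zeta> p" "u \<bullet> \<zeta> = 0" "norm v = 1" "v \<in> pspan \<zeta> p" "v \<bullet> \<zeta> = 0"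
      using norm_circ[OF p] inner_circ[OF p] circ_in_pspan by (simp_all only: u_def v_def inner_commute)
    note O' = reflect_in_O_on[OF z zeta_in_pspan] reflect_in_O_on[OF uv(1,2)] reflect_in_O_on[OF uv(4,5)]
    have "\<phi> = reflect \<zeta> \<circ> (reflect u \<circ> reflect v)"
    proof (rule linear_eq_on_pspan[OF O O_on_compose[OF O'(1) O_on_compose[OF O'(2,3)]]])
      show "\<phi> \<zeta> = (reflect \<zeta> \<circ> (reflect u \<circ> reflect v)) \<zeta>"
        using neg uv z by (simp add: reflect_fixes reflect_self)
      fix s
      have "reflect v (circ p s) = circ p (- s + pi)"
        by (simp only: v_def reflect_circ[OF p] circ_add_pi mult_zero_right diff_0)
      then have "reflect u (reflect v (circ p s)) = - circ p (2 * (\<alpha> / 2) - (- s + pi))"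
        unfolding u_def by (simp only: reflect_circ[OF p])
      also have "2 * (\<alpha> / 2) - (- s + pi) = \<alpha> + \<tau> * s - pi" using \<open>\<tau> = 1\<close> by simp
      also have "- circ p (\<alpha> + \<tau> * s - pi) = circ p (\<alpha> + \<tau> * s)"
        using circ_add_pi[of p "\<alpha> + \<tau> * s - pi"] by simp
      finally show "\<phi> (circ p s) = (reflect \<zeta> \<circ> (reflect u \<circ> reflect v)) (circ p s)"
        using inner_circ[OF p] by (simp add: eq reflect_fixes)
    qed
    then have "det (matrix \<phi>) = - 1"
      using uv z by (simp add: det_compose linear_compose linear_reflect det_reflect)
    then show False using det by simp
  qed
  with \<tau> eq show thesis by (intro that[of \<alpha>]) simp
qed

text \<open>The half turn about \<open>e\<close> is the product of the reflections in
  \<open>a\<close> and \<open>b\<close>. Symmetry about the centre \<open>m\<close> becomes symmetry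
  up to the translation \<open>R q - q\<close>, where \<open>q\<close> is the projection of
  \<open>m\<close> to \<open>H\<close>.\<close>

lemma pi_symmetry_if_support_fun:
  fixes K :: "(real^'n) set"
  assumes K: "compact K" "convex K" "K \<noteq> {}"
    and n: "norm e = 1" "norm a = 1" "norm b = 1" "e \<bullet> a = 0" "e \<bullet> b = 0" "a \<bullet> b = 0"
    and H: "H = span {e, a, b}"
    and sym: "\<And>x. x \<in> H \<Longrightarrow> support_fun K x - m \<bullet> x
       = support_fun K ((reflect a \<circ> reflect b) x) - m \<bullet> (reflect a \<circ> reflect b) x"
  shows "pi_symmetry H e (orth_proj K H)"
proof -
  define R where "R = reflect a \<circ> reflect b"
  have sH: "subspace H" and mem: "e \<in> H" "a \<in> H" "b \<in> H" by (simp_all add: H span_base)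
  have RSO: "R \<in> SO_on H" unfolding R_def using n mem by (intro half_turn_in_SO_on)
  then have RO: "R \<in> O_on H" by (simp add: SO_on_def)
  have "a \<bullet> e = 0" "b \<bullet> e = 0" using n by (simp_all add: inner_commute)
  then have Re: "R e = e" by (simp add: R_def reflect_fixes)
  have Rperp: "R x = - x" if "x \<in> H" "orthogonal x e" for x
  proof -
    have "x = (x \<bullet> e) *\<^sub>R e + (x \<bullet> a) *\<^sub>R a + (x \<bullet> b) *\<^sub>R b"
      using span3_expansion[OF n] that(1) by (simp add: H)
    then have x: "x = (x \<bullet> a) *\<^sub>R a + (x \<bullet> b) *\<^sub>R b" using that(2) by (simp add: orthogonal_def)
    have R1: "reflect b x = x - (2 * (x \<bullet> b)) *\<^sub>R b" by (simp add: reflect_def inner_commute)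
    have R2: "reflect a (x - (2 * (x \<bullet> b)) *\<^sub>R b) = x - (2 * (x \<bullet> b)) *\<^sub>R b - (2 * (x \<bullet> a)) *\<^sub>R a"
      using n by (simp add: reflect_def inner_diff_right inner_commute)
    have "R x = reflect a (reflect b x)" by (simp add: R_def)
    also have "\<dots> = x - 2 *\<^sub>R ((x \<bullet> a) *\<^sub>R a + (x \<bullet> b) *\<^sub>R b)"
      unfolding R1 R2 by (simp add: scaleR_add_right)
    finally have "R x = x - 2 *\<^sub>R ((x \<bullet> a) *\<^sub>R a + (x \<bullet> b) *\<^sub>R b)" .
    then show ?thesis using x by (simp add: scaleR_2)
  qed
  obtain q where q: "q \<in> H" "m - q \<in> H\<^sup>\<bottom>" using orth_decomposition[OF sH] .
  have mq: "m \<bullet> x = q \<bullet> x" if "x \<in> H" for x using inner_orth_proj[OF that q(2)] by (simp add: inner_commute)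
  have aH: "R q - q \<in> H" using O_on_maps[OF sH RO] q(1) sH by (simp add: subspace_diff)
  have "R ` orth_proj K H = (+) (R q - q) ` orth_proj K H"
  proof (subst congruent_orth_proj_iff[OF sH K K RO aH], intro ballI)
    fix x assume x: "x \<in> H"
    then have Rx: "R x \<in> H" using O_on_maps[OF sH RO] by simp
    have "R x \<bullet> (R q - q) = x \<bullet> q - R x \<bullet> q" by (simp add: inner_diff_right O_onD(4)[OF RO])
    then show "support_fun K x = R x \<bullet> (R q - q) + support_fun K (R x)"
      using sym[OF x] mq[OF x] mq[OF Rx] by (simp add: R_def inner_commute)
  qed
  then show ?thesis unfolding pi_symmetry_def using RSO Re Rperp aH by blast
qed

section \<open>Diameters and generic directions\<close>

lemma unit_decomposition:
  fixes \<zeta> :: "'a::euclidean_space"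
  assumes dim: "4 \<le> DIM('a)" and z: "norm \<zeta> = 1"
  obtains r v where "norm v = 1" "\<zeta> \<bullet> v = 0" "0 \<le> r" "x = (x \<bullet> \<zeta>) *\<^sub>R \<zeta> + r *\<^sub>R v"
proof -
  define u where "u = x - (x \<bullet> \<zeta>) *\<^sub>R \<zeta>"
  have zz: "\<zeta> \<bullet> \<zeta> = 1" using z by (simp add: norm_eq_1)
  have u: "\<zeta> \<bullet> u = 0" by (simp add: u_def inner_diff_right zz inner_commute)
  show thesis
  proof (cases "u = 0")
    case True
    have "card {\<zeta>} < DIM('a)" using dim by simp
    then obtain v where "norm v = 1" "\<And>w. w \<in> {\<zeta>} \<Longrightarrow> w \<bullet> v = 0"
      by (rule exists_unit_orthogonal_vector[rotated]) auto
    then show thesis using True by (intro that[of v 0]) (auto simp: u_def)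
  next
    case False
    then show thesis using u by (intro that[of "(1 / norm u) *\<^sub>R u" "norm u"]) (auto simp: u_def)
  qed
qed

lemma exists_pspan_containing:
  fixes \<zeta> :: "real^'n"
  assumes dim: "4 \<le> CARD('n)" and z: "norm \<zeta> = 1"
  obtains p where "p \<in> opair \<zeta>" "x \<in> pspan \<zeta> p"
proof -
  have d: "4 \<le> DIM(real^'n)" using dim by simp
  obtain r v where v: "norm v = 1" "\<zeta> \<bullet> v = 0" "0 \<le> r" "x = (x \<bullet> \<zeta>) *\<^sub>R \<zeta> + r *\<^sub>R v"
    by (rule unit_decomposition[OF d z])
  obtain y where y: "(v, y) \<in> opair \<zeta>" by (rule opair_nonempty[OF d v(1,2)])
  have "(x \<bullet> \<zeta>) *\<^sub>R \<zeta> + r *\<^sub>R v \<in> pspan \<zeta> (v, y)"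
    by (intro span_add span_scale span_base) auto
  then show thesis using y v(4) by (intro that[of "(v, y)"]) auto
qed

text \<open>The distance of two points is at most the width in the direction joining them, so the
  maximal width bounds all distances in \<open>K\<close>.\<close>

lemma diameter_endpoints:
  fixes K :: "(real^'n) set"
  assumes cb: "convex_body K" and diam: "has_diameter_parallel K \<zeta>" and z: "norm \<zeta> = 1"
  obtains m d where "0 < d" "m + d *\<^sub>R \<zeta> \<in> K" "m - d *\<^sub>R \<zeta> \<in> K"
    "\<And>k k'. k \<in> K \<Longrightarrow> k' \<in> K \<Longrightarrow> norm (k - k') \<le> 2 * d"
proof -
  have K: "compact K" using cb by (simp add: convex_body_def)
  obtain a b c \<theta> where ab: "closed_segment a b \<subseteq> K" "a - b = c *\<^sub>R \<zeta>"
    and \<theta>: "\<theta> \<in> max_width_directions K" "norm (a - b) = width_fun K \<theta>"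
    using diam by (auto simp: has_diameter_parallel_def is_diameter_def)
  define d m where "d = norm (a - b) / 2" and "m = (1/2) *\<^sub>R (a + b)"
  have mem: "a \<in> K" "b \<in> K" using ab(1) by auto
  have le: "norm (k - k') \<le> 2 * d" if k: "k \<in> K" "k' \<in> K" for k k'
  proof (cases "k = k'")
    case False
    define u where "u = (1 / norm (k - k')) *\<^sub>R (k - k')"
    have u: "u \<in> sphere 0 1" using False by (simp add: u_def)
    have "norm (k - k') * norm (k - k') = (k - k') \<bullet> (k - k')"
      by (metis power2_eq_square power2_norm_eq_inner)
    moreover have "u \<bullet> (k - k') = (1 / norm (k - k')) * ((k - k') \<bullet> (k - k'))"
      by (simp only: u_def inner_scaleR_left)
    ultimately have "norm (k - k') = u \<bullet> (k - k')" using False by (metis mult.assoc mult.left_neutral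
      nonzero_divide_eq_eq norm_eq_zero right_minus_eq times_divide_eq_left)
    also have "\<dots> = u \<bullet> k + (- u) \<bullet> k'" by (simp add: inner_diff_right)
    also have "\<dots> \<le> width_fun K u" unfolding width_fun_def by (intro add_mono support_fun_upper K k)
    also have "\<dots> \<le> width_fun K \<theta>" using \<theta>(1) u by (auto simp: max_width_directions_def)
    finally show ?thesis using \<theta>(2) by (simp add: d_def)
  qed (simp add: d_def)
  obtain x e where e: "0 < e" "ball x e \<subseteq> K"
    using cb unfolding convex_body_def by (metis equals0I mem_interior)
  have "x \<in> K" "x + (e / 2) *\<^sub>R \<zeta> \<in> K" using e z by (auto simp: subset_iff dist_norm)
  from le[OF this(2,1)] have d: "0 < d" using e z by simp
  have "c = 2 * d \<or> c = - 2 * d" using ab(2) z by (auto simp: d_def abs_if split: if_splits)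
  moreover have "a = m + (c / 2) *\<^sub>R \<zeta>" "b = m - (c / 2) *\<^sub>R \<zeta>"
  proof -
    have *: "(c / 2) *\<^sub>R \<zeta> = (1/2) *\<^sub>R (a - b)" using ab(2) by simp
    have "(1/2) *\<^sub>R a + (1/2) *\<^sub>R a = a" "(1/2) *\<^sub>R b + (1/2) *\<^sub>R b = b" by (simp_all flip: scaleR_add_left)
    then show "a = m + (c / 2) *\<^sub>R \<zeta>" "b = m - (c / 2) *\<^sub>R \<zeta>"
      unfolding * m_def by (simp_all add: scaleR_add_right scaleR_diff_right)
  qed
  ultimately have "m + d *\<^sub>R \<zeta> \<in> K \<and> m - d *\<^sub>R \<zeta> \<in> K" using mem by auto
  then show thesis using that[of d m] d le by blast
qed

lemma pythagoras_orth_comp: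
  "x \<in> H \<Longrightarrow> u \<in> H\<^sup>\<bottom> \<Longrightarrow> (norm (x + u))\<^sup>2 = (norm x)\<^sup>2 + (norm u)\<^sup>2"
  using inner_orth_comp[of x H u] by (intro norm_add_Pythagorean) (simp add: orthogonal_def)

lemma orth_proj_contraction:
  fixes H :: "(real^'n) set"
  assumes H: "subspace H" and "p \<in> H" "p' \<in> H" "k - p \<in> H\<^sup>\<bottom>" "k' - p' \<in> H\<^sup>\<bottom>"
  shows "norm (p - p') \<le> norm (k - k')"
proof -
  have "(k - p) - (k' - p') \<in> H\<^sup>\<bottom>" by (rule subspace_diff[OF subspace_orthogonal_comp assms(4,5)])
  then have "(norm (p - p' + ((k - p) - (k' - p'))))\<^sup>2 = (norm (p - p'))\<^sup>2 + (norm ((k - p) - (k' - p')))\<^sup>2"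
    using assms by (intro pythagoras_orth_comp) (auto intro: subspace_diff)
  moreover have "p - p' + ((k - p) - (k' - p')) = k - k'" by simp
  ultimately have "(norm (p - p'))\<^sup>2 \<le> (norm (k - k'))\<^sup>2" by simp
  then show ?thesis by (simp add: power2_le_iff_abs_le)
qed

text \<open>A body of diameter \<open>2 * d\<close> meets the supporting hyperplane at the end point of a diameter
  only in that end point, so diameters of the projections must match without translation.\<close>

lemma contact_points_unique:
  fixes H L :: "(real^'n) set"
  assumes H: "subspace H" "\<zeta> \<in> H" and z: "norm \<zeta> = 1"
    and L: "m + d *\<^sub>R \<zeta> \<in> L" "m - d *\<^sub>R \<zeta> \<in> L"
    and diam: "\<And>k k'. k \<in> L \<Longrightarrow> k' \<in> L \<Longrightarrow> norm (k - k') \<le> 2 * d"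
    and q: "q \<in> H" "m - q \<in> H\<^sup>\<bottom>" and a: "a \<in> H"
    and pr: "q + d *\<^sub>R \<zeta> - a \<in> orth_proj L H" "q - d *\<^sub>R \<zeta> - a \<in> orth_proj L H"
  shows "a = 0"
proof -
  have d: "0 \<le> d" using diam[OF L(1) L(1)] by simp
  \<comment> \<open>The point of \<open>L\<close> above \<open>q + e *\<^sub>R \<zeta> - a\<close>
    has distance at most \<open>2 * d\<close> from the opposite end point
    \<open>m - e *\<^sub>R \<zeta>\<close>. Expanding the square leaves this bound; for
    \<open>e = d\<close> and \<open>e = - d\<close> the right-hand sides cancel in the sum.\<close>
  have key: "(norm a)\<^sup>2 \<le> 2 * ((2 * e) * (a \<bullet> \<zeta>))"
    if e: "e = d \<or> e = - d" and pe: "q + e *\<^sub>R \<zeta> - a \<in> orth_proj L H" and me: "m - e *\<^sub>R \<zeta> \<in> L" for e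
  proof -
    obtain l where l: "l \<in> L" "l - (q + e *\<^sub>R \<zeta> - a) \<in> H\<^sup>\<bottom>" using pe by (auto simp: orth_proj_def)
    define u where "u = l - (q + e *\<^sub>R \<zeta> - a) - (m - q)"
    have u: "u \<in> H\<^sup>\<bottom>" unfolding u_def by (rule subspace_diff[OF subspace_orthogonal_comp l(2) q(2)])
    have v: "(2 * e) *\<^sub>R \<zeta> - a \<in> H" by (rule subspace_diff[OF H(1) subspace_scale[OF H] a])
    have "l - (m - e *\<^sub>R \<zeta>) = ((2 * e) *\<^sub>R \<zeta> - a) + u"
      by (simp add: u_def scaleR_2 algebra_simps flip: scaleR_scaleR)
    then have "(norm ((2 * e) *\<^sub>R \<zeta> - a))\<^sup>2 + (norm u)\<^sup>2 = (norm (l - (m - e *\<^sub>R \<zeta>)))\<^sup>2"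
      using pythagoras_orth_comp[OF v u] by simp
    also have "\<dots> \<le> (2 * d)\<^sup>2" using diam[OF l(1) me] by (intro power_mono) auto
    finally have "(norm ((2 * e) *\<^sub>R \<zeta> - a))\<^sup>2 \<le> (2 * d)\<^sup>2" by (smt (verit) zero_le_power2)
    moreover have "(norm ((2 * e) *\<^sub>R \<zeta> - a))\<^sup>2 = (2 * e)\<^sup>2 - 2 * ((2 * e) * (a \<bullet> \<zeta>)) + (norm a)\<^sup>2"
    proof -
      have "\<zeta> \<bullet> \<zeta> = 1" using z by (simp add: norm_eq_1)
      then show ?thesis unfolding power2_norm_eq_inner
        by (simp add: inner_diff_left inner_diff_right inner_commute power2_eq_square)
    qed
    moreover have "(2 * e)\<^sup>2 = (2 * d)\<^sup>2" using e by auto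
    ultimately show ?thesis by linarith
  qed
  have "(norm a)\<^sup>2 \<le> 2 * ((2 * d) * (a \<bullet> \<zeta>))" using key[of d] pr L by simp
  moreover have "(norm a)\<^sup>2 \<le> 2 * ((2 * (- d)) * (a \<bullet> \<zeta>))" using key[of "- d"] pr L by simp
  ultimately have "(norm a)\<^sup>2 \<le> 0" by linarith
  then show ?thesis by simp
qed

text \<open>Distinct angles in an interval shorter than a half turn give non-parallel vectors, so
  each nonzero \<open>c\<close> rules out at most one angle, and countably many angles do not
  exhaust an interval.\<close>

lemma generic_direction:
  assumes p: "p \<in> opair \<zeta>" and C: "countable C" and e: "0 < e"
  obtains s where "0 < s" "s < e" "\<And>c k. c \<in> C \<Longrightarrow> c = k *\<^sub>R circ p s \<Longrightarrow> k = 0"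
proof -
  define Bad where "Bad = {s \<in> {0<..<min e pi}. \<exists>c\<in>C. \<exists>k. k \<noteq> 0 \<and> c = k *\<^sub>R circ p s}"
  define f where "f s = (SOME c. c \<in> C \<and> (\<exists>k. k \<noteq> 0 \<and> c = k *\<^sub>R circ p s))" for s
  have f: "f s \<in> C \<and> (\<exists>k. k \<noteq> 0 \<and> f s = k *\<^sub>R circ p s)" if "s \<in> Bad" for s
  proof -
    have "\<exists>c. c \<in> C \<and> (\<exists>k. k \<noteq> 0 \<and> c = k *\<^sub>R circ p s)" using that by (auto simp: Bad_def)
    then show ?thesis unfolding f_def by (rule someI_ex)
  qed
  have "inj_on f Bad"
  proof (rule inj_onI)
    fix s s' assume s: "s \<in> Bad" "s' \<in> Bad" "f s = f s'"
    have ip: "circ p a \<bullet> circ p (b + pi / 2) = sin (a - b)" for a b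
      by (simp add: inner_circ_circ[OF p] cos_diff sin_diff cos_add sin_add)
    obtain k k' where k: "k \<noteq> 0" "f s = k *\<^sub>R circ p s" "f s' = k' *\<^sub>R circ p s'"
      using f[OF s(1)] f[OF s(2)] by blast
    have "(k *\<^sub>R circ p s) \<bullet> circ p (s' + pi / 2) = (k' *\<^sub>R circ p s') \<bullet> circ p (s' + pi / 2)"
      using k s(3) by simp
    then have "sin (s - s') = 0" using k(1) by (simp add: ip)
    moreover have "\<bar>s - s'\<bar> < pi" using s by (auto simp: Bad_def)
    ultimately show "s = s'" using sin_eq_0_pi[of "s - s'"] by (simp add: abs_less_iff)
  qed
  then have "countable Bad" 
    by (rule countable_image_inj_on[rotated]) (use C f in \<open>auto intro: countable_subset[of _ C]\<close>)
  moreover have "uncountable {0<..<min e pi}" using e by (simp add: uncountable_open_interval)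
  ultimately obtain s where "s \<in> {0<..<min e pi} - Bad"
    by (metis uncountable_minus_countable all_not_in_conv countable_empty)
  then show thesis by (intro that[of s]) (auto simp: Bad_def)
qed

lemma circ_close:
  fixes p :: "'a::euclidean_space \<times> 'a"
  assumes "0 < e"
  obtains d where "0 < d" "\<And>s. 0 < s \<Longrightarrow> s < d \<Longrightarrow> norm (circ p s - fst p) < e"
proof -
  have "isCont (\<lambda>s. circ p s) 0" unfolding circ_def by (intro continuous_intros)
  then obtain d where "0 < d" "\<forall>s. dist s 0 < d \<longrightarrow> dist (circ p s) (circ p 0) < e"
    using assms unfolding continuous_at_eps_delta by blast
  then show thesis by (intro that[of d]) (auto simp: dist_norm)
qed

text \<open>Turn \<open>x\<close> and then \<open>y\<close> slightly: the first turn avoids the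
  parts of \<open>C\<close> orthogonal to \<zeta>, the second avoids what remains of them after
  removing the component along the new first vector. An element of \<open>C\<close> in the new
  subspace then has no component along either vector.\<close>

lemma generic_opair_dense:
  fixes \<zeta> :: "real^'n"
  assumes dim: "4 \<le> CARD('n)" and z: "norm \<zeta> = 1" and C: "countable C" and p: "p \<in> opair \<zeta>" and e: "0 < e"
  obtains p' where "p' \<in> opair \<zeta>" "dist p' p < e"
    "\<And>c. c \<in> C \<Longrightarrow> c \<in> pspan \<zeta> p' \<Longrightarrow> c = (c \<bullet> \<zeta>) *\<^sub>R \<zeta>"
proof -
  have d: "4 \<le> DIM(real^'n)" using dim by simp
  obtain x y where xy: "p = (x, y)" by fastforce
  have o: "(x, y) \<in> opair \<zeta>" using p xy by simp
  define h where "h c = c - (c \<bullet> \<zeta>) *\<^sub>R \<zeta>" for c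
  obtain w where w: "(x, w) \<in> opair \<zeta>" "(y, w) \<in> opair \<zeta>" using opair_frame[OF d o] .
  obtain d1 where d1: "0 < d1" "\<And>s. 0 < s \<Longrightarrow> s < d1 \<Longrightarrow> norm (circ (x, w) s - x) < e / 2"
    using circ_close[of "e / 2" "(x, w)"] e by auto
  obtain s1 where s1: "0 < s1" "s1 < d1" "\<And>c k. c \<in> h ` C \<Longrightarrow> c = k *\<^sub>R circ (x, w) s1 \<Longrightarrow> k = 0"
    using generic_direction[OF w(1) countable_image[OF C] d1(1)] by blast
  define x1 where "x1 = circ (x, w) s1"
  have "(y, x) \<in> opair \<zeta>" using o by (rule swap_in_opair)
  then have yx1: "(y, x1) \<in> opair \<zeta>" unfolding x1_def by (rule opair_snd_circ[OF _ w(2,1)])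
  then have o1: "(x1, y) \<in> opair \<zeta>" by (rule swap_in_opair)
  obtain w' where w': "(x1, w') \<in> opair \<zeta>" "(y, w') \<in> opair \<zeta>" using opair_frame[OF d o1] .
  obtain d2 where d2: "0 < d2" "\<And>s. 0 < s \<Longrightarrow> s < d2 \<Longrightarrow> norm (circ (y, w') s - y) < e / 2"
    using circ_close[of "e / 2" "(y, w')"] e by auto
  obtain s2 where s2: "0 < s2" "s2 < d2"
    "\<And>c k. c \<in> (\<lambda>c. h c - (h c \<bullet> x1) *\<^sub>R x1) ` C \<Longrightarrow> c = k *\<^sub>R circ (y, w') s2 \<Longrightarrow> k = 0"
    using generic_direction[OF w'(2) countable_image[OF C] d2(1)] by blast
  define y1 where "y1 = circ (y, w') s2"
  have o2: "(x1, y1) \<in> opair \<zeta>" unfolding y1_def by (rule opair_snd_circ[OF o1 w'])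
  show thesis
  proof (rule that[OF o2])
    have "dist (x1, y1) p \<le> norm (x1 - x) + norm (y1 - y)"
      using norm_Pair_le[of "x1 - x" "y1 - y"] by (simp add: xy dist_norm)
    also have "\<dots> < e / 2 + e / 2" unfolding x1_def y1_def using d1 d2 s1 s2 by (intro add_strict_mono) auto
    finally show "dist (x1, y1) p < e" by simp
    fix c assume c: "c \<in> C" "c \<in> pspan \<zeta> (x1, y1)"
    have "c = (c \<bullet> \<zeta>) *\<^sub>R \<zeta> + (c \<bullet> x1) *\<^sub>R x1 + (c \<bullet> y1) *\<^sub>R y1"
      using c(2) o2 z by (intro span3_expansion) (auto simp: opair_def)
    then have hc: "h c = (c \<bullet> x1) *\<^sub>R x1 + (c \<bullet> y1) *\<^sub>R y1" by (simp add: h_def algebra_simps)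
    have hx: "h c \<bullet> x1 = c \<bullet> x1" using o2 by (simp add: h_def inner_diff_left opair_def)
    have "h c - (h c \<bullet> x1) *\<^sub>R x1 = (c \<bullet> y1) *\<^sub>R y1" using hc hx by simp
    from s2(3)[OF imageI[OF c(1)] this[unfolded y1_def]] have 0: "c \<bullet> y1 = 0" by (simp add: y1_def)
    then have "h c = (c \<bullet> x1) *\<^sub>R x1" using hc by simp
    from s1(3)[OF imageI[OF c(1)] this[unfolded x1_def]] have "c \<bullet> x1 = 0" by (simp add: x1_def)
    then have "h c = 0" using hc 0 by simp
    then show "c = (c \<bullet> \<zeta>) *\<^sub>R \<zeta>" by (simp add: h_def)
  qed
qed

text \<open>For \<open>r > 0\<close> both arguments are \<open>r\<close> times points at which the
  values agree by assumption. The axis \<open>r = 0\<close> is the limit from the right.\<close>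

lemma homogeneous_extension:
  fixes f g :: "'a::euclidean_space \<Rightarrow> real"
  assumes cf: "continuous_on UNIV f" and cg: "continuous_on UNIV g"
    and hf: "\<And>r x. 0 < r \<Longrightarrow> f (r *\<^sub>R x) = r * f x" and hg: "\<And>r x. 0 < r \<Longrightarrow> g (r *\<^sub>R x) = r * g x"
    and eq: "\<And>t. f (v + t *\<^sub>R \<zeta>) = g (v' + (\<sigma> * t) *\<^sub>R \<zeta>)" and r: "0 \<le> r"
  shows "f (t *\<^sub>R \<zeta> + r *\<^sub>R v) = g ((\<sigma> * t) *\<^sub>R \<zeta> + r *\<^sub>R v')"
proof -
  have pos: "f (t *\<^sub>R \<zeta> + r *\<^sub>R v) = g ((\<sigma> * t) *\<^sub>R \<zeta> + r *\<^sub>R v')" if "0 < r" for r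
  proof -
    have "t *\<^sub>R \<zeta> + r *\<^sub>R v = r *\<^sub>R (v + (t / r) *\<^sub>R \<zeta>)"
      "(\<sigma> * t) *\<^sub>R \<zeta> + r *\<^sub>R v' = r *\<^sub>R (v' + (\<sigma> * (t / r)) *\<^sub>R \<zeta>)"
      using that by (simp_all add: scaleR_add_right add.commute)
    then show ?thesis using hf[OF that] hg[OF that] eq by simp
  qed
  define h where "h r = f (t *\<^sub>R \<zeta> + r *\<^sub>R v) - g ((\<sigma> * t) *\<^sub>R \<zeta> + r *\<^sub>R v')" for r
  have "continuous_on UNIV h" unfolding h_def
    by (intro continuous_intros continuous_on_compose2[OF cf] continuous_on_compose2[OF cg]) auto
  then have "(h \<longlongrightarrow> h 0) (at_right 0)"
    by (simp add: continuous_on_eq_continuous_at isCont_def filterlim_at_split)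
  moreover have "(h \<longlongrightarrow> 0) (at_right 0)"
    by (rule tendsto_eventually) (auto simp: eventually_at_right_field h_def pos intro!: exI[of _ 1])
  ultimately have "h 0 = 0" using tendsto_unique[OF trivial_limit_at_right_real] by blast
  then show ?thesis using pos[of r] r by (cases "r = 0") (auto simp: h_def)
qed

section \<open>Congruent projections\<close>

text \<open>Common ground for both bodies: all distances are at most \<open>2 * d\<close>, and this
  is attained parallel to \<zeta> about the midpoint \<open>m\<close>. For \<open>K\<close> it comes
  from the assumptions, for \<open>L\<close> it has to be derived.\<close>

definition diameter_body :: "real^'n \<Rightarrow> real \<Rightarrow> real^'n \<Rightarrow> (real^'n) set \<Rightarrow> bool" where
  "diameter_body \<zeta> d m K \<longleftrightarrow> compact K \<and> convex K \<and> m + d *\<^sub>R \<zeta> \<in> K \<and> m - d *\<^sub>R \<zeta> \<in> K \<and>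
     (\<forall>k\<in>K. \<forall>k'\<in>K. norm (k - k') \<le> 2 * d)"

text \<open>The support function of \<open>K\<close> translated by \<open>- m\<close>.\<close>

definition centered_support :: "(real^'n) set \<Rightarrow> real^'n \<Rightarrow> real^'n \<Rightarrow> real" where
  "centered_support K m x = support_fun K x - m \<bullet> x"

lemma diameter_bodyD:
  assumes "diameter_body \<zeta> d m K"
  shows "compact K" "convex K" "K \<noteq> {}" "m + d *\<^sub>R \<zeta> \<in> K" "m - d *\<^sub>R \<zeta> \<in> K"
    "\<And>k k'. k \<in> K \<Longrightarrow> k' \<in> K \<Longrightarrow> norm (k - k') \<le> 2 * d"
  using assms by (auto simp: diameter_body_def)

lemma continuous_centered_support:
  "diameter_body \<zeta> d m K \<Longrightarrow> continuous_on UNIV (centered_support K m)"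
  unfolding centered_support_def
  by (intro continuous_intros continuous_support_fun diameter_bodyD)

lemma centered_support_scale:
  assumes "diameter_body \<zeta> d m K" "0 < r"
  shows "centered_support K m (r *\<^sub>R x) = r * centered_support K m x"
proof -
  note K = diameter_bodyD(1,3)[OF assms(1)]
  obtain y where y: "y \<in> K" "support_fun K x = x \<bullet> y" using support_fun_attained[OF K] .
  have "support_fun K (r *\<^sub>R x) = r * (x \<bullet> y)"
    unfolding support_fun_def
  proof (rule cSup_eq_maximum)
    show "r * (x \<bullet> y) \<in> (\<bullet>) (r *\<^sub>R x) ` K" using y(1) by (intro image_eqI[of _ _ y]) auto
    fix z assume "z \<in> (\<bullet>) (r *\<^sub>R x) ` K"
    then obtain k where k: "k \<in> K" "z = (r *\<^sub>R x) \<bullet> k" by blast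
    have "x \<bullet> k \<le> x \<bullet> y" using support_fun_upper[OF K(1) k(1), of x] y(2) by simp
    then show "z \<le> r * (x \<bullet> y)" using k(2) assms(2) by simp
  qed
  then show ?thesis using y by (simp add: centered_support_def algebra_simps)
qed

lemma congruent_point:
  assumes "\<phi> ` orth_proj K H = (+) a ` orth_proj L H" "k \<in> K" "q \<in> H" "k - q \<in> H\<^sup>\<bottom>"
  shows "\<phi> q - a \<in> orth_proj L H"
proof -
  have "q \<in> orth_proj K H" using assms(2-4) by (auto simp: orth_proj_def)
  then have "\<phi> q \<in> (+) a ` orth_proj L H" using assms(1) by blast
  then show ?thesis by auto
qed

lemma congruent_point':
  assumes "\<phi> ` orth_proj K H = (+) a ` orth_proj L H" "l \<in> L" "q \<in> H" "l - q \<in> H\<^sup>\<bottom>"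
  obtains k p where "k \<in> K" "p \<in> H" "k - p \<in> H\<^sup>\<bottom>" "\<phi> p = a + q"
proof -
  have "q \<in> orth_proj L H" using assms(2-4) by (auto simp: orth_proj_def)
  then have "a + q \<in> \<phi> ` orth_proj K H" using assms(1) by blast
  then obtain p where "p \<in> orth_proj K H" "\<phi> p = a + q" by force
  then show thesis using that by (auto simp: orth_proj_def)
qed

text \<open>Choose the subspace to contain \<open>l - l'\<close> as well. Projection then preserves
  this distance, the congruence carries it to the projection of \<open>K\<close>, and projections do
  not increase distances.\<close>

lemma diameter_le_if_congruent:
  fixes K L :: "(real^'n) set"
  assumes dim: "4 \<le> CARD('n)" and z: "norm \<zeta> = 1" and K: "diameter_body \<zeta> d m K"
    and cong: "\<And>p. p \<in> opair \<zeta> \<Longrightarrow> directly_congruent (pspan \<zeta> p) (orth_proj K (pspan \<zeta> p)) (orth_proj L (pspan \<zeta> p))"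
    and l: "l \<in> L" "l' \<in> L"
  shows "norm (l - l') \<le> 2 * d"
proof -
  obtain p where p: "p \<in> opair \<zeta>" "l - l' \<in> pspan \<zeta> p" by (rule exists_pspan_containing[OF dim z])
  define H where "H = pspan \<zeta> p"
  have sH: "subspace H" by (simp add: H_def)
  obtain \<phi> a where \<phi>: "\<phi> \<in> SO_on H" "a \<in> H" "\<phi> ` orth_proj K H = (+) a ` orth_proj L H"
    using cong[OF p(1)] unfolding directly_congruent_def H_def by blast
  have \<phi>O: "\<phi> \<in> O_on H" using \<phi>(1) by (simp add: SO_on_def)
  obtain q where q: "q \<in> H" "l - q \<in> H\<^sup>\<bottom>" using orth_decomposition[OF sH] .
  obtain q' where q': "q' \<in> H" "l' - q' \<in> H\<^sup>\<bottom>" using orth_decomposition[OF sH] .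
  obtain k u where k: "k \<in> K" "u \<in> H" "k - u \<in> H\<^sup>\<bottom>" "\<phi> u = a + q" using congruent_point'[OF \<phi>(3) l(1) q] .
  obtain k' u' where k': "k' \<in> K" "u' \<in> H" "k' - u' \<in> H\<^sup>\<bottom>" "\<phi> u' = a + q'" using congruent_point'[OF \<phi>(3) l(2) q'] .
  have "(l - l') - (q - q') \<in> H" using p(2) q q' sH by (simp add: H_def subspace_diff)
  moreover have "(l - q) - (l' - q') \<in> H\<^sup>\<bottom>" by (rule subspace_diff[OF subspace_orthogonal_comp q(2) q'(2)])
  then have "(l - l') - (q - q') \<in> H\<^sup>\<bottom>" by (simp add: algebra_simps)
  ultimately have "(l - l') - (q - q') = 0" using inner_orth_comp by (metis inner_eq_zero_iff)
  then have "l - l' = \<phi> u - \<phi> u'" using k(4) k'(4) by simp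
  also have "\<dots> = \<phi> (u - u')" using O_onD(2)[OF \<phi>O] by (simp add: linear_diff)
  finally have "norm (l - l') = norm (u - u')" using orthogonal_transformation_norm[OF O_onD(1)[OF \<phi>O]] by simp
  also have "\<dots> \<le> norm (k - k')" using orth_proj_contraction[OF sH k(2) k'(2) k(3) k'(3)] .
  also have "\<dots> \<le> 2 * d" using diameter_bodyD(6)[OF K k(1) k'(1)] .
  finally show ?thesis .
qed

lemma congruent_diameter_points:
  fixes K L :: "(real^'n) set"
  assumes H: "subspace H" "\<zeta> \<in> H" and K: "diameter_body \<zeta> d m K"
    and \<phi>: "\<phi> \<in> O_on H" "\<phi> ` orth_proj K H = (+) a ` orth_proj L H"
    and q: "q \<in> H" "m - q \<in> H\<^sup>\<bottom>"
  shows "\<phi> q + d *\<^sub>R \<phi> \<zeta> - a \<in> orth_proj L H" "\<phi> q - d *\<^sub>R \<phi> \<zeta> - a \<in> orth_proj L H"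
proof -
  have "q + d *\<^sub>R \<zeta> \<in> H" "q - d *\<^sub>R \<zeta> \<in> H" using q(1) H by (simp_all add: subspace_add subspace_diff subspace_scale)
  moreover have "m + d *\<^sub>R \<zeta> - (q + d *\<^sub>R \<zeta>) \<in> H\<^sup>\<bottom>" "m - d *\<^sub>R \<zeta> - (q - d *\<^sub>R \<zeta>) \<in> H\<^sup>\<bottom>" using q(2) by simp_all
  ultimately have "\<phi> (q + d *\<^sub>R \<zeta>) - a \<in> orth_proj L H" "\<phi> (q - d *\<^sub>R \<zeta>) - a \<in> orth_proj L H"
    using congruent_point[OF \<phi>(2) diameter_bodyD(4)[OF K]] congruent_point[OF \<phi>(2) diameter_bodyD(5)[OF K]] by blast+
  then show "\<phi> q + d *\<^sub>R \<phi> \<zeta> - a \<in> orth_proj L H" "\<phi> q - d *\<^sub>R \<phi> \<zeta> - a \<in> orth_proj L H"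
    using O_onD(2)[OF \<phi>(1)] by (simp_all add: linear_add linear_diff linear_scale)
qed

text \<open>The end points of the diameter of \<open>K\<close> yield two points of the projection of
  \<open>L\<close> at distance \<open>2 * d\<close>. Points of \<open>L\<close> above them cannot be
  further apart, so by Pythagoras their difference lies in \<open>H\<close>.\<close>

lemma congruent_diameter_in_L:
  fixes K L :: "(real^'n) set"
  assumes H: "subspace H" "\<zeta> \<in> H" and z: "norm \<zeta> = 1" and K: "diameter_body \<zeta> d m K"
    and \<phi>: "\<phi> \<in> O_on H" "\<phi> ` orth_proj K H = (+) a ` orth_proj L H"
    and diam: "\<And>l l'. l \<in> L \<Longrightarrow> l' \<in> L \<Longrightarrow> norm (l - l') \<le> 2 * d"
  obtains l l' where "l \<in> L" "l' \<in> L" "l - l' = (2 * d) *\<^sub>R \<phi> \<zeta>"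
proof -
  obtain q where q: "q \<in> H" "m - q \<in> H\<^sup>\<bottom>" using orth_decomposition[OF H(1)] .
  obtain l l' where l: "l \<in> L" "l - (\<phi> q + d *\<^sub>R \<phi> \<zeta> - a) \<in> H\<^sup>\<bottom>"
    and l': "l' \<in> L" "l' - (\<phi> q - d *\<^sub>R \<phi> \<zeta> - a) \<in> H\<^sup>\<bottom>"
    using congruent_diameter_points[OF H K \<phi> q] by (auto simp: orth_proj_def)
  define u where "u = (l - (\<phi> q + d *\<^sub>R \<phi> \<zeta> - a)) - (l' - (\<phi> q - d *\<^sub>R \<phi> \<zeta> - a))"
  have u: "u \<in> H\<^sup>\<bottom>" unfolding u_def by (rule subspace_diff[OF subspace_orthogonal_comp l(2) l'(2)])
  have zH: "(2 * d) *\<^sub>R \<phi> \<zeta> \<in> H" using H O_on_maps[OF H(1) \<phi>(1)] by (simp add: subspace_scale)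
  have eq: "l - l' = (2 * d) *\<^sub>R \<phi> \<zeta> + u"
    by (simp add: u_def scaleR_2 flip: scaleR_scaleR)
  have nz: "norm (\<phi> \<zeta>) = 1" using orthogonal_transformation_norm[OF O_onD(1)[OF \<phi>(1)]] z by simp
  have "(norm ((2 * d) *\<^sub>R \<phi> \<zeta>))\<^sup>2 + (norm u)\<^sup>2 = (norm (l - l'))\<^sup>2"
    using pythagoras_orth_comp[OF zH u] eq by simp
  also have "\<dots> \<le> (2 * d)\<^sup>2" using diam[OF l(1) l'(1)] by (intro power_mono) auto
  also have "\<dots> = (norm ((2 * d) *\<^sub>R \<phi> \<zeta>))\<^sup>2" using nz by (simp add: power_mult_distrib)
  finally have "u = 0" by simp
  then show thesis using that[OF l(1) l'(1)] eq by simp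
qed

lemma diameter_direction_maximal:
  fixes L :: "(real^'n) set"
  assumes L: "compact L" "L \<noteq> {}" and \<theta>: "norm \<theta> = 1"
    and l: "l \<in> L" "l' \<in> L" "l - l' = (2 * d) *\<^sub>R \<theta>"
    and diam: "\<And>l l'. l \<in> L \<Longrightarrow> l' \<in> L \<Longrightarrow> norm (l - l') \<le> 2 * d"
  shows "\<theta> \<in> max_width_directions L"
proof -
  have "width_fun L \<theta>' \<le> 2 * d" if \<theta>': "\<theta>' \<in> sphere 0 1" for \<theta>'
  proof -
    obtain y where y: "y \<in> L" "support_fun L \<theta>' = \<theta>' \<bullet> y" using support_fun_attained[OF L] .
    obtain y' where y': "y' \<in> L" "support_fun L (- \<theta>') = - \<theta>' \<bullet> y'" using support_fun_attained[OF L] .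
    have "width_fun L \<theta>' = \<theta>' \<bullet> (y - y')" by (simp add: width_fun_def y y' inner_diff_right)
    also have "\<dots> \<le> norm \<theta>' * norm (y - y')" by (rule norm_cauchy_schwarz)
    also have "\<dots> \<le> 2 * d" using \<theta>' diam[OF y(1) y'(1)] by simp
    finally show ?thesis .
  qed
  moreover have "2 * d \<le> width_fun L \<theta>"
  proof -
    have "2 * d = \<theta> \<bullet> (l - l')" using \<theta> l(3) by (simp add: norm_eq_1)
    also have "\<dots> = \<theta> \<bullet> l + (- \<theta>) \<bullet> l'" by (simp add: inner_diff_right)
    also have "\<dots> \<le> width_fun L \<theta>" unfolding width_fun_def by (intro add_mono support_fun_upper L l)
    finally show ?thesis .
  qed
  ultimately show ?thesis using \<theta> by (fastforce simp: max_width_directions_def)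
qed

lemma centered_support_congruent:
  fixes K L :: "(real^'n) set"
  assumes H: "subspace H" "\<zeta> \<in> H" and z: "norm \<zeta> = 1"
    and K: "diameter_body \<zeta> d m K" and L: "diameter_body \<zeta> d m' L"
    and \<phi>: "\<phi> \<in> O_on H" "\<phi> ` orth_proj K H = (+) a ` orth_proj L H" and a: "a \<in> H"
    and \<sigma>: "\<phi> \<zeta> = \<zeta> \<or> \<phi> \<zeta> = - \<zeta>" and x: "x \<in> H"
  shows "centered_support K m x = centered_support L m' (\<phi> x)"
proof -
  obtain q where q: "q \<in> H" "m - q \<in> H\<^sup>\<bottom>" using orth_decomposition[OF H(1)] .
  obtain q' where q': "q' \<in> H" "m' - q' \<in> H\<^sup>\<bottom>" using orth_decomposition[OF H(1)] .
  \<comment> \<open>The translation that remains once both bodies are centred. Since the congruence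
    maps \<zeta> to itself or its negative, it sends the end points over end points, and contact
    forces \<open>b = 0\<close>.\<close>
  define b where "b = a - \<phi> q + q'"
  have \<phi>q: "\<phi> q \<in> H" using O_on_maps[OF H(1) \<phi>(1)] q(1) by simp
  have b: "b \<in> H" unfolding b_def using a \<phi>q q'(1) H(1) by (simp add: subspace_add subspace_diff)
  have "q' + d *\<^sub>R \<zeta> - b \<in> orth_proj L H \<and> q' - d *\<^sub>R \<zeta> - b \<in> orth_proj L H"
    using congruent_diameter_points[OF H K \<phi> q] \<sigma> by (auto simp: b_def algebra_simps)
  then have "b = 0"
    using contact_points_unique[OF H z diameter_bodyD(4,5)[OF L] diameter_bodyD(6)[OF L] q' b] by blast
  then have a_eq: "a = \<phi> q - q'" by (simp add: b_def algebra_simps)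
  have \<phi>x: "\<phi> x \<in> H" using O_on_maps[OF H(1) \<phi>(1)] x by simp
  have "support_fun K x = \<phi> x \<bullet> a + support_fun L (\<phi> x)"
    using congruent_orth_proj_iff[OF H(1) diameter_bodyD(1-3)[OF K] diameter_bodyD(1-3)[OF L] \<phi>(1) a] \<phi>(2) x by blast
  moreover have "\<phi> x \<bullet> a = x \<bullet> q - \<phi> x \<bullet> q'" by (simp add: a_eq inner_diff_right O_onD(4)[OF \<phi>(1)])
  moreover have "x \<bullet> q = m \<bullet> x" "\<phi> x \<bullet> q' = m' \<bullet> \<phi> x"
    using inner_orth_proj[OF x q(2)] inner_orth_proj[OF \<phi>x q'(2)] by (simp_all add: inner_commute)
  ultimately show ?thesis by (simp add: centered_support_def)
qed

text \<open>The two signs are the two kinds of rotations of the 3-dimensional space preserving the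
  axis line: turning the circle with the axis fixed, or reflecting the circle and reversing the
  axis.\<close>

definition circle_isometric ::
  "'a::euclidean_space \<Rightarrow> real \<Rightarrow> ('a \<Rightarrow> real) \<Rightarrow> ('a \<Rightarrow> real) \<Rightarrow> 'a \<times> 'a \<Rightarrow> bool" where
  "circle_isometric \<zeta> \<sigma> f g p \<longleftrightarrow>
     (\<exists>c. \<forall>s t. f (circ p s + t *\<^sub>R \<zeta>) = g (circ p (c + \<sigma> * s) + (\<sigma> * t) *\<^sub>R \<zeta>))"

lemma circle_alternative:
  fixes K L :: "(real^'n) set"
  assumes z: "norm \<zeta> = 1" and p: "p \<in> opair \<zeta>"
    and K: "diameter_body \<zeta> d m K" and L: "diameter_body \<zeta> d m' L"
    and \<phi>: "\<phi> \<in> SO_on (pspan \<zeta> p)" "\<phi> ` orth_proj K (pspan \<zeta> p) = (+) a ` orth_proj L (pspan \<zeta> p)"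
    and a: "a \<in> pspan \<zeta> p" and \<sigma>: "\<phi> \<zeta> = \<zeta> \<or> \<phi> \<zeta> = - \<zeta>"
  shows "circle_isometric \<zeta> 1 (centered_support K m) (centered_support L m') p \<or>
    circle_isometric \<zeta> (- 1) (centered_support K m) (centered_support L m') p"
proof -
  have O: "\<phi> \<in> O_on (pspan \<zeta> p)" using \<phi>(1) by (simp add: SO_on_def)
  note lin = O_onD(2)[OF O]
  have eq: "centered_support K m (circ p s + t *\<^sub>R \<zeta>) = centered_support L m' (\<phi> (circ p s) + t *\<^sub>R \<phi> \<zeta>)" for s t
  proof -
    have "circ p s + t *\<^sub>R \<zeta> \<in> pspan \<zeta> p" by (intro span_add span_scale circ_in_pspan zeta_in_pspan)
    from centered_support_congruent[OF subspace_span zeta_in_pspan z K L O \<phi>(2) a \<sigma> this]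
    show ?thesis using lin by (simp add: linear_add linear_scale)
  qed
  from \<sigma> show ?thesis
  proof
    assume f: "\<phi> \<zeta> = \<zeta>"
    obtain c where "\<And>s. \<phi> (circ p s) = circ p (s + c)" 
      using SO_on_pspan_rotation[OF z p \<phi>(1) f] by blast
    then show ?thesis using eq f by (auto simp: circle_isometric_def add.commute)
  next
    assume f: "\<phi> \<zeta> = - \<zeta>"
    obtain c where "\<And>s. \<phi> (circ p s) = circ p (c - s)" 
      using SO_on_pspan_reflection[OF z p \<phi>(1) f] by blast
    then show ?thesis using eq f by (auto simp: circle_isometric_def)
  qed
qed

lemma pi_symmetry_zeta_if:
  fixes K :: "(real^'n) set"
  assumes z: "norm \<zeta> = 1" and p: "p \<in> opair \<zeta>" and K: "diameter_body \<zeta> d m K"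
    and sym: "\<And>s t. centered_support K m (circ p (s + pi) + t *\<^sub>R \<zeta>) = centered_support K m (circ p s + t *\<^sub>R \<zeta>)"
  shows "pi_symmetry (pspan \<zeta> p) \<zeta> (orth_proj K (pspan \<zeta> p))"
proof (rule pi_symmetry_if_support_fun[OF diameter_bodyD(1-3)[OF K] z])
  let ?R = "reflect (fst p) \<circ> reflect (snd p)"
  fix x assume x: "x \<in> pspan \<zeta> p"
  obtain r s where e: "x = (x \<bullet> \<zeta>) *\<^sub>R \<zeta> + r *\<^sub>R circ p s" and r: "0 \<le> r"
    using pspan_circ_expansion[OF z p x] by metis
  define t where "t = x \<bullet> \<zeta>"
  have x': "x = t *\<^sub>R \<zeta> + r *\<^sub>R circ p s" using e by (simp add: t_def)
  have fs: "fst p = circ p 0" "snd p = circ p (pi / 2)" by (simp_all add: circ_def)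
  have "?R (circ p s) = circ p (s + pi)"
    unfolding fs comp_def reflect_circ[OF p] linear_neg[OF linear_reflect]
    using circ_add_2pi[of p "s - pi" 1] by (simp add: algebra_simps)
  moreover have "fst p \<bullet> \<zeta> = 0" "snd p \<bullet> \<zeta> = 0" using p by (auto simp: opair_iff inner_commute)
  then have "?R \<zeta> = \<zeta>" by (simp add: reflect_fixes)
  moreover have "linear ?R" by (intro linear_compose linear_reflect)
  ultimately have Rx: "?R x = (1 * t) *\<^sub>R \<zeta> + r *\<^sub>R circ p (s + pi)"
    unfolding x' by (simp only: linear_add linear_scale mult_1)
  have "centered_support K m (t *\<^sub>R \<zeta> + r *\<^sub>R circ p s) = centered_support K m ((1 * t) *\<^sub>R \<zeta> + r *\<^sub>R circ p (s + pi))"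
    using sym by (intro homogeneous_extension[OF continuous_centered_support[OF K] continuous_centered_support[OF K]
      centered_support_scale[OF K] centered_support_scale[OF K]] r) simp_all
  then have "centered_support K m x = centered_support K m (?R x)" by (simp only: Rx x'[symmetric])
  then show "support_fun K x - m \<bullet> x = support_fun K (?R x) - m \<bullet> ?R x"
    by (simp only: centered_support_def)
qed (use p in \<open>auto simp: opair_iff\<close>)

text \<open>A half turn about a vector of the circle reflects the circle in that vector and reverses
  the axis; it is the product of the reflections in \<zeta> and in the circle vector a quarter turn
  away.\<close>

lemma pi_symmetry_perp_if:
  fixes K :: "(real^'n) set"
  assumes z: "norm \<zeta> = 1" and p: "p \<in> opair \<zeta>" and K: "diameter_body \<zeta> d m K"
    and sym: "\<And>s t. centered_support K m (circ p s + t *\<^sub>R \<zeta>) = centered_support K m (circ p (2 * \<beta> - s) + (- t) *\<^sub>R \<zeta>)"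
  shows "pi_symmetry (pspan \<zeta> p) (circ p \<beta>) (orth_proj K (pspan \<zeta> p))"
proof (rule pi_symmetry_if_support_fun[OF diameter_bodyD(1-3)[OF K]])
  let ?v = "circ p (\<beta> + pi / 2)"
  let ?R = "reflect \<zeta> \<circ> reflect ?v"
  have rot: "rot p \<beta> \<in> opair \<zeta>" using p by simp
  show n: "norm (circ p \<beta>) = 1" "norm \<zeta> = 1" "norm ?v = 1" using z norm_circ[OF p] by simp_all
  show o: "circ p \<beta> \<bullet> \<zeta> = 0" "\<zeta> \<bullet> ?v = 0" using inner_circ[OF p] by (simp_all add: inner_commute)
  show cv: "circ p \<beta> \<bullet> ?v = 0" using rot by (simp add: opair_iff rot_def)
  show "pspan \<zeta> p = span {circ p \<beta>, \<zeta>, ?v}"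
  proof (rule antisym)
    have "circ (rot p \<beta>) s \<in> span {circ p \<beta>, \<zeta>, ?v}" for s
      unfolding circ_def rot_def by (intro span_add span_scale span_base) auto
    from this[of "- \<beta>"] this[of "pi / 2 - \<beta>"] have "fst p \<in> span {circ p \<beta>, \<zeta>, ?v}" "snd p \<in> span {circ p \<beta>, \<zeta>, ?v}"
      by (simp_all add: circ_def[of p "pi / 2"])
    then show "pspan \<zeta> p \<subseteq> span {circ p \<beta>, \<zeta>, ?v}"
      by (intro span_minimal subspace_span) (auto simp: span_base)
    show "span {circ p \<beta>, \<zeta>, ?v} \<subseteq> pspan \<zeta> p"
      by (intro span_minimal subspace_span) (auto simp: span_base circ_in_pspan)
  qed
  fix x assume x: "x \<in> pspan \<zeta> p"
  obtain r s where e: "x = (x \<bullet> \<zeta>) *\<^sub>R \<zeta> + r *\<^sub>R circ p s" and r: "0 \<le> r"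
    using pspan_circ_expansion[OF z p x] by metis
  define t where "t = x \<bullet> \<zeta>"
  have x': "x = t *\<^sub>R \<zeta> + r *\<^sub>R circ p s" using e by (simp add: t_def)
  have "reflect ?v (circ p s) = circ p (2 * \<beta> - s)"
    unfolding reflect_circ[OF p] using circ_add_pi[of p "2 * \<beta> - s"] by (simp add: algebra_simps)
  then have "?R (circ p s) = circ p (2 * \<beta> - s)" using inner_circ[OF p] by (simp add: reflect_fixes)
  moreover have "?v \<bullet> \<zeta> = 0" using o(2) by (simp add: inner_commute)
  then have "?R \<zeta> = - \<zeta>" using z by (simp add: reflect_fixes reflect_self)
  moreover have "linear ?R" by (intro linear_compose linear_reflect)
  ultimately have Rx: "?R x = (- 1 * t) *\<^sub>R \<zeta> + r *\<^sub>R circ p (2 * \<beta> - s)"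
    unfolding x' by (simp only: linear_add linear_scale) simp
  have "centered_support K m (t *\<^sub>R \<zeta> + r *\<^sub>R circ p s) = centered_support K m ((- 1 * t) *\<^sub>R \<zeta> + r *\<^sub>R circ p (2 * \<beta> - s))"
    using sym by (intro homogeneous_extension[OF continuous_centered_support[OF K] continuous_centered_support[OF K]
      centered_support_scale[OF K] centered_support_scale[OF K]] r) simp_all
  then have "centered_support K m x = centered_support K m (?R x)" by (simp only: Rx x'[symmetric])
  then show "support_fun K x - m \<bullet> x = support_fun K (?R x) - m \<bullet> ?R x"
    by (simp only: centered_support_def)
qed

text \<open>On a dense set of circles the only directions of maximal width of \<open>L\<close> are
  parallel to \<zeta>, so the congruence preserves the axis there. Both alternatives are closed,
  hence so is their union, and it is everything.\<close>

lemma all_circles_alternative: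
  fixes K L :: "(real^'n) set"
  assumes dim: "4 \<le> CARD('n)" and z: "norm \<zeta> = 1"
    and K: "diameter_body \<zeta> d m K" and L: "compact L" "convex L" "L \<noteq> {}" and d: "0 < d"
    and countable: "countable (max_width_directions L)"
    and cong: "\<And>p. p \<in> opair \<zeta> \<Longrightarrow> directly_congruent (pspan \<zeta> p) (orth_proj K (pspan \<zeta> p)) (orth_proj L (pspan \<zeta> p))"
  obtains m' where "diameter_body \<zeta> d m' L"
    "\<And>p. p \<in> opair \<zeta> \<Longrightarrow>
      circle_isometric \<zeta> 1 (centered_support K m) (centered_support L m') p \<or>
      circle_isometric \<zeta> (- 1) (centered_support K m) (centered_support L m') p"
proof -
  have diam: "norm (l - l') \<le> 2 * d" if "l \<in> L" "l' \<in> L" for l l'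
    by (rule diameter_le_if_congruent[OF dim z K cong that])
  define good where "good p \<longleftrightarrow> p \<in> opair \<zeta> \<and> (\<forall>c \<in> max_width_directions L. c \<in> pspan \<zeta> p \<longrightarrow> c = (c \<bullet> \<zeta>) *\<^sub>R \<zeta>)" for p
  have good: "\<exists>\<phi> a. \<phi> \<in> SO_on (pspan \<zeta> p) \<and> a \<in> pspan \<zeta> p \<and>
      \<phi> ` orth_proj K (pspan \<zeta> p) = (+) a ` orth_proj L (pspan \<zeta> p) \<and> (\<phi> \<zeta> = \<zeta> \<or> \<phi> \<zeta> = - \<zeta>)"
    if g: "good p" for p
  proof -
    have p: "p \<in> opair \<zeta>" using g by (simp add: good_def)
    obtain \<phi> a where \<phi>: "\<phi> \<in> SO_on (pspan \<zeta> p)" "a \<in> pspan \<zeta> p" "\<phi> ` orth_proj K (pspan \<zeta> p) = (+) a ` orth_proj L (pspan \<zeta> p)"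
      using cong[OF p] unfolding directly_congruent_def by blast
    have O: "\<phi> \<in> O_on (pspan \<zeta> p)" using \<phi>(1) by (simp add: SO_on_def)
    obtain l l' where l: "l \<in> L" "l' \<in> L" "l - l' = (2 * d) *\<^sub>R \<phi> \<zeta>"
      by (rule congruent_diameter_in_L[OF subspace_span zeta_in_pspan z K O \<phi>(3) diam])
    have n: "norm (\<phi> \<zeta>) = 1" using orthogonal_transformation_norm[OF O_onD(1)[OF O]] z by simp
    have "\<phi> \<zeta> \<in> max_width_directions L" by (rule diameter_direction_maximal[OF L(1,3) n l diam])
    moreover have "\<phi> \<zeta> \<in> pspan \<zeta> p" using O_on_maps[OF subspace_span O] zeta_in_pspan by blast
    ultimately have e: "\<phi> \<zeta> = (\<phi> \<zeta> \<bullet> \<zeta>) *\<^sub>R \<zeta>" using g by (auto simp: good_def)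
    then have "norm (\<phi> \<zeta>) = \<bar>\<phi> \<zeta> \<bullet> \<zeta>\<bar> * norm \<zeta>" by (metis norm_scaleR)
    then have "\<phi> \<zeta> \<bullet> \<zeta> = 1 \<or> \<phi> \<zeta> \<bullet> \<zeta> = - 1" using n z by (auto simp: abs_if split: if_splits)
    then have "\<phi> \<zeta> = \<zeta> \<or> \<phi> \<zeta> = - \<zeta>" using e by (metis scaleR_minus1_left scaleR_one)
    with \<phi> show ?thesis by blast
  qed
  have dense: "\<exists>p'. good p' \<and> dist p' p < e" if p: "p \<in> opair \<zeta>" and e: "0 < e" for p e
  proof (rule generic_opair_dense[OF dim z countable p e])
    fix p' assume p': "p' \<in> opair \<zeta>" "dist p' p < e"
      and "\<And>c. c \<in> max_width_directions L \<Longrightarrow> c \<in> pspan \<zeta> p' \<Longrightarrow> c = (c \<bullet> \<zeta>) *\<^sub>R \<zeta>"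
    then have "good p'" unfolding good_def by blast
    then show ?thesis using p'(2) by blast
  qed
  obtain p0 where p0: "p0 \<in> opair \<zeta>" by (rule exists_pspan_containing[OF dim z])
  obtain p1 where p1: "good p1" using dense[OF p0, of 1] by auto
  obtain \<phi> a where \<phi>: "\<phi> \<in> SO_on (pspan \<zeta> p1)" "a \<in> pspan \<zeta> p1"
    "\<phi> ` orth_proj K (pspan \<zeta> p1) = (+) a ` orth_proj L (pspan \<zeta> p1)" "\<phi> \<zeta> = \<zeta> \<or> \<phi> \<zeta> = - \<zeta>"
    using good[OF p1] by blast
  have O: "\<phi> \<in> O_on (pspan \<zeta> p1)" using \<phi>(1) by (simp add: SO_on_def)
  obtain l l' where l: "l \<in> L" "l' \<in> L" "l - l' = (2 * d) *\<^sub>R \<phi> \<zeta>"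
    by (rule congruent_diameter_in_L[OF subspace_span zeta_in_pspan z K O \<phi>(3) diam])
  \<comment> \<open>One generic circle already produces a diameter of \<open>L\<close> parallel to
    \<zeta>. Its midpoint is then used as the centre for all circles.\<close>
  define m' where "m' = (1/2) *\<^sub>R (l + l')"
  have "d *\<^sub>R \<phi> \<zeta> = (1/2) *\<^sub>R (l - l')" using l(3) by simp
  then have "m' + d *\<^sub>R \<phi> \<zeta> = l" "m' - d *\<^sub>R \<phi> \<zeta> = l'"
    by (simp_all add: m'_def scaleR_add_right scaleR_diff_right flip: scaleR_add_left)
  then have "m' + d *\<^sub>R \<zeta> \<in> L \<and> m' - d *\<^sub>R \<zeta> \<in> L" using l(1,2) \<phi>(4) by auto
  then have DL: "diameter_body \<zeta> d m' L" using L diam by (simp add: diameter_body_def)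
  define F G where "F t v = centered_support K m (v + t *\<^sub>R \<zeta>)" and "G t v = centered_support L m' (v + t *\<^sub>R \<zeta>)" for t v
  have cF: "continuous_on UNIV (F t)" and cG: "continuous_on UNIV (G t)" for t
    unfolding F_def G_def
    by (intro continuous_on_compose2[OF continuous_centered_support[OF K]]
      continuous_on_compose2[OF continuous_centered_support[OF DL]] continuous_intros; simp)+
  define A B where "A = {p \<in> opair \<zeta>. \<exists>c. \<forall>s t. F t (circ p s) = G t (circ p (c + 1 * s))}"
    and "B = {p \<in> opair \<zeta>. \<exists>c. \<forall>s t. F t (circ p s) = G (- t) (circ p (c + (- 1) * s))}"
  have "closed A" unfolding A_def by (rule closed_circle_isometric[OF cF cG])
  moreover have "closed B" unfolding B_def by (rule closed_circle_isometric[OF cF cG])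
  ultimately have cl: "closed (A \<union> B)" by (rule closed_Un)
  have gAB: "p \<in> A \<union> B" if g: "good p" for p
  proof -
    have p: "p \<in> opair \<zeta>" using g by (simp add: good_def)
    obtain \<phi> a where \<phi>: "\<phi> \<in> SO_on (pspan \<zeta> p)" "a \<in> pspan \<zeta> p"
      "\<phi> ` orth_proj K (pspan \<zeta> p) = (+) a ` orth_proj L (pspan \<zeta> p)" "\<phi> \<zeta> = \<zeta> \<or> \<phi> \<zeta> = - \<zeta>"
      using good[OF g] by blast
    from circle_alternative[OF z p K DL \<phi>(1,3,2,4)] show ?thesis using p by (simp add: A_def B_def F_def G_def circle_isometric_def)
  qed
  have "p \<in> A \<union> B" if p: "p \<in> opair \<zeta>" for p
  proof -
    have "p \<in> closure (A \<union> B)" unfolding closure_approachable using dense[OF p] gAB by blast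
    then show ?thesis unfolding closure_closed[OF cl] .
  qed
  then show thesis by (intro that[OF DL]) (auto simp: A_def B_def F_def G_def circle_isometric_def)
qed

lemma opair_pspan_basis:
  "p \<in> opair \<zeta> \<Longrightarrow> circ p \<beta> \<in> {\<zeta>}\<^sup>\<bottom> \<inter> pspan \<zeta> p \<inter> sphere 0 1" for \<zeta> :: "real^'n"
  by (auto simp: circ_in_pspan orthogonal_comp_def orthogonal_def)

lemma eq_translation_if_support_fun:
  fixes K L :: "(real^'n) set"
  assumes "compact K" "convex K" "K \<noteq> {}" "compact L" "convex L" "L \<noteq> {}"
    and "\<And>x. support_fun K x = x \<bullet> b + support_fun L x"
  shows "K = (+) b ` L"
  using assms by (intro support_fun_eq_imp_eq)
    (auto intro: compact_translation convex_translation simp: support_fun_translation)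

lemma bodies_determined:
  fixes K L :: "(real^'n) set"
  assumes dim: "4 \<le> CARD('n)" and z: "norm \<zeta> = 1"
    and K: "diameter_body \<zeta> d m K" and L: "compact L" "convex L" "L \<noteq> {}" and d: "0 < d"
    and countable: "countable (max_width_directions L)"
    and cong: "\<And>p. p \<in> opair \<zeta> \<Longrightarrow> directly_congruent (pspan \<zeta> p) (orth_proj K (pspan \<zeta> p)) (orth_proj L (pspan \<zeta> p))"
    and nosym: "\<And>p. p \<in> opair \<zeta> \<Longrightarrow> \<not> pi_symmetry (pspan \<zeta> p) \<zeta> (orth_proj K (pspan \<zeta> p))"
    and nosym_perp: "\<And>p u. p \<in> opair \<zeta> \<Longrightarrow> u \<in> {\<zeta>}\<^sup>\<bottom> \<inter> pspan \<zeta> p \<inter> sphere 0 1 \<Longrightarrow>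
      \<not> pi_symmetry (pspan \<zeta> p) u (orth_proj K (pspan \<zeta> p))"
  shows "(\<exists>b. K = (+) b ` L) \<or> (\<exists>b. K = (+) b ` (O_zeta \<zeta> ` L))"
proof -
  have dim': "4 \<le> DIM(real^'n)" using dim by simp
  obtain m' where DL: "diameter_body \<zeta> d m' L" and alt: "\<And>p. p \<in> opair \<zeta> \<Longrightarrow>
      circle_isometric \<zeta> 1 (centered_support K m) (centered_support L m') p \<or>
      circle_isometric \<zeta> (- 1) (centered_support K m) (centered_support L m') p"
    using all_circles_alternative[OF dim z K L d countable cong] by blast
  define F G where "F t v = centered_support K m (v + t *\<^sub>R \<zeta>)" and "G t v = centered_support L m' (v + t *\<^sub>R \<zeta>)" for t v
  have cF: "continuous_on UNIV (F t)" and cG: "continuous_on UNIV (G t)" for t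
    unfolding F_def G_def
    by (intro continuous_on_compose2[OF continuous_centered_support[OF K]]
      continuous_on_compose2[OF continuous_centered_support[OF DL]] continuous_intros; simp)+
  have nopi: "\<not> (\<forall>s t. F t (circ p (s + pi)) = F t (circ p s))" if p: "p \<in> opair \<zeta>" for p
  proof
    assume "\<forall>s t. F t (circ p (s + pi)) = F t (circ p s)"
    then have "pi_symmetry (pspan \<zeta> p) \<zeta> (orth_proj K (pspan \<zeta> p))"
      by (intro pi_symmetry_zeta_if[OF z p K]) (simp only: F_def)
    then show False using nosym[OF p] by blast
  qed
  obtain p0 where p0: "p0 \<in> opair \<zeta>" by (rule exists_pspan_containing[OF dim z])
  have swap: "circ (y, x) s = circ (x, y) (pi / 2 - s)" for x y :: "real^'n" and s
    by (simp add: circ_def cos_diff sin_diff)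
  have "(\<forall>p\<in>opair \<zeta>. \<exists>c. \<forall>s t. F t (circ p s) = G t (circ p (c + 1 * s))) \<or>
      (\<forall>p\<in>opair \<zeta>. \<exists>c. \<forall>s t. F t (circ p s) = G (- t) (circ p (c + (- 1) * s)))"
  proof (rule opair_connected[OF dim'])
    show "closed {p \<in> opair \<zeta>. \<exists>c. \<forall>s t. F t (circ p s) = G t (circ p (c + 1 * s))}"
      "closed {p \<in> opair \<zeta>. \<exists>c. \<forall>s t. F t (circ p s) = G (- t) (circ p (c + (- 1) * s))}"
      by (rule closed_circle_isometric[OF cF cG])+
    show "(\<exists>c. \<forall>s t. F t (circ p s) = G t (circ p (c + 1 * s))) \<or>
      (\<exists>c. \<forall>s t. F t (circ p s) = G (- t) (circ p (c + (- 1) * s)))" if "p \<in> opair \<zeta>" for p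
      using alt[OF that] by (simp only: F_def G_def circle_isometric_def mult_1 mult_minus1)
    show "\<not> ((\<exists>c. \<forall>s t. F t (circ p s) = G t (circ p (c + 1 * s))) \<and>
      (\<exists>c. \<forall>s t. F t (circ p s) = G (- t) (circ p (c + (- 1) * s))))" if p: "p \<in> opair \<zeta>" for p
    proof
      assume "(\<exists>c. \<forall>s t. F t (circ p s) = G t (circ p (c + 1 * s))) \<and>
        (\<exists>c. \<forall>s t. F t (circ p s) = G (- t) (circ p (c + (- 1) * s)))"
      then obtain a c where a: "\<And>s t. F t (circ p s) = G t (circ p (a + 1 * s))"
        and c: "\<And>s t. F t (circ p s) = G (- t) (circ p (c + (- 1) * s))" by blast
      \<comment> \<open>Eliminating \<open>G\<close> between the rotation by \<open>a\<close> and
        the reflection with constant \<open>c\<close> leaves a symmetry of \<open>F\<close> alone: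
        the half turn about the circle vector at the angle \<open>(c - a) / 2\<close>.\<close>
      have "F t (circ p s) = F (- t) (circ p (2 * ((c - a) / 2) - s))" for s t
      proof -
        have "a + 1 * (2 * ((c - a) / 2) - s) = c + (- 1) * s" by (simp add: field_simps)
        then show ?thesis using c[of t s] a[of "- t" "2 * ((c - a) / 2) - s"] by (simp only:)
      qed
      then have "pi_symmetry (pspan \<zeta> p) (circ p ((c - a) / 2)) (orth_proj K (pspan \<zeta> p))"
        by (intro pi_symmetry_perp_if[OF z p K]) (simp only: F_def)
      then show False using nosym_perp[OF p opair_pspan_basis[OF p]] by blast
    qed
    show "\<exists>c. \<forall>s t. F t (circ (y, x) s) = G t (circ (y, x) (c + 1 * s))"
      if ex: "\<exists>c. \<forall>s t. F t (circ (x, y) s) = G t (circ (x, y) (c + 1 * s))" for x y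
    proof -
      obtain c where c: "\<And>s t. F t (circ (x, y) s) = G t (circ (x, y) (c + 1 * s))" using ex by blast
      have "F t (circ (y, x) s) = G t (circ (y, x) (- c + 1 * s))" for s t
        using c[of t "pi / 2 - s"] by (simp add: swap[of y x] algebra_simps)
      then show ?thesis by blast
    qed
  qed
  then have rots: "\<exists>c. \<forall>s t. F t (circ p s) = G t (circ p (s + c))" if p: "p \<in> opair \<zeta>" for p
  proof (elim disjE)
    assume "\<forall>p\<in>opair \<zeta>. \<exists>c. \<forall>s t. F t (circ p s) = G t (circ p (c + 1 * s))"
    then show ?thesis using p by (simp add: add.commute)
  next
    assume "\<forall>p\<in>opair \<zeta>. \<exists>c. \<forall>s t. F t (circ p s) = G (- t) (circ p (c + (- 1) * s))"
    then have refls: "\<exists>c. \<forall>s t. F t (circ p s) = G (- t) (circ p (c - s))" if "p \<in> opair \<zeta>" for p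
      using that by simp
    \<comment> \<open>This alternative is contradictory. Replacing \<open>G t\<close> by
      \<open>G (- t)\<close> absorbs the reversal of the axis.\<close>
    show ?thesis
      using no_reflections_on_all_circles[where F = F and G = "\<lambda>t. G (- t)", OF dim' p0 cF cG nopi refls]
      by blast
  qed
  note KL = continuous_centered_support[OF K] continuous_centered_support[OF DL]
    centered_support_scale[OF K] centered_support_scale[OF DL]
  note bodies = diameter_bodyD(1-3)[OF K] L
  have "(\<forall>v t. norm v = 1 \<longrightarrow> \<zeta> \<bullet> v = 0 \<longrightarrow> F t v = G t v) \<or>
    (\<forall>v t. norm v = 1 \<longrightarrow> \<zeta> \<bullet> v = 0 \<longrightarrow> F t v = G t (- v))"
    by (rule rotations_on_all_circles[where F = F and G = G, OF dim' cF cG nopi rots])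
  then show ?thesis
  proof (rule disjE)
    assume eq: "\<forall>v t. norm v = 1 \<longrightarrow> \<zeta> \<bullet> v = 0 \<longrightarrow> F t v = G t v"
    have "support_fun K x = x \<bullet> (m - m') + support_fun L x" for x
    proof -
      obtain r v where v: "norm v = 1" "\<zeta> \<bullet> v = 0" "0 \<le> r" and x: "x = (x \<bullet> \<zeta>) *\<^sub>R \<zeta> + r *\<^sub>R v"
        by (rule unit_decomposition[OF dim' z])
      have "centered_support K m ((x \<bullet> \<zeta>) *\<^sub>R \<zeta> + r *\<^sub>R v) = centered_support L m' ((1 * (x \<bullet> \<zeta>)) *\<^sub>R \<zeta> + r *\<^sub>R v)"
        by (rule homogeneous_extension[OF KL _ v(3)]) (use eq v(1,2) in \<open>simp_all add: F_def G_def\<close>)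
      then have "centered_support K m x = centered_support L m' x" using x by simp
      then show ?thesis by (simp add: centered_support_def inner_diff_right inner_commute)
    qed
    then have "K = (+) (m - m') ` L" by (rule eq_translation_if_support_fun[OF bodies])
    then show ?thesis by blast
  next
    assume eq: "\<forall>v t. norm v = 1 \<longrightarrow> \<zeta> \<bullet> v = 0 \<longrightarrow> F t v = G t (- v)"
    note O = O_zeta_properties[OF z]
    have OO: "O_zeta \<zeta> (O_zeta \<zeta> x) = x" for x
      using z by (simp add: O_zeta_def norm_eq_1 inner_diff_left)
    have "support_fun K x = x \<bullet> (m - O_zeta \<zeta> m') + support_fun (O_zeta \<zeta> ` L) x" for x
    proof -
      obtain r v where v: "norm v = 1" "\<zeta> \<bullet> v = 0" "0 \<le> r" and x: "x = (x \<bullet> \<zeta>) *\<^sub>R \<zeta> + r *\<^sub>R v"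
        by (rule unit_decomposition[OF dim' z])
      have "centered_support K m ((x \<bullet> \<zeta>) *\<^sub>R \<zeta> + r *\<^sub>R v) = centered_support L m' ((1 * (x \<bullet> \<zeta>)) *\<^sub>R \<zeta> + r *\<^sub>R (- v))"
        by (rule homogeneous_extension[OF KL _ v(3)]) (use eq v(1,2) in \<open>simp_all add: F_def G_def\<close>)
      \<comment> \<open>Reversing the component in the hyperplane while keeping the one along
        \<zeta> is exactly \<open>O_zeta \<zeta>\<close>.\<close>
      moreover have "(1 * (x \<bullet> \<zeta>)) *\<^sub>R \<zeta> + r *\<^sub>R (- v) = O_zeta \<zeta> x"
      proof -
        have "r *\<^sub>R v = x - (x \<bullet> \<zeta>) *\<^sub>R \<zeta>" using x by (metis add_diff_cancel_left')
        then show ?thesis by (simp add: O_zeta_def scaleR_2 flip: scaleR_scaleR)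
      qed
      ultimately have "centered_support K m x = centered_support L m' (O_zeta \<zeta> x)" using x by simp
      moreover have "m' \<bullet> O_zeta \<zeta> x = x \<bullet> O_zeta \<zeta> m'"
        by (simp add: O_zeta_def inner_diff_right inner_commute)
      moreover have "support_fun (O_zeta \<zeta> ` L) x = support_fun L (O_zeta \<zeta> x)"
        using support_fun_orthogonal_image[OF O(1), of L "O_zeta \<zeta> x"] by (simp add: OO)
      ultimately show ?thesis by (simp add: centered_support_def inner_diff_right inner_commute)
    qed
    moreover have "compact (O_zeta \<zeta> ` L)" "convex (O_zeta \<zeta> ` L)" "O_zeta \<zeta> ` L \<noteq> {}"
      using L O(1) by (auto intro!: compact_continuous_image convex_linear_image linear_continuous_on
        simp: linear_linear orthogonal_transformation_def)
    ultimately have "K = (+) (m - O_zeta \<zeta> m') ` O_zeta \<zeta> ` L"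
      by (intro eq_translation_if_support_fun bodies)
    then show ?thesis by blast
  qed
qed

section \<open>Three-dimensional subspaces of the hyperplane\<close>

lemma exists_minus_on_3dim:
  fixes G :: "(real^'n) set"
  assumes G: "subspace G" "dim G = 3"
  obtains N where "N \<in> O_on G" "det (matrix N) = - 1" "\<And>x. x \<in> G \<Longrightarrow> N x = - x"
proof -
  obtain B where B: "B \<subseteq> G" "pairwise orthogonal B" "\<And>x. x \<in> B \<Longrightarrow> norm x = 1" "independent B" "card B = dim G" "span B = G"
    using orthonormal_basis_subspace[OF G(1)] by blast
  have "card B = 3" using B(5) G(2) by simp
  then obtain a b c where abc: "B = {a, b, c}" "a \<noteq> b" "a \<noteq> c" "b \<noteq> c" by (auto simp: card_3_iff)
  have n: "norm a = 1" "norm b = 1" "norm c = 1" using B(3) abc(1) by auto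
  have o: "a \<bullet> b = 0" "a \<bullet> c = 0" "b \<bullet> c = 0" "b \<bullet> a = 0" "c \<bullet> a = 0" "c \<bullet> b = 0"
    using B(2) abc by (auto simp: pairwise_def orthogonal_def)
  have mem: "a \<in> G" "b \<in> G" "c \<in> G" using B(1) abc(1) by auto
  \<comment> \<open>One reflection for each vector of an orthonormal basis of \<open>G\<close>; the
    dimension being odd, the determinant is - 1.\<close>
  define N where "N = reflect a \<circ> (reflect b \<circ> reflect c)"
  show thesis
  proof (rule that)
    show O: "N \<in> O_on G" unfolding N_def by (intro O_on_compose reflect_in_O_on n mem)
    show "det (matrix N) = - 1"
      unfolding N_def using n by (simp add: det_compose linear_compose linear_reflect det_reflect)
    fix x assume x: "x \<in> G"
    have "N a = - a" "N b = - b" "N c = - c"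
      using n o by (simp_all add: N_def reflect_fixes reflect_self)
    then have "N v = - v" if "v \<in> B" for v using that abc(1) by auto
    moreover have "linear (\<lambda>x. - x :: real^'n)" by (simp add: linear_iff)
    moreover have "x \<in> span B" using x B(6) by simp
    ultimately show "N x = - x" using linear_eq_on_span[OF O_onD(2)[OF O]] by blast
  qed
qed

text \<open>On a 3-dimensional \<open>G\<close> orthogonal to \<open>\<zeta>\<close>, the projection of \<open>O_zeta \<zeta> ` L\<close> is a point
  reflection of that of \<open>L\<close>, so the congruence composed with \<open>- id\<close> is a symmetry of determinant
  \<open>- 1\<close>.\<close>

lemma rigid_motion_symmetry_if_O_zeta:
  fixes K L :: "(real^'n) set"
  assumes K: "compact K" "convex K" "K \<noteq> {}" and L: "compact L" "convex L" "L \<noteq> {}"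
    and z: "norm \<zeta> = 1" and eq: "K = (+) b ` (O_zeta \<zeta> ` L)"
    and G: "subspace G" "dim G = 3" "G \<subseteq> {\<zeta>}\<^sup>\<bottom>"
    and cong: "directly_congruent G (orth_proj K G) (orth_proj L G)"
  shows "rigid_motion_symmetry G (orth_proj K G)"
proof -
  note O = O_zeta_properties[OF z]
  obtain \<phi> a where \<phi>: "\<phi> \<in> SO_on G" "a \<in> G" "\<phi> ` orth_proj K G = (+) a ` orth_proj L G"
    using cong by (auto simp: directly_congruent_def)
  have \<phi>O: "\<phi> \<in> O_on G" and det: "det (matrix \<phi>) = 1" using \<phi>(1) by (simp_all add: SO_on_def)
  obtain N where N: "N \<in> O_on G" "det (matrix N) = - 1" "\<And>x. x \<in> G \<Longrightarrow> N x = - x"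
    using exists_minus_on_3dim[OF G(1,2)] by blast
  obtain q where q: "q \<in> G" "b - q \<in> G\<^sup>\<bottom>" using orth_decomposition[OF G(1)] .
  define \<psi> where "\<psi> = N \<circ> \<phi>"
  have \<psi>O: "\<psi> \<in> O_on G" unfolding \<psi>_def by (rule O_on_compose[OF N(1) \<phi>O])
  have "det (matrix \<psi>) = - 1"
    unfolding \<psi>_def using det N(2) O_onD(2)[OF N(1)] O_onD(2)[OF \<phi>O] by (simp add: det_compose)
  then have ne: "\<psi> \<noteq> id" by auto
  have cG: "- a - q \<in> G" using \<phi>(2) q(1) G(1) by (simp add: subspace_diff subspace_neg)
  have "\<psi> ` orth_proj K G = (+) (- a - q) ` orth_proj K G"
  proof (subst congruent_orth_proj_iff[OF G(1) K K \<psi>O cG], intro ballI)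
    fix x assume x: "x \<in> G"
    have \<phi>x: "\<phi> x \<in> G" using O_on_maps[OF G(1) \<phi>O] x by simp
    have \<psi>x: "\<psi> x = - \<phi> x" using N(3)[OF \<phi>x] by (simp add: \<psi>_def)
    have OL: "compact (O_zeta \<zeta> ` L)" "O_zeta \<zeta> ` L \<noteq> {}"
      using L O(1) by (auto intro!: compact_continuous_image linear_continuous_on
        simp: linear_linear orthogonal_transformation_def)
    have "O_zeta \<zeta> (\<phi> x) = - \<phi> x" using O(3) \<phi>x G(3) by blast
    then have "support_fun (O_zeta \<zeta> ` L) (- \<phi> x) = support_fun L (\<phi> x)"
      using support_fun_orthogonal_image[OF O(1), of L "\<phi> x"] by simp
    then have "support_fun K (- \<phi> x) = - \<phi> x \<bullet> b + support_fun L (\<phi> x)"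
      unfolding eq support_fun_translation[OF OL] by simp
    moreover have "support_fun K x = \<phi> x \<bullet> a + support_fun L (\<phi> x)"
      using congruent_orth_proj_iff[OF G(1) K L \<phi>O \<phi>(2)] \<phi>(3) x by blast
    moreover have "\<phi> x \<bullet> q = \<phi> x \<bullet> b" by (rule inner_orth_proj[OF \<phi>x q(2)])
    ultimately show "support_fun K x = \<psi> x \<bullet> (- a - q) + support_fun K (\<psi> x)"
      unfolding \<psi>x by (simp add: inner_diff_right)
  qed
  then show ?thesis unfolding rigid_motion_symmetry_def using \<psi>O ne cG by blast
qed

lemma exists_3dim_orthogonal_subspace:
  fixes \<zeta> :: "real^'n"
  assumes dim: "4 \<le> CARD('n)" and z: "norm \<zeta> = 1"
  obtains G where "subspace G" "dim G = 3" "G \<subseteq> {\<zeta>}\<^sup>\<bottom>"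
proof -
  have d: "4 \<le> DIM(real^'n)" using dim by simp
  obtain p where p: "p \<in> opair \<zeta>" by (rule exists_pspan_containing[OF dim z])
  then obtain x y where xy: "(x, y) \<in> opair \<zeta>" by (cases p) auto
  obtain w where w: "(x, w) \<in> opair \<zeta>" "(y, w) \<in> opair \<zeta>" by (rule opair_frame[OF d xy])
  have "dim (span {x, y, w}) = 3" using xy w by (intro dim_span3) (auto simp: opair_def)
  moreover have "span {x, y, w} \<subseteq> {\<zeta>}\<^sup>\<bottom>"
    using xy w by (intro span_minimal subspace_orthogonal_comp) (auto simp: orthogonal_comp_def orthogonal_def opair_def)
  ultimately show thesis by (intro that[of "span {x, y, w}"]) auto
qed

theorem corollary1:
  fixes K L :: "(real^'n) set" and \<zeta> :: "real^'n"
  assumes "CARD('n) \<ge> 4"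
    and "convex_body K" and "convex_body L"
    and "countably_many_diameters K" and "countably_many_diameters L"
    and "\<zeta> \<in> sphere 0 1"
    and "has_diameter_parallel K \<zeta>"
    and "\<And>H. subspace H \<Longrightarrow> dim H = 3 \<Longrightarrow> \<zeta> \<in> H \<Longrightarrow>
           directly_congruent H (orth_proj K H) (orth_proj L H)"
    and "\<And>H. subspace H \<Longrightarrow> dim H = 3 \<Longrightarrow> \<zeta> \<in> H \<Longrightarrow>
           \<not> pi_symmetry H \<zeta> (orth_proj K H) \<and> \<not> pi_symmetry H \<zeta> (orth_proj L H)"
    and "\<And>H u. subspace H \<Longrightarrow> dim H = 3 \<Longrightarrow> \<zeta> \<in> H \<Longrightarrow> u \<in> {\<zeta>}\<^sup>\<bottom> \<inter> H \<inter> sphere 0 1 \<Longrightarrow>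
           \<not> pi_symmetry H u (orth_proj K H) \<and> \<not> pi_symmetry H u (orth_proj L H)"
  shows "((\<exists>b. K = (+) b ` L) \<or> (\<exists>b. K = (+) b ` (O_zeta \<zeta> ` L))) \<and>
    ((\<forall>G. subspace G \<and> dim G = 3 \<and> G \<subseteq> {\<zeta>}\<^sup>\<bottom> \<longrightarrow>
         directly_congruent G (orth_proj K G) (orth_proj L G) \<and>
         \<not> rigid_motion_symmetry G (orth_proj K G) \<and>
         \<not> rigid_motion_symmetry G (orth_proj L G))
     \<longrightarrow> (\<exists>b. K = (+) b ` L))"
proof -
  have z: "norm \<zeta> = 1" using assms(6) by simp
  have K: "compact K" "convex K" "K \<noteq> {}" and L: "compact L" "convex L" "L \<noteq> {}"
    using assms(2,3) interior_subset by (auto simp: convex_body_def)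
  obtain m d where d: "0 < d" and DK: "diameter_body \<zeta> d m K"
    by (rule diameter_endpoints[OF assms(2,7) z], rule that) (use K in \<open>auto simp: diameter_body_def\<close>)
  note H = subspace_span dim_pspan[OF z] zeta_in_pspan
  have det: "(\<exists>b. K = (+) b ` L) \<or> (\<exists>b. K = (+) b ` (O_zeta \<zeta> ` L))"
  proof (rule bodies_determined[OF assms(1) z DK L d])
    show "countable (max_width_directions L)" using assms(5) by (simp add: countably_many_diameters_def)
    show "directly_congruent (pspan \<zeta> p) (orth_proj K (pspan \<zeta> p)) (orth_proj L (pspan \<zeta> p))"
      if "p \<in> opair \<zeta>" for p by (rule assms(8)[OF H(1) H(2)[OF that] H(3)])
    show "\<not> pi_symmetry (pspan \<zeta> p) \<zeta> (orth_proj K (pspan \<zeta> p))" if "p \<in> opair \<zeta>" for p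
      using assms(9)[OF H(1) H(2)[OF that] H(3)] by blast
    show "\<not> pi_symmetry (pspan \<zeta> p) u (orth_proj K (pspan \<zeta> p))"
      if "p \<in> opair \<zeta>" "u \<in> {\<zeta>}\<^sup>\<bottom> \<inter> pspan \<zeta> p \<inter> sphere 0 1" for p u
      using assms(10)[OF H(1) H(2)[OF that(1)] H(3) that(2)] by blast
  qed
  \<comment> \<open>Such a subspace exists, so the additional hypothesis is not vacuous; on it the
    \<open>O_zeta\<close> case would create a forbidden symmetry.\<close>
  obtain G where G: "subspace G" "dim G = 3" "G \<subseteq> {\<zeta>}\<^sup>\<bottom>"
    by (rule exists_3dim_orthogonal_subspace[OF assms(1) z])
  have "\<exists>b. K = (+) b ` L"
    if add: "\<forall>G. subspace G \<and> dim G = 3 \<and> G \<subseteq> {\<zeta>}\<^sup>\<bottom> \<longrightarrow>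
         directly_congruent G (orth_proj K G) (orth_proj L G) \<and>
         \<not> rigid_motion_symmetry G (orth_proj K G) \<and>
         \<not> rigid_motion_symmetry G (orth_proj L G)"
    using det
  proof
    assume "\<exists>b. K = (+) b ` (O_zeta \<zeta> ` L)"
    then obtain b where "K = (+) b ` (O_zeta \<zeta> ` L)" by blast
    from rigid_motion_symmetry_if_O_zeta[OF K L z this G] show ?thesis using add G by blast
  qed
  with det show ?thesis by blast
qed

end
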